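(* Let $K$ be a connected compact Lie group, $L\subset K$ a closed subgroup, $M=K/L$, $n=\dim M$, and let $g$ be a $K$-invariant Riemannian metric on $M$. Let $\lambda>0$ be an eigenvalue of the Laplace operator on $M$, with eigenspace $W_\lambda=\{u\in C^\infty(M,\mathbb R):\Delta u+\lambda u=0\}$, let $H\subset W_\lambda$ be a nonzero $K$-invariant subspace of dimension $N$, let $\{f_i\}_{i=1}^N$ be an orthonormal basis of $H$, and let $f=(f_1,\ldots,f_N):M\to\mathbb R^N$. Assume that the isotropy representation of $L$ in the tangent space to $M$ at the base point $eL$ is irreducible. Then: 1) the mapping $f:M\to f(M)$ is a covering of some degree $d$ and a local isometry up to a dilation (with $f(M)$ carrying the Riemannian metric induced from $\mathbb R^N$); 2) the inverse image of the Euclidean metric $\sum_i dt_i^2$ on $\mathbb R^N$ is given by $$f^*\Bigl(\sum_{i=1}^N dt_i^2\Bigr)=\frac{\lambda N}{n\,\mathrm{vol}\,M}\cdot g,$$ and the volume of $f(M)\subset S^{N-1}(R)$, where $S^{N-1}(R)\subset\mathbb R^N$ is the sphere of radius $R=\sqrt{N/\mathrm{vol}\,M}$ centered at the origin, is equal to $$\mathrm{vol}\,f(M)=\frac1d\cdot\Bigl(\frac{\lambda N}{n\,\mathrm{vol}\,M}\Bigr)^{n/2}\cdot\mathrm{vol}\,M.$$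
   Context: All functions are real valued. $\Delta=\mathrm{div}\,\mathrm{grad}$ is the Laplace operator of $g$, and $\mathrm{vol}\,M$ is the Riemannian volume of $(M,g)$. $K$ acts on functions by $(k\cdot u)(x)=u(k^{-1}x)$. Orthonormality is with respect to the scalar product $(f_1,f_2)=\int_M f_1(x)f_2(x)\,dx$, where $dx$ is the Riemannian measure. $\mathrm{vol}\,f(M)$ is the $n$-dimensional Riemannian volume of the submanifold $f(M)\subset\mathbb R^N$ in the metric induced from the Euclidean metric. *)

theory Defs
  imports "HOL-Analysis.Analysis" "HOL-Algebra.Left_Coset"
begin

section \<open>Smooth maps between normed vector spaces\<close>

primrec Ck_on :: "nat \<Rightarrow> ('a::real_normed_vector \<Rightarrow> 'b::real_normed_vector) \<Rightarrow> 'a set \<Rightarrow> bool" where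
  "Ck_on 0 f S \<longleftrightarrow> continuous_on S f"
| "Ck_on (Suc k) f S \<longleftrightarrow>
     (\<forall>x\<in>S. f differentiable (at x)) \<and>
     (\<forall>v. Ck_on k (\<lambda>x. frechet_derivative f (at x) v) S)"

text \<open>Only used for finite-dimensional domains and open \<open>S\<close>.\<close>
definition smooth_on :: "'a::real_normed_vector set \<Rightarrow> ('a \<Rightarrow> 'b::real_normed_vector) \<Rightarrow> bool" where
  "smooth_on S f \<longleftrightarrow> (\<forall>k. Ck_on k f S)"


section \<open>Smooth manifolds\<close>

text \<open>A chart is a pair of its domain and its coordinate map; the latter is a total function
  whose values outside the domain are irrelevant.  The dimension is that of the model space.
  Atlases need not be maximal: all notions below depend only on the smooth structure
  generated by the atlas.\<close>

type_synonym ('a, 'e) chart = "'a set \<times> ('a \<Rightarrow> 'e)"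

record ('a, 'e) mfd =
  mtop :: "'a topology"
  atlas :: "('a, 'e) chart set"

abbreviation points :: "('a, 'e) mfd \<Rightarrow> 'a set" where
  "points M \<equiv> topspace (mtop M)"

definition cinv :: "('a, 'e) chart \<Rightarrow> 'e \<Rightarrow> 'a" where
  "cinv c = inv_into (fst c) (snd c)"

definition second_countable_top :: "'a topology \<Rightarrow> bool" where
  "second_countable_top X \<longleftrightarrow>
     (\<exists>B. countable B \<and> (\<forall>U\<in>B. openin X U) \<and>
          (\<forall>U. openin X U \<longrightarrow> (\<exists>C\<subseteq>B. U = \<Union>C)))"

definition smooth_manifold :: "('a, 'e::euclidean_space) mfd \<Rightarrow> bool" where
  "smooth_manifold M \<longleftrightarrow>
     Hausdorff_space (mtop M) \<and> second_countable_top (mtop M) \<and>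
     (\<Union>c\<in>atlas M. fst c) = points M \<and>
     (\<forall>c\<in>atlas M. openin (mtop M) (fst c) \<and> open (snd c ` fst c) \<and>
        homeomorphic_map (subtopology (mtop M) (fst c)) (top_of_set (snd c ` fst c)) (snd c)) \<and>
     (\<forall>c\<in>atlas M. \<forall>c'\<in>atlas M. smooth_on (snd c ` (fst c \<inter> fst c')) (snd c' \<circ> cinv c))"

definition smooth_map ::
    "('a, 'e::euclidean_space) mfd \<Rightarrow> ('b, 'f::euclidean_space) mfd \<Rightarrow> ('a \<Rightarrow> 'b) \<Rightarrow> bool" where
  "smooth_map M N F \<longleftrightarrow>
     continuous_map (mtop M) (mtop N) F \<and>
     (\<forall>c\<in>atlas M. \<forall>d\<in>atlas N.
        smooth_on (snd c ` {p \<in> fst c. F p \<in> fst d}) (snd d \<circ> F \<circ> cinv c))"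

text \<open>Smooth functions with values in a vector space.\<close>
definition smooth_fun ::
    "('a, 'e::euclidean_space) mfd \<Rightarrow> ('a \<Rightarrow> 'v::real_normed_vector) \<Rightarrow> bool" where
  "smooth_fun M u \<longleftrightarrow> (\<forall>c\<in>atlas M. smooth_on (snd c ` fst c) (u \<circ> cinv c))"

definition prod_mfd :: "('a, 'e) mfd \<Rightarrow> ('b, 'f) mfd \<Rightarrow> ('a \<times> 'b, 'e \<times> 'f) mfd" where
  "prod_mfd M N =
     \<lparr>mtop = prod_topology (mtop M) (mtop N),
      atlas = {(fst c \<times> fst d, map_prod (snd c) (snd d)) | c d. c \<in> atlas M \<and> d \<in> atlas N}\<rparr>"

definition open_submfd :: "('a, 'e) mfd \<Rightarrow> 'a set \<Rightarrow> ('a, 'e) mfd" where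
  "open_submfd M U =
     \<lparr>mtop = subtopology (mtop M) U, atlas = {(U \<inter> fst c, snd c) | c. c \<in> atlas M}\<rparr>"

definition diffeomorphism ::
    "('a, 'e::euclidean_space) mfd \<Rightarrow> ('b, 'f::euclidean_space) mfd \<Rightarrow> ('a \<Rightarrow> 'b) \<Rightarrow> bool" where
  "diffeomorphism M N F \<longleftrightarrow>
     bij_betw F (points M) (points N) \<and> smooth_map M N F \<and>
     smooth_map N M (inv_into (points M) F)"

definition local_diffeomorphism ::
    "('a, 'e::euclidean_space) mfd \<Rightarrow> ('b, 'f::euclidean_space) mfd \<Rightarrow> ('a \<Rightarrow> 'b) \<Rightarrow> bool" where
  "local_diffeomorphism M N F \<longleftrightarrow>
     (\<forall>p\<in>points M. \<exists>U. p \<in> U \<and> openin (mtop M) U \<and> openin (mtop N) (F ` U) \<and>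
        diffeomorphism (open_submfd M U) (open_submfd N (F ` U)) F)"


section \<open>Tangent vectors and differentials\<close>

text \<open>A tangent vector at \<open>p\<close> is the family of its coordinate vectors with respect to all charts
  around \<open>p\<close>; these are related by the derivatives of the coordinate changes.  The family is
  \<open>0\<close> at every other index, so that a tangent vector is determined by its coordinates.
  The linear structure is pointwise.\<close>

type_synonym ('a, 'e) tvec = "('a, 'e) chart \<Rightarrow> 'e"

definition charts_at :: "('a, 'e) mfd \<Rightarrow> 'a \<Rightarrow> ('a, 'e) chart set" where
  "charts_at M p = {c \<in> atlas M. p \<in> fst c}"

definition chart_at :: "('a, 'e) mfd \<Rightarrow> 'a \<Rightarrow> ('a, 'e) chart" where
  "chart_at M p = (SOME c. c \<in> charts_at M p)"

definition tangent_space :: "('a, 'e::euclidean_space) mfd \<Rightarrow> 'a \<Rightarrow> ('a, 'e) tvec set" where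
  "tangent_space M p =
     {v. (\<forall>c\<in>charts_at M p. \<forall>c'\<in>charts_at M p.
            v c' = frechet_derivative (snd c' \<circ> cinv c) (at (snd c p)) (v c)) \<and>
         (\<forall>c. c \<notin> charts_at M p \<longrightarrow> v c = 0)}"

text \<open>The tangent vector at \<open>p\<close> whose coordinate vector in the chart \<open>c\<close> is \<open>e\<close>.\<close>
definition coord_vec ::
    "('a, 'e::euclidean_space) mfd \<Rightarrow> ('a, 'e) chart \<Rightarrow> 'a \<Rightarrow> 'e \<Rightarrow> ('a, 'e) tvec" where
  "coord_vec M c p e =
     (\<lambda>c'. if c' \<in> charts_at M p
           then frechet_derivative (snd c' \<circ> cinv c) (at (snd c p)) e else 0)"

text \<open>By the chain rule the differentials do not depend on the chart chosen at \<open>p\<close>.\<close>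

definition differential ::
    "('a, 'e::euclidean_space) mfd \<Rightarrow> ('b, 'f::euclidean_space) mfd \<Rightarrow> ('a \<Rightarrow> 'b) \<Rightarrow> 'a
       \<Rightarrow> ('a, 'e) tvec \<Rightarrow> ('b, 'f) tvec" where
  "differential M N F p v =
     (\<lambda>d. if d \<in> charts_at N (F p)
          then frechet_derivative (snd d \<circ> F \<circ> cinv (chart_at M p))
                 (at (snd (chart_at M p) p)) (v (chart_at M p))
          else 0)"

text \<open>For maps into a vector space, whose tangent spaces are identified with the space itself.\<close>
definition dfun ::
    "('a, 'e::euclidean_space) mfd \<Rightarrow> ('a \<Rightarrow> 'v::real_normed_vector) \<Rightarrow> 'a
       \<Rightarrow> ('a, 'e) tvec \<Rightarrow> 'v" where
  "dfun M u p v =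
     frechet_derivative (u \<circ> cinv (chart_at M p)) (at (snd (chart_at M p) p)) (v (chart_at M p))"

definition tangent_subspace ::
    "('a, 'e::euclidean_space) mfd \<Rightarrow> 'a \<Rightarrow> ('a, 'e) tvec set \<Rightarrow> bool" where
  "tangent_subspace M p S \<longleftrightarrow>
     S \<subseteq> tangent_space M p \<and> (\<lambda>_. 0) \<in> S \<and>
     (\<forall>v\<in>S. \<forall>w\<in>S. (\<lambda>c. v c + w c) \<in> S) \<and> (\<forall>a. \<forall>v\<in>S. (\<lambda>c. a *\<^sub>R v c) \<in> S)"


section \<open>Riemannian metrics, Riemannian measure and Laplace operator\<close>

type_synonym ('a, 'e) metric = "'a \<Rightarrow> ('a, 'e) tvec \<Rightarrow> ('a, 'e) tvec \<Rightarrow> real"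

definition riemannian_metric ::
    "('a, 'e::euclidean_space) mfd \<Rightarrow> ('a, 'e) metric \<Rightarrow> bool" where
  "riemannian_metric M g \<longleftrightarrow>
     (\<forall>p\<in>points M.
        (\<forall>v\<in>tangent_space M p. \<forall>w\<in>tangent_space M p. g p v w = g p w v) \<and>
        (\<forall>a b. \<forall>v\<in>tangent_space M p. \<forall>w\<in>tangent_space M p. \<forall>z\<in>tangent_space M p.
           g p (\<lambda>c. a *\<^sub>R v c + b *\<^sub>R w c) z = a * g p v z + b * g p w z) \<and>
        (\<forall>v\<in>tangent_space M p. v \<noteq> (\<lambda>_. 0) \<longrightarrow> g p v v > 0)) \<and>
     (\<forall>c\<in>atlas M. \<forall>e e'. smooth_on (snd c ` fst c)
        (\<lambda>y. g (cinv c y) (coord_vec M c (cinv c y) e) (coord_vec M c (cinv c y) e')))"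

text \<open>The pullback of the Euclidean metric under a map into a Euclidean space.\<close>
definition pullback_euclidean ::
    "('a, 'e::euclidean_space) mfd \<Rightarrow> ('a \<Rightarrow> 'v::euclidean_space) \<Rightarrow> ('a, 'e) metric" where
  "pullback_euclidean M F p v w = dfun M F p v \<bullet> dfun M F p w"

text \<open>\<open>sqrt (det (g\<^sub>i\<^sub>j))\<close> as a function of the coordinates.\<close>
definition vol_density ::
    "('a, real^'n) mfd \<Rightarrow> ('a, real^'n) metric \<Rightarrow> ('a, real^'n) chart \<Rightarrow> real^'n \<Rightarrow> real" where
  "vol_density M g c y =
     sqrt (det (\<chi> i j. g (cinv c y) (coord_vec M c (cinv c y) (axis i 1))
                                    (coord_vec M c (cinv c y) (axis j 1))))"

text \<open>The unique Borel measure that is \<open>sqrt (det (g\<^sub>i\<^sub>j)) dy\<^sub>1 \<dots> dy\<^sub>n\<close> in every chart.\<close>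
definition riemannian_measure ::
    "('a, real^'n) mfd \<Rightarrow> ('a, real^'n) metric \<Rightarrow> 'a measure" where
  "riemannian_measure M g =
     (THE \<mu>. space \<mu> = points M \<and>
             sets \<mu> = sigma_sets (points M) {U. openin (mtop M) U} \<and>
             (\<forall>c\<in>atlas M. \<forall>B\<in>sets \<mu>. B \<subseteq> fst c \<longrightarrow>
                emeasure \<mu> B =
                  (\<integral>\<^sup>+ y. ennreal (vol_density M g c y) * indicator (snd c ` B) y \<partial>lborel)))"

definition riemannian_volume :: "('a, real^'n) mfd \<Rightarrow> ('a, real^'n) metric \<Rightarrow> real" where
  "riemannian_volume M g = measure (riemannian_measure M g) (points M)"

definition gradient ::
    "('a, 'e::euclidean_space) mfd \<Rightarrow> ('a, 'e) metric \<Rightarrow> ('a \<Rightarrow> real) \<Rightarrow> 'a \<Rightarrow> ('a, 'e) tvec" where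
  "gradient M g u p =
     (THE w. w \<in> tangent_space M p \<and> (\<forall>v\<in>tangent_space M p. g p w v = dfun M u p v))"

text \<open>\<open>div X = \<rho>\<^sup>-\<^sup>1 \<Sum>\<^sub>i \<partial>\<^sub>i (\<rho> X\<^sup>i)\<close> with \<open>\<rho> = sqrt (det (g\<^sub>i\<^sub>j))\<close>, which does not depend on
  the chart chosen at \<open>p\<close>.\<close>
definition divergence ::
    "('a, real^'n) mfd \<Rightarrow> ('a, real^'n) metric \<Rightarrow> ('a \<Rightarrow> ('a, real^'n) tvec) \<Rightarrow> 'a \<Rightarrow> real" where
  "divergence M g X p =
     (let c = chart_at M p in
        (\<Sum>i\<in>UNIV. frechet_derivative (\<lambda>y. vol_density M g c y * (X (cinv c y) c $ i))
                     (at (snd c p)) (axis i 1)) / vol_density M g c (snd c p))"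

definition laplacian ::
    "('a, real^'n) mfd \<Rightarrow> ('a, real^'n) metric \<Rightarrow> ('a \<Rightarrow> real) \<Rightarrow> 'a \<Rightarrow> real" where
  "laplacian M g u = divergence M g (gradient M g u)"


section \<open>Function spaces on a manifold\<close>

text \<open>A function on a manifold is represented by its extension by \<open>0\<close> to the ambient type.\<close>

definition smooth_functions :: "('a, 'e::euclidean_space) mfd \<Rightarrow> ('a \<Rightarrow> real) set" where
  "smooth_functions M = {u. smooth_fun M u \<and> (\<forall>x. x \<notin> points M \<longrightarrow> u x = 0)}"

definition eigenspace ::
    "('a, real^'n) mfd \<Rightarrow> ('a, real^'n) metric \<Rightarrow> real \<Rightarrow> ('a \<Rightarrow> real) set" where
  "eigenspace M g lam =
     {u \<in> smooth_functions M. \<forall>x\<in>points M. laplacian M g u x + lam * u x = 0}"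

definition function_subspace :: "('a \<Rightarrow> real) set \<Rightarrow> bool" where
  "function_subspace H \<longleftrightarrow>
     (\<lambda>_. 0) \<in> H \<and> (\<forall>u\<in>H. \<forall>v\<in>H. (\<lambda>x. u x + v x) \<in> H) \<and>
     (\<forall>a. \<forall>u\<in>H. (\<lambda>x. a * u x) \<in> H)"

definition L2_prod ::
    "('a, real^'n) mfd \<Rightarrow> ('a, real^'n) metric \<Rightarrow> ('a \<Rightarrow> real) \<Rightarrow> ('a \<Rightarrow> real) \<Rightarrow> real" where
  "L2_prod M g u v = (\<integral>x. u x * v x \<partial>(riemannian_measure M g))"

text \<open>The components of \<open>f\<close> form an orthonormal basis of \<open>H\<close>; in particular
  \<open>dim H = CARD('N)\<close>.\<close>
definition orthonormal_basis ::
    "('a, real^'n) mfd \<Rightarrow> ('a, real^'n) metric \<Rightarrow> ('a \<Rightarrow> real) set \<Rightarrow> ('a \<Rightarrow> real^'N) \<Rightarrow> bool" where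
  "orthonormal_basis M g H f \<longleftrightarrow>
     (\<forall>i. (\<lambda>x. f x $ i) \<in> H) \<and>
     (\<forall>i j. L2_prod M g (\<lambda>x. f x $ i) (\<lambda>x. f x $ j) = (if i = j then 1 else 0)) \<and>
     (\<forall>u\<in>H. \<exists>a::'N \<Rightarrow> real. u = (\<lambda>x. \<Sum>i\<in>UNIV. a i * f x $ i))"


section \<open>Lie groups and homogeneous spaces\<close>

definition lie_group :: "('k, 'b) monoid_scheme \<Rightarrow> ('k, 'd::euclidean_space) mfd \<Rightarrow> bool" where
  "lie_group K KM \<longleftrightarrow>
     group K \<and> smooth_manifold KM \<and> points KM = carrier K \<and>
     smooth_map (prod_mfd KM KM) KM (\<lambda>(x, y). x \<otimes>\<^bsub>K\<^esub> y) \<and>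
     smooth_map KM KM (\<lambda>x. inv\<^bsub>K\<^esub> x)"

text \<open>\<open>M\<close> is the set of left cosets of \<open>L\<close> with the quotient topology and the unique smooth
  structure making the projection a submersion.\<close>
definition homogeneous_space ::
    "('k, 'b) monoid_scheme \<Rightarrow> ('k, 'd::euclidean_space) mfd \<Rightarrow> 'k set
       \<Rightarrow> ('k set, 'e::euclidean_space) mfd \<Rightarrow> bool" where
  "homogeneous_space K KM L M \<longleftrightarrow>
     smooth_manifold M \<and> points M = lcosets\<^bsub>K\<^esub> L \<and>
     quotient_map (mtop KM) (mtop M) (\<lambda>x. x <#\<^bsub>K\<^esub> L) \<and>
     smooth_map KM M (\<lambda>x. x <#\<^bsub>K\<^esub> L) \<and>
     (\<forall>x\<in>carrier K. differential KM M (\<lambda>x. x <#\<^bsub>K\<^esub> L) x ` tangent_space KM x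
                      = tangent_space M (x <#\<^bsub>K\<^esub> L))"

text \<open>The action of \<open>k\<close> on cosets is \<open>x \<mapsto> k <# x\<close>.\<close>

definition invariant_metric ::
    "('k, 'b) monoid_scheme \<Rightarrow> ('k set, 'e::euclidean_space) mfd \<Rightarrow> ('k set, 'e) metric \<Rightarrow> bool" where
  "invariant_metric K M g \<longleftrightarrow>
     (\<forall>k\<in>carrier K. \<forall>p\<in>points M. \<forall>v\<in>tangent_space M p. \<forall>w\<in>tangent_space M p.
        g (k <#\<^bsub>K\<^esub> p) (differential M M (\<lambda>x. k <#\<^bsub>K\<^esub> x) p v)
                      (differential M M (\<lambda>x. k <#\<^bsub>K\<^esub> x) p w) = g p v w)"

definition act_fun ::
    "('k, 'b) monoid_scheme \<Rightarrow> ('k set, 'e) mfd \<Rightarrow> 'k \<Rightarrow> ('k set \<Rightarrow> real) \<Rightarrow> 'k set \<Rightarrow> real" where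
  "act_fun K M k u = (\<lambda>x. if x \<in> points M then u ((inv\<^bsub>K\<^esub> k) <#\<^bsub>K\<^esub> x) else 0)"

definition invariant_functions ::
    "('k, 'b) monoid_scheme \<Rightarrow> ('k set, 'e) mfd \<Rightarrow> ('k set \<Rightarrow> real) set \<Rightarrow> bool" where
  "invariant_functions K M H \<longleftrightarrow> (\<forall>k\<in>carrier K. \<forall>u\<in>H. act_fun K M k u \<in> H)"

text \<open>The base point \<open>eL\<close> is the coset \<open>L\<close> itself.\<close>
definition isotropy_irreducible ::
    "('k, 'b) monoid_scheme \<Rightarrow> 'k set \<Rightarrow> ('k set, 'e::euclidean_space) mfd \<Rightarrow> bool" where
  "isotropy_irreducible K L M \<longleftrightarrow>
     (\<forall>S. tangent_subspace M L S \<and>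
          (\<forall>l\<in>L. differential M M (\<lambda>x. l <#\<^bsub>K\<^esub> x) L ` S \<subseteq> S) \<longrightarrow>
          S = {\<lambda>_. 0} \<or> S = tangent_space M L)"


section \<open>Submanifolds of Euclidean space, coverings, local isometries up to a dilation\<close>

text \<open>\<open>S\<close> is the set \<open>Q\<close> with the subspace topology and the structure of an embedded
  submanifold.\<close>
definition embedded_submanifold ::
    "('v, 'e::euclidean_space) mfd \<Rightarrow> 'v::euclidean_space set \<Rightarrow> bool" where
  "embedded_submanifold S Q \<longleftrightarrow>
     smooth_manifold S \<and> mtop S = top_of_set Q \<and> smooth_fun S (\<lambda>x. x) \<and>
     (\<forall>p\<in>Q. inj_on (dfun S (\<lambda>x. x) p) (tangent_space S p))"

definition induced_metric :: "('v::euclidean_space, 'e::euclidean_space) mfd \<Rightarrow> ('v, 'e) metric" where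
  "induced_metric S = pullback_euclidean S (\<lambda>x. x)"

definition covering_of_degree :: "'a topology \<Rightarrow> 'b topology \<Rightarrow> ('a \<Rightarrow> 'b) \<Rightarrow> nat \<Rightarrow> bool" where
  "covering_of_degree X Y p d \<longleftrightarrow>
     continuous_map X Y p \<and> p ` topspace X = topspace Y \<and>
     (\<forall>y\<in>topspace Y. \<exists>T. y \<in> T \<and> openin Y T \<and>
        (\<exists>\<V>. \<Union>\<V> = {x \<in> topspace X. p x \<in> T} \<and> (\<forall>U\<in>\<V>. openin X U) \<and> pairwise disjnt \<V> \<and>
             (\<forall>U\<in>\<V>. homeomorphic_map (subtopology X U) (subtopology Y T) p))) \<and>
     d > 0 \<and> (\<forall>y\<in>topspace Y. card {x \<in> topspace X. p x = y} = d)"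

definition local_isometry_up_to_dilation ::
    "('a, 'e::euclidean_space) mfd \<Rightarrow> ('a, 'e) metric \<Rightarrow> ('b, 'f::euclidean_space) mfd
       \<Rightarrow> ('b, 'f) metric \<Rightarrow> ('a \<Rightarrow> 'b) \<Rightarrow> bool" where
  "local_isometry_up_to_dilation M g S h F \<longleftrightarrow>
     local_diffeomorphism M S F \<and>
     (\<exists>c>0. \<forall>p\<in>points M. \<forall>v\<in>tangent_space M p. \<forall>w\<in>tangent_space M p.
        h (F p) (differential M S F p v) (differential M S F p w) = c * g p v w)"

end

theory Submission
  imports Defs
begin

text \<open>Since \<open>H\<close> and the \<open>L\<^sup>2\<close> product are invariant under \<open>K\<close>, there are orthogonal matrices \<open>A k\<close> with
  \<open>f (k x) = A k (f x)\<close>. Hence \<open>\<bar>f\<bar>\<^sup>2\<close> is constant, and integrating it over \<open>M\<close> gives \<open>N / V\<close>; moreover the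
  pullback of the Euclidean metric is invariant, so by Schur's lemma it is \<open>C g\<close> for a constant \<open>C\<close>.
  Taking the divergence of \<open>\<Sum>\<^sub>i f\<^sub>i grad f\<^sub>i = 0\<close> gives \<open>\<Sum>\<^sub>i \<bar>grad f\<^sub>i\<bar>\<^sup>2 = \<lambda> \<bar>f\<bar>\<^sup>2\<close>, whose left-hand side is
  \<open>n C\<close>; this determines \<open>C\<close>.

  In particular \<open>f\<close> is an immersion. It is open onto its image because the preimage in \<open>K\<close> of \<open>f ` U\<close> is
  a union of right translates of the preimage of \<open>U\<close>; so it is a local homeomorphism with finite fibers
  that are permuted by \<open>K\<close>, that is, a covering. The charts of the image are those of \<open>M\<close> transported along
  the local inverses of \<open>f\<close>. The Riemannian measure scales by \<open>C\<^bsup>n/2\<^esup>\<close> on each sheet.\<close>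

section \<open>Calculus of \<open>C\<^sup>k\<close> maps\<close>

text \<open>\<open>riemannian_measure\<close> and \<open>gradient\<close> are definite descriptions,
  and differentials are read in a chart chosen at the point; existence, uniqueness and independence
  of the chart must therefore come before the geometry. One principle is used throughout: an
  injective differentiable map that multiplies the metric by C multiplies volumes by C to the power
  n/2. For the identity it gives existence and uniqueness of the Riemannian measure, for the action
  its invariance (hence the orthogonality of \<open>A k\<close>), and for \<open>f\<close> on a
  sheet the volume of the image. The action is obtained as a differentiable map, from local sections
  of the submersion; this suffices for transporting tangent vectors. The image of an immersion need
  not be a submanifold. Its coordinate changes are at first only continuous lifts of
  \<open>f\<close> through \<open>f\<close>; their smoothness is bootstrapped from the immersion
  property. Finiteness and positivity of the volume come out of the normalization of the components
  of \<open>f\<close>.\<close>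

lemma Ck_on_cong:
  assumes "open S" "\<And>x. x \<in> S \<Longrightarrow> f x = g x" "Ck_on k f S"
  shows "Ck_on k g S"
  using assms(2,3)
proof (induction k arbitrary: f g)
  case 0
  then show ?case by (metis Ck_on.simps(1) continuous_on_cong)
next
  case (Suc k)
  \<comment> \<open>Openness of \<open>S\<close> enters here: a derivative \<open>at x\<close> sees
    the values of the function off \<open>S\<close> as well.\<close>
  have d: "(g has_derivative frechet_derivative f (at x)) (at x)" if "x \<in> S" for x
    using Suc.prems that assms(1)
    by (metis Ck_on.simps(2) frechet_derivative_works has_derivative_transform_within_open)
  have "frechet_derivative f (at x) v = frechet_derivative g (at x) v" if "x \<in> S" for x v
    using frechet_derivative_at[OF d[OF that]] by simp
  then have "Ck_on k (\<lambda>x. frechet_derivative g (at x) v) S" for v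
    by (rule Suc.IH[of "\<lambda>x. frechet_derivative f (at x) v"]) (use Suc.prems in auto)
  then show ?case using d by (auto simp: differentiable_def)
qed

text \<open>\<open>Ck_on\<close> speaks of \<open>frechet_derivative\<close>; accepting any family
  of derivatives instead lets the closure properties below follow from the
  \<open>has_derivative\<close> rules.\<close>

lemma Ck_on_SucI:
  assumes "open S" "\<And>x. x \<in> S \<Longrightarrow> (f has_derivative f' x) (at x)"
    and "\<And>v. Ck_on k (\<lambda>x. f' x v) S"
  shows "Ck_on (Suc k) f S"
proof -
  have "Ck_on k (\<lambda>x. frechet_derivative f (at x) v) S" for v
    by (rule Ck_on_cong[OF assms(1) _ assms(3)[of v]]) (metis assms(2) frechet_derivative_at)
  then show ?thesis
    using assms(2) by (auto simp: differentiable_def)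
qed

lemma Ck_on_SucD:
  assumes "Ck_on (Suc k) f S"
  shows "\<And>x. x \<in> S \<Longrightarrow> (f has_derivative frechet_derivative f (at x)) (at x)"
    and "\<And>v. Ck_on k (\<lambda>x. frechet_derivative f (at x) v) S"
  using assms frechet_derivative_works by auto

lemma Ck_on_subset: "Ck_on k f S \<Longrightarrow> T \<subseteq> S \<Longrightarrow> Ck_on k f T"
  by (induction k arbitrary: f) (auto intro: continuous_on_subset)

lemma Ck_on_Suc_imp: "Ck_on (Suc k) f S \<Longrightarrow> Ck_on k f S"
proof (induction k arbitrary: f)
  case 0
  then show ?case
    by (auto intro!: differentiable_imp_continuous_on simp: differentiable_on_def differentiable_at_withinI)
next
  case (Suc k)
  then show ?case by auto
qed

lemma Ck_on_imp_continuous_on: "Ck_on k f S \<Longrightarrow> continuous_on S f"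
  by (induction k) (auto dest: Ck_on_Suc_imp simp del: Ck_on.simps(2))

lemma Ck_on_const [simp]: "Ck_on k (\<lambda>x. c) S"
  by (induction k arbitrary: c) auto

lemma Ck_on_bounded_linear_compose:
  assumes "bounded_linear h" "open S" "Ck_on k f S"
  shows "Ck_on k (\<lambda>x. h (f x)) S"
  using assms(3)
proof (induction k arbitrary: f)
  case 0
  then show ?case using bounded_linear.continuous_on[OF assms(1)] by simp
next
  case (Suc k)
  show ?case
    by (rule Ck_on_SucI[OF assms(2) bounded_linear.has_derivative[OF assms(1) Ck_on_SucD(1)[OF Suc.prems]]])
       (use Suc in auto)
qed

lemma Ck_on_bounded_linear: "bounded_linear h \<Longrightarrow> open S \<Longrightarrow> Ck_on k h S"
proof (cases k)
  case 0
  then show "bounded_linear h \<Longrightarrow> open S \<Longrightarrow> Ck_on k h S" by (simp add: linear_continuous_on)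
next
  case (Suc j)
  assume "bounded_linear h" "open S"
  with Suc show ?thesis
    by (auto intro!: Ck_on_SucI[OF _ bounded_linear_imp_has_derivative] simp del: Ck_on.simps)
qed

lemma Ck_on_add:
  assumes "open S" "Ck_on k f S" "Ck_on k g S"
  shows "Ck_on k (\<lambda>x. f x + g x) S"
  using assms(2,3)
proof (induction k arbitrary: f g)
  case 0
  then show ?case by (simp add: continuous_on_add)
next
  case (Suc k)
  show ?case
    by (rule Ck_on_SucI[OF assms(1) has_derivative_add[OF Ck_on_SucD(1)[OF Suc.prems(1)] Ck_on_SucD(1)[OF Suc.prems(2)]]])
       (use Suc in auto)
qed

lemma Ck_on_sum:
  assumes "open S" "\<And>i. i \<in> I \<Longrightarrow> Ck_on k (f i) S"
  shows "Ck_on k (\<lambda>x. \<Sum>i\<in>I. f i x) S"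
  using assms(2) by (induction I rule: infinite_finite_induct) (auto intro!: Ck_on_add[OF assms(1)])

lemma Ck_on_bilinear:
  assumes "bounded_bilinear h" "open S" "Ck_on k f S" "Ck_on k g S"
  shows "Ck_on k (\<lambda>x. h (f x) (g x)) S"
  using assms(3,4)
proof (induction k arbitrary: f g)
  case 0
  then show ?case using bounded_bilinear.continuous_on[OF assms(1)] by simp
next
  case (Suc k)
  show ?case
    by (rule Ck_on_SucI[OF assms(2) bounded_bilinear.FDERIV[OF assms(1) Ck_on_SucD(1)[OF Suc.prems(1)] Ck_on_SucD(1)[OF Suc.prems(2)]]])
       (assumption | intro Ck_on_add[OF assms(2)] Suc.IH Ck_on_Suc_imp[OF Suc.prems(1)] Ck_on_Suc_imp[OF Suc.prems(2)]
          Ck_on_SucD(2)[OF Suc.prems(1)] Ck_on_SucD(2)[OF Suc.prems(2)])+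
qed

lemmas Ck_on_mult = Ck_on_bilinear[OF bounded_bilinear_mult]
lemmas Ck_on_scaleR = Ck_on_bilinear[OF bounded_bilinear_scaleR]
lemmas Ck_on_inner = Ck_on_bilinear[OF bounded_bilinear_inner]

lemma Ck_on_prod:
  fixes f :: "'i \<Rightarrow> 'a::real_normed_vector \<Rightarrow> real"
  assumes "open S" "\<And>i. i \<in> I \<Longrightarrow> Ck_on k (f i) S"
  shows "Ck_on k (\<lambda>x. \<Prod>i\<in>I. f i x) S"
  using assms(2) by (induction I rule: infinite_finite_induct) (auto intro!: Ck_on_mult[OF assms(1)])

lemma Ck_on_inverse:
  fixes f :: "'a::real_normed_vector \<Rightarrow> real"
  assumes "open S" "\<And>x. x \<in> S \<Longrightarrow> f x \<noteq> 0" "Ck_on k f S"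
  shows "Ck_on k (\<lambda>x. inverse (f x)) S"
  using assms(3)
proof (induction k)
  case 0
  then show ?case using assms(2) by (auto intro!: continuous_intros)
next
  case (Suc k)
  have d: "((\<lambda>x. inverse (f x)) has_derivative
     (\<lambda>v. - 1 * (inverse (f x) * frechet_derivative f (at x) v * inverse (f x)))) (at x)" if "x \<in> S" for x
    using Ck_on_SucD(1)[OF Suc.prems that] assms(2)[OF that]
    by (auto intro!: derivative_eq_intros)
  show ?case
  proof (rule Ck_on_SucI[OF assms(1) d])
    have "Ck_on k (\<lambda>x. inverse (f x)) S" by (rule Suc.IH[OF Ck_on_Suc_imp[OF Suc.prems]])
    then show "Ck_on k (\<lambda>x. - 1 * (inverse (f x) * frechet_derivative f (at x) v * inverse (f x))) S" for v
      by (intro Ck_on_mult assms(1) Ck_on_const Ck_on_SucD(2)[OF Suc.prems])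
  qed
qed

text \<open>In the chain rule the direction in which \<open>g\<close> is differentiated varies with
  the point, whereas \<open>Ck_on\<close> controls derivatives in fixed directions. Expanding the
  direction in a basis of the middle space leaves products of scalar functions with derivatives of
  \<open>g\<close> in basis directions, composed with the same \<open>f\<close>; these fall under
  the induction hypothesis.\<close>

lemma Ck_on_compose:
  fixes f :: "'a::real_normed_vector \<Rightarrow> 'b::euclidean_space"
  assumes "open S" "open T" "Ck_on k g T" "Ck_on k f S" "f ` S \<subseteq> T"
  shows "Ck_on k (\<lambda>x. g (f x)) S"
  using assms(3,4)
proof (induction k arbitrary: g)
  case 0
  then show ?case using assms(5) by (auto intro: continuous_on_compose2)
next
  case (Suc k)
  note fd = Ck_on_SucD[OF Suc.prems(2)] and gd = Ck_on_SucD[OF Suc.prems(1)]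
  have d: "((\<lambda>x. g (f x)) has_derivative
     (\<lambda>v. \<Sum>b\<in>Basis. (frechet_derivative f (at x) v \<bullet> b) *\<^sub>R frechet_derivative g (at (f x)) b)) (at x)"
    if "x \<in> S" for x
  proof -
    have fx: "f x \<in> T" using that assms(5) by auto
    have "((\<lambda>x. g (f x)) has_derivative
        (\<lambda>v. frechet_derivative g (at (f x)) (frechet_derivative f (at x) v))) (at x)"
      using diff_chain_at[OF fd(1)[OF that] gd(1)[OF fx]] by (simp add: o_def)
    moreover have expand: "frechet_derivative g (at (f x)) w =
        (\<Sum>b\<in>Basis. (w \<bullet> b) *\<^sub>R frechet_derivative g (at (f x)) b)" for w
    proof -
      interpret linear "frechet_derivative g (at (f x))"
        using gd(1)[OF fx] has_derivative_linear by blast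
      have "frechet_derivative g (at (f x)) w = frechet_derivative g (at (f x)) (\<Sum>b\<in>Basis. (w \<bullet> b) *\<^sub>R b)"
        by (simp only: euclidean_representation)
      then show ?thesis by (simp only: sum scale)
    qed
    ultimately show ?thesis
      by (subst expand[of "frechet_derivative f (at x) v" for v, symmetric])
  qed
  show ?case
  proof (rule Ck_on_SucI[OF assms(1) d])
    fix v
    have "Ck_on k (\<lambda>x. frechet_derivative f (at x) v \<bullet> b) S" for b
      by (rule Ck_on_inner[OF assms(1) fd(2) Ck_on_const])
    moreover have "Ck_on k (\<lambda>x. frechet_derivative g (at (f x)) b) S" for b
      by (rule Suc.IH[OF gd(2) Ck_on_Suc_imp[OF Suc.prems(2)]])
    ultimately show "Ck_on k (\<lambda>x. \<Sum>b\<in>Basis. (frechet_derivative f (at x) v \<bullet> b) *\<^sub>R frechet_derivative g (at (f x)) b) S"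
      by (intro Ck_on_sum Ck_on_scaleR assms(1))
  qed
qed

lemma smooth_on_cong:
  "open S \<Longrightarrow> (\<And>x. x \<in> S \<Longrightarrow> f x = g x) \<Longrightarrow> smooth_on S f \<Longrightarrow> smooth_on S g"
  unfolding smooth_on_def using Ck_on_cong by blast

lemma smooth_on_subset: "smooth_on S f \<Longrightarrow> T \<subseteq> S \<Longrightarrow> smooth_on T f"
  unfolding smooth_on_def using Ck_on_subset by blast

lemma smooth_on_differentiable: "smooth_on S f \<Longrightarrow> x \<in> S \<Longrightarrow> f differentiable (at x)"
  unfolding smooth_on_def by (metis Ck_on.simps(2))

lemma smooth_on_has_derivative:
  "smooth_on S f \<Longrightarrow> x \<in> S \<Longrightarrow> (f has_derivative frechet_derivative f (at x)) (at x)"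
  by (simp add: frechet_derivative_works[symmetric] smooth_on_differentiable)

lemma smooth_on_imp_continuous_on: "smooth_on S f \<Longrightarrow> continuous_on S f"
  unfolding smooth_on_def by (metis Ck_on.simps(1))

lemma smooth_on_frechet_derivative:
  "smooth_on S f \<Longrightarrow> smooth_on S (\<lambda>x. frechet_derivative f (at x) v)"
  unfolding smooth_on_def by (metis Ck_on.simps(2))

lemma Ck_on_det:
  fixes A :: "'a::real_normed_vector \<Rightarrow> real^'n^'n"
  assumes "open S" "\<And>i j. Ck_on k (\<lambda>x. A x $ i $ j) S"
  shows "Ck_on k (\<lambda>x. det (A x)) S"
  unfolding det_def
  by (intro Ck_on_sum Ck_on_mult Ck_on_prod Ck_on_const assms)

lemma Ck_on_vec:
  fixes f :: "'a::real_normed_vector \<Rightarrow> real^'n"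
  assumes "open S" "\<And>i. Ck_on k (\<lambda>x. f x $ i) S"
  shows "Ck_on k f S"
proof -
  have "Ck_on k (\<lambda>x. \<Sum>i\<in>UNIV. f x $ i *\<^sub>R axis i 1) S"
    by (intro Ck_on_sum Ck_on_scaleR Ck_on_const assms)
  then show ?thesis
    by (rule Ck_on_cong[OF assms(1), rotated])
       (simp add: vec_eq_iff axis_def if_distrib[of "\<lambda>z. _ * z"] cong: if_cong)
qed

text \<open>Cramer's rule expresses the solution of a linear system polynomially in the data, apart
  from one division.\<close>
lemma Ck_on_linear_system:
  fixes A :: "'a::real_normed_vector \<Rightarrow> real^'n^'n"
  assumes S: "open S" and A: "\<And>i j. Ck_on k (\<lambda>x. A x $ i $ j) S" and b: "\<And>i. Ck_on k (\<lambda>x. b x $ i) S"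
    and "\<And>x. x \<in> S \<Longrightarrow> det (A x) \<noteq> 0" and eq: "\<And>x. x \<in> S \<Longrightarrow> A x *v w x = b x"
  shows "Ck_on k w S"
proof (rule Ck_on_vec[OF S])
  fix i
  have "Ck_on k (\<lambda>x. det (\<chi> l m. if m = i then b x $ l else A x $ l $ m) * inverse (det (A x))) S"
  proof (intro Ck_on_mult Ck_on_inverse Ck_on_det S A assms(4); assumption?)
    fix l m show "Ck_on k (\<lambda>x. (\<chi> l m. if m = i then b x $ l else A x $ l $ m) $ l $ m) S"
      using A b by (cases "m = i") auto
  qed
  then show "Ck_on k (\<lambda>x. w x $ i) S"
  proof (rule Ck_on_cong[OF S, rotated])
    fix x assume "x \<in> S"
    then have "w x = (\<chi> k. det (\<chi> i j. if j = k then b x $ i else A x $ i $ j) / det (A x))"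
      using cramer[OF assms(4), of x] eq by blast
    then show "det (\<chi> l m. if m = i then b x $ l else A x $ l $ m) * inverse (det (A x)) = w x $ i"
      by (simp add: divide_inverse)
  qed
qed

section \<open>Local inverses and immersions\<close>

text \<open>The inverse function theorem wants the derivative to be continuous as an operator; on a
  finite-dimensional domain, continuity on each basis vector is enough.\<close>

lemma C1_continuous_blinfun:
  fixes f :: "'a::euclidean_space \<Rightarrow> 'b::real_normed_vector"
  assumes "Ck_on (Suc 0) f U"
  shows "continuous_on U (\<lambda>x. Blinfun (frechet_derivative f (at x)))"
proof (rule continuous_on_blinfun_componentwise)
  fix i :: 'a
  have "continuous_on U (\<lambda>x. frechet_derivative f (at x) i)" using assms by auto
  moreover have "blinfun_apply (Blinfun (frechet_derivative f (at x))) i = frechet_derivative f (at x) i"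
    if "x \<in> U" for x
    using Ck_on_SucD(1)[OF assms that] bounded_linear_Blinfun_apply has_derivative_bounded_linear by metis
  ultimately show "continuous_on U (\<lambda>x. blinfun_apply (Blinfun (frechet_derivative f (at x))) i)"
    by (metis (no_types, lifting) continuous_on_cong)
qed

text \<open>An injective linear map in finite dimension has a linear left inverse, which is the form
  of invertibility that the inverse function theorem takes. The local inverse is recorded as
  differentiable; higher smoothness comes later from
  \<open>smooth_on_lift_immersion\<close>.\<close>

lemma C1_local_inverse:
  fixes f :: "'a::euclidean_space \<Rightarrow> 'a"
  assumes U: "open U" and f: "Ck_on (Suc 0) f U" and x0: "x0 \<in> U"
    and inj: "inj (frechet_derivative f (at x0))"
  obtains U' V g where "open U'" "U' \<subseteq> U" "x0 \<in> U'" "open V" "f x0 \<in> V" "homeomorphism U' V f g"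
    "\<And>y. y \<in> V \<Longrightarrow> g differentiable (at y)"
proof -
  define f' where "f' x = Blinfun (frechet_derivative f (at x))" for x
  have f'_apply: "blinfun_apply (f' x) = frechet_derivative f (at x)" if "x \<in> U" for x
    unfolding f'_def
    using Ck_on_SucD(1)[OF f that] bounded_linear_Blinfun_apply has_derivative_bounded_linear by metis
  have d: "(f has_derivative blinfun_apply (f' x)) (at x)" if "x \<in> U" for x
    using Ck_on_SucD(1)[OF f that] f'_apply[OF that] by simp
  have cont: "continuous_on U f'"
    unfolding f'_def by (rule C1_continuous_blinfun[OF f])
  have "linear (frechet_derivative f (at x0))"
    using Ck_on_SucD(1)[OF f x0] has_derivative_linear by blast
  then obtain h where h: "linear h" "h \<circ> frechet_derivative f (at x0) = id"
    using linear_injective_left_inverse inj by blast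
  have "Blinfun h o\<^sub>L f' x0 = id_blinfun"
    by (rule blinfun_eqI) (use h f'_apply[OF x0] in
        \<open>simp add: bounded_linear_Blinfun_apply linear_conv_bounded_linear o_def fun_eq_iff\<close>)
  from inverse_function_theorem[OF U d cont x0 this]
  obtain U' V g g' where "open U'" "U' \<subseteq> U" "x0 \<in> U'" "open V" "f x0 \<in> V" "homeomorphism U' V f g"
    "\<And>y. y \<in> V \<Longrightarrow> (g has_derivative (g' y)) (at y)" by metis
  then show thesis using that by (metis differentiableI)
qed

text \<open>A left inverse \<open>P\<close> of the derivative reduces the immersion to a map between
  spaces of equal dimension, and \<open>g \<circ> P\<close> is then a left inverse of
  \<open>F\<close> near \<open>y0\<close>.\<close>

lemma immersion_local_inverse:
  fixes F :: "'a::euclidean_space \<Rightarrow> 'b::euclidean_space"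
  assumes Y: "open Y" and F: "Ck_on (Suc 0) F Y" and y0: "y0 \<in> Y"
    and inj: "inj (frechet_derivative F (at y0))"
  obtains P U V g where "bounded_linear (P :: 'b \<Rightarrow> 'a)" "open U" "U \<subseteq> Y" "y0 \<in> U" "open V" "P (F y0) \<in> V"
    "homeomorphism U V (\<lambda>y. P (F y)) g" "\<And>y. y \<in> V \<Longrightarrow> g differentiable (at y)"
proof -
  have lin: "linear (frechet_derivative F (at y0))"
    using Ck_on_SucD(1)[OF F y0] has_derivative_linear by blast
  obtain P where P: "linear P" "P \<circ> frechet_derivative F (at y0) = id"
    using linear_injective_left_inverse[OF lin inj] by blast
  then have bP: "bounded_linear P" by (simp add: linear_conv_bounded_linear)
  have c: "Ck_on (Suc 0) (\<lambda>y. P (F y)) Y" by (rule Ck_on_bounded_linear_compose[OF bP Y F])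
  have "((\<lambda>y. P (F y)) has_derivative (\<lambda>v. P (frechet_derivative F (at y0) v))) (at y0)"
    by (rule bounded_linear.has_derivative[OF bP Ck_on_SucD(1)[OF F y0]])
  then have "frechet_derivative (\<lambda>y. P (F y)) (at y0) = id"
    using P(2) frechet_derivative_at by (force simp: o_def)
  then have "inj (frechet_derivative (\<lambda>y. P (F y)) (at y0))" by simp
  from C1_local_inverse[OF Y c y0 this] that[OF bP] show thesis by metis
qed

text \<open>Differentiating \<open>F' \<circ> \<phi> = F\<close> and passing to the normal equations gives a linear system for
  the derivative of \<open>\<phi>\<close> whose coefficients are as smooth as \<open>\<phi>\<close> itself, so \<open>\<phi>\<close> gains one
  derivative at a time.\<close>
lemma smooth_on_lift_immersion:
  fixes F :: "'m::euclidean_space \<Rightarrow> 'v::euclidean_space" and F' :: "real^'n \<Rightarrow> 'v"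
  assumes X: "open X" and Y: "open Y" and F: "smooth_on X F" and F': "smooth_on Y F'"
    and cont: "continuous_on X \<phi>" and sub: "\<phi> ` X \<subseteq> Y" and eq: "\<And>x. x \<in> X \<Longrightarrow> F' (\<phi> x) = F x"
    and inj: "\<And>y. y \<in> Y \<Longrightarrow> inj (frechet_derivative F' (at y))"
  shows "smooth_on X \<phi>"
proof -
  \<comment> \<open>Continuity keeps \<open>\<phi>\<close> in the neighbourhood on which
    \<open>g\<close> inverts \<open>P \<circ> F'\<close>, so near \<open>x\<close> the map
    \<open>\<phi>\<close> is \<open>g \<circ> P \<circ> F\<close>.\<close>
  have diff: "\<phi> differentiable (at x)" if x: "x \<in> X" for x
  proof -
    have y0: "\<phi> x \<in> Y" using x sub by auto
    have "Ck_on (Suc 0) F' Y" using F' smooth_on_def by blast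
    from immersion_local_inverse[OF Y this y0 inj[OF y0]]
    obtain P U V g where P: "bounded_linear (P :: 'v \<Rightarrow> real^'n)" "open U" "\<phi> x \<in> U" "P (F' (\<phi> x)) \<in> V"
      "homeomorphism U V (\<lambda>y. P (F' y)) g" "\<And>y. y \<in> V \<Longrightarrow> g differentiable (at y)" by metis
    have o: "open (X \<inter> \<phi> -` U)" using cont X P(2) by (simp add: continuous_on_open_vimage Int_commute)
    have "((\<lambda>x. g (P (F x)))) differentiable (at x)"
    proof -
      have "(\<lambda>x. P (F x)) differentiable (at x)"
        using bounded_linear.has_derivative[OF P(1) smooth_on_has_derivative[OF F x]] differentiableI by blast
      moreover have "g differentiable at (P (F x))" using P(4,6) eq[OF x] by simp
      ultimately show ?thesis using differentiable_chain_at[of "\<lambda>x. P (F x)" x g] by (simp add: o_def)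
    qed
    then obtain D where "((\<lambda>x. g (P (F x))) has_derivative D) (at x)" by (auto simp: differentiable_def)
    then have "(\<phi> has_derivative D) (at x)"
    proof (rule has_derivative_transform_within_open[OF _ o])
      show "x \<in> X \<inter> \<phi> -` U" using x P(3) by auto
      fix z assume "z \<in> X \<inter> \<phi> -` U"
      then show "g (P (F z)) = \<phi> z" using P(5) eq[of z] by (auto simp: homeomorphism_def)
    qed
    then show ?thesis by (auto simp: differentiable_def)
  qed
  have deriv: "frechet_derivative F' (at (\<phi> x)) (frechet_derivative \<phi> (at x) v) = frechet_derivative F (at x) v"
    if x: "x \<in> X" for x v
  proof -
    have "((\<lambda>x. F' (\<phi> x)) has_derivative (\<lambda>v. frechet_derivative F' (at (\<phi> x)) (frechet_derivative \<phi> (at x) v))) (at x)"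
      using diff_chain_at[of \<phi> _ x F'] diff[OF x] smooth_on_has_derivative[OF F'] x sub
      by (auto simp: frechet_derivative_works o_def)
    then have "(F has_derivative (\<lambda>v. frechet_derivative F' (at (\<phi> x)) (frechet_derivative \<phi> (at x) v))) (at x)"
      by (rule has_derivative_transform_within_open[OF _ X x]) (use eq in auto)
    then show ?thesis using frechet_derivative_at by metis
  qed
  have "Ck_on k \<phi> X" for k
  proof (induction k)
    case 0
    then show ?case using cont by simp
  next
    case (Suc k)
    have comp: "Ck_on k (\<lambda>x. frechet_derivative F' (at (\<phi> x)) u) X" for u
      using Ck_on_compose[OF X Y _ Suc sub] smooth_on_frechet_derivative[OF F'] smooth_on_def by blast
    have "Ck_on k (\<lambda>x. frechet_derivative \<phi> (at x) v) X" for v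
    proof (rule Ck_on_linear_system[OF X])
      let ?D = "\<lambda>x i. frechet_derivative F' (at (\<phi> x)) (axis i 1)"
      let ?A = "\<lambda>x. (\<chi> i j. ?D x i \<bullet> ?D x j) :: real^'n^'n"
      let ?b = "\<lambda>x. (\<chi> i. ?D x i \<bullet> frechet_derivative F (at x) v) :: real^'n"
      show "Ck_on k (\<lambda>x. ?A x $ i $ j) X" for i j
        by (simp add: Ck_on_inner[OF X comp comp])
      show "Ck_on k (\<lambda>x. ?b x $ i) X" for i
        using smooth_on_frechet_derivative[OF F] by (simp add: Ck_on_inner[OF X comp] smooth_on_def)
      fix x assume x: "x \<in> X"
      then have y: "\<phi> x \<in> Y" using sub by auto
      interpret l: linear "frechet_derivative F' (at (\<phi> x))"
        using smooth_on_has_derivative[OF F' y] has_derivative_linear by blast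
      have expand: "frechet_derivative F' (at (\<phi> x)) w = (\<Sum>j\<in>UNIV. w $ j *\<^sub>R ?D x j)" for w
      proof -
        have "w = (\<Sum>j\<in>UNIV. w $ j *\<^sub>R axis j 1)"
          by (simp add: vec_eq_iff axis_def if_distrib[of "\<lambda>z. _ * z"] cong: if_cong)
        then have "frechet_derivative F' (at (\<phi> x)) w = frechet_derivative F' (at (\<phi> x)) (\<Sum>j\<in>UNIV. w $ j *\<^sub>R axis j 1)"
          by (rule arg_cong)
        then show ?thesis by (simp only: l.sum l.scale)
      qed
      have Aw: "(?A x *v w) $ i = ?D x i \<bullet> frechet_derivative F' (at (\<phi> x)) w" for w i
        unfolding expand[of w] by (simp add: matrix_vector_mult_def inner_sum_right mult.commute)
      show "?A x *v frechet_derivative \<phi> (at x) v = ?b x"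
        by (simp add: vec_eq_iff Aw deriv[OF x])
      \<comment> \<open>The Gram matrix is nonsingular: \<open>w \<bullet> (A *v w)\<close> is the
        squared norm of the image of \<open>w\<close> under the injective derivative of
        \<open>F'\<close>.\<close>
      have "w = 0" if "?A x *v w = 0" for w
      proof -
        have "frechet_derivative F' (at (\<phi> x)) w \<bullet> frechet_derivative F' (at (\<phi> x)) w = (\<Sum>i\<in>UNIV. w $ i * (?A x *v w) $ i)"
          unfolding Aw by (subst (1) expand) (simp add: inner_sum_left)
        then have "frechet_derivative F' (at (\<phi> x)) w = 0" using that by simp
        then show ?thesis using inj[OF y] by (metis injD l.zero)
      qed
      then show "det (?A x) \<noteq> 0"
        using invertible_det_nz matrix_left_invertible_ker invertible_left_inverse by blast
    qed
    then show ?case using diff by simp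
  qed
  then show ?thesis by (simp add: smooth_on_def)
qed

section \<open>Change of variables for arbitrary finite index types\<close>

text \<open>The change of variables theorem of the library requires a well-ordered index type. An arbitrary
  finite index type is replaced by a well-ordered copy, along which everything is transported.\<close>

typedef (overloaded) 'n wo = "UNIV :: 'n::finite set" by auto

lemma bij_Rep_wo: "bij (Rep_wo :: 'n::finite wo \<Rightarrow> 'n)"
  by (metis Abs_wo_inverse UNIV_I bijI Rep_wo_inject injI surjI)

text \<open>An arbitrary numbering of the index type; only its injectivity matters, since it serves
  to order the copy.\<close>

definition wo_index :: "'n::finite wo \<Rightarrow> nat" where
  "wo_index x = (SOME h. inj h) (Rep_wo x)"

lemma inj_wo_index: "inj (wo_index :: 'n::finite wo \<Rightarrow> nat)"
proof -
  have "\<exists>h :: 'n \<Rightarrow> nat. inj h" using finite_imp_inj_to_nat_seg[OF finite[of "UNIV :: 'n set"]]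
    by (elim exE conjE) (rule exI)
  then have "inj (SOME h :: 'n \<Rightarrow> nat. inj h)" by (rule someI_ex)
  moreover have "(wo_index :: 'n wo \<Rightarrow> nat) = (SOME h. inj h) \<circ> Rep_wo"
    by (simp add: fun_eq_iff wo_index_def)
  ultimately show ?thesis
    by (metis inj_compose bij_is_inj[OF bij_Rep_wo])
qed

instantiation wo :: (finite) "{finite, wellorder}"
begin

definition less_eq_wo :: "'a wo \<Rightarrow> 'a wo \<Rightarrow> bool" where "less_eq_wo x y \<longleftrightarrow> wo_index x \<le> wo_index y"
definition less_wo :: "'a wo \<Rightarrow> 'a wo \<Rightarrow> bool" where "less_wo x y \<longleftrightarrow> wo_index x < wo_index y"

instance
proof
  show "finite (UNIV :: 'a wo set)"
    using bij_betw_finite[OF bij_Rep_wo] by simp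
  show "x = y" if "x \<le> y" "y \<le> x" for x y :: "'a wo"
    using that by (intro injD[OF inj_wo_index]) (simp add: less_eq_wo_def)
  show "P a" if "\<And>x. (\<And>y. y < x \<Longrightarrow> P y) \<Longrightarrow> P x" for P and a :: "'a wo"
    using that unfolding less_wo_def by (induction a rule: measure_induct_rule[of wo_index]) blast
qed (auto simp: less_eq_wo_def less_wo_def)

end

definition reindex :: "real^'n \<Rightarrow> real^'n wo" where
  "reindex x = (\<chi> i. x $ Rep_wo i)"

definition unreindex :: "real^'n wo \<Rightarrow> real^'n" where
  "unreindex x = (\<chi> i. x $ Abs_wo i)"

lemma reindex_inverse [simp]: "unreindex (reindex x) = x" "reindex (unreindex y) = y"
  by (simp_all add: reindex_def unreindex_def vec_eq_iff Abs_wo_inverse Rep_wo_inverse)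

lemma mem_reindex_image: "x \<in> reindex ` B \<longleftrightarrow> unreindex x \<in> B"
  by (metis image_iff reindex_inverse)

lemma bounded_linear_reindex: "bounded_linear reindex" "bounded_linear unreindex"
  by (auto simp: linear_conv_bounded_linear[symmetric] reindex_def unreindex_def vec_eq_iff intro!: linearI)

lemma borel_measurable_reindex [measurable]:
  "reindex \<in> borel_measurable borel" "unreindex \<in> borel_measurable borel"
  by (simp_all add: bounded_linear_reindex borel_measurable_continuous_onI linear_continuous_on)

lemma all_wo: "(\<forall>i. P (Rep_wo i) i) \<longleftrightarrow> (\<forall>i. P i (Abs_wo i))"
  by (metis Abs_wo_inverse Rep_wo_inverse UNIV_I)

lemma prod_Basis_vec: "(\<Prod>b\<in>Basis. (v::real^'n) \<bullet> b) = (\<Prod>i\<in>UNIV. v $ i)"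
proof -
  have "inj (\<lambda>i::'n. axis i (1::real))" by (auto simp: inj_def axis_eq_axis)
  then show ?thesis
    unfolding Basis_vec_def by (simp add: prod.reindex inner_axis UNION_singleton_eq_range o_def)
qed

text \<open>Lebesgue measure is determined by its values on boxes, and renaming the coordinates
  permutes the side lengths of a box.\<close>

lemma distr_reindex: "distr lborel borel reindex = (lborel :: (real^('n::finite) wo) measure)"
proof (rule lborel_eqI[symmetric])
  fix l u :: "real^'n wo" assume le: "\<And>b. b \<in> Basis \<Longrightarrow> l \<bullet> b \<le> u \<bullet> b"
  then have le': "l $ i \<le> u $ i" for i
    by (metis axis_in_Basis_iff cart_eq_inner_axis insertI1 Basis_real_def)
  have "reindex -` box l u = box (unreindex l) (unreindex u)"
    by (simp add: set_eq_iff mem_box_cart reindex_def unreindex_def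
        all_wo[of "\<lambda>j i. l $ i < x $ j \<and> x $ j < u $ i" for x])
  moreover have "unreindex l \<bullet> b \<le> unreindex u \<bullet> b" if "b \<in> Basis" for b :: "real^'n"
    using that le' by (auto simp: Basis_vec_def inner_axis unreindex_def)
  ultimately have "emeasure (distr lborel borel reindex) (box l u) = (\<Prod>b\<in>Basis. (unreindex u - unreindex l) \<bullet> b)"
    by (simp add: emeasure_distr)
  also have "(\<Prod>b\<in>Basis. (unreindex u - unreindex l) \<bullet> b) = (\<Prod>i\<in>UNIV. (u - l) $ Abs_wo i)"
    by (simp add: prod_Basis_vec unreindex_def)
  also have "\<dots> = (\<Prod>i\<in>UNIV. (u - l) $ i)"
    by (rule prod.reindex_bij_witness[of _ Rep_wo Abs_wo]) (auto simp: Abs_wo_inverse Rep_wo_inverse)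
  finally show "emeasure (distr lborel borel reindex) (box l u) = (\<Prod>b\<in>Basis. (u - l) \<bullet> b)"
    by (simp add: prod_Basis_vec)
qed simp

lemma nn_integral_reindex:
  assumes "h \<in> borel_measurable borel"
  shows "(\<integral>\<^sup>+ y. h y \<partial>lborel) = (\<integral>\<^sup>+ x. h (unreindex x) \<partial>(lborel :: (real^('n::finite) wo) measure))"
  by (subst distr_reindex[symmetric]) (use assms in \<open>simp add: nn_integral_distr\<close>)

text \<open>Transporting permutations along the bijection \<open>Rep_wo\<close> preserves their
  signs, so the two Leibniz sums agree term by term.\<close>

lemma det_reindex:
  fixes A :: "real^'n^'n"
  shows "det ((\<chi> i j. A $ Rep_wo i $ Rep_wo j) :: real^('n::finite) wo^'n wo) = det A"
proof -
  let ?T = "map_permutation UNIV (Rep_wo :: 'n wo \<Rightarrow> 'n)"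
  note b = bij_Rep_wo
  have inj: "inj (Rep_wo :: 'n wo \<Rightarrow> 'n)" using b bij_is_inj by blast
  have bT: "bij_betw ?T {p. p permutes UNIV} {p. p permutes UNIV}"
  proof (rule bij_betwI[where g = "map_permutation UNIV Abs_wo"])
    have b': "bij (Abs_wo :: 'n \<Rightarrow> 'n wo)"
      by (rule bij_betw_byWitness[where f' = Rep_wo]) (auto simp: Abs_wo_inverse Rep_wo_inverse)
    show "?T \<in> {p. p permutes UNIV} \<rightarrow> {p. p permutes UNIV}"
      using map_permutation_permutes[OF b] by auto
    show "map_permutation UNIV Abs_wo \<in> {p. p permutes UNIV} \<rightarrow> {p. p permutes (UNIV :: 'n wo set)}"
      using map_permutation_permutes[OF b'] by auto
    show "map_permutation UNIV Abs_wo (?T p) = p" if "p \<in> {p. p permutes UNIV}" for p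
      using that b by (intro map_permutation_compose_inv) (auto simp: Rep_wo_inverse)
    show "?T (map_permutation UNIV Abs_wo p) = p" if "p \<in> {p. p permutes UNIV}" for p
      using that b' by (intro map_permutation_compose_inv) (auto simp: Abs_wo_inverse)
  qed
  have T: "?T p (Rep_wo i) = Rep_wo (p i)" for p i
    by (simp add: map_permutation_apply[OF inj])
  have "det A = (\<Sum>p | p permutes UNIV. of_int (sign (?T p)) * (\<Prod>i\<in>UNIV. A $ i $ ?T p i))"
    unfolding det_def by (rule sum.reindex_bij_betw[OF bT, symmetric])
  also have "\<dots> = (\<Sum>p | p permutes UNIV. of_int (sign p) * (\<Prod>i\<in>UNIV. A $ Rep_wo i $ Rep_wo (p i)))"
  proof (rule sum.cong[OF refl])
    fix p :: "'n wo \<Rightarrow> 'n wo" assume "p \<in> {p. p permutes UNIV}"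
    then have "sign (?T p) = sign p" using sign_map_permutation[OF inj] by simp
    moreover have "(\<Prod>i\<in>UNIV. A $ i $ ?T p i) = (\<Prod>i\<in>UNIV. A $ Rep_wo i $ ?T p (Rep_wo i))"
      by (rule prod.reindex_bij_betw[OF b, symmetric])
    ultimately show "of_int (sign (?T p)) * (\<Prod>i\<in>UNIV. A $ i $ ?T p i) =
        of_int (sign p) * (\<Prod>i\<in>UNIV. A $ Rep_wo i $ Rep_wo (p i))"
      by (simp add: T)
  qed
  also have "\<dots> = det ((\<chi> i j. A $ Rep_wo i $ Rep_wo j) :: real^'n wo^'n wo)"
    unfolding det_def by simp
  finally show ?thesis ..
qed

text \<open>A bridge between the extended nonnegative integrals that define volumes and the gauge
  integrals of the change of variables theorem.\<close>

lemma nn_integral_eq_iff_has_integral: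
  fixes f :: "'a::euclidean_space \<Rightarrow> real"
  assumes m: "(\<lambda>x. indicator S x * f x) \<in> borel_measurable borel" and nonneg: "\<And>x. x \<in> S \<Longrightarrow> 0 \<le> f x" and b: "0 \<le> b"
  shows "(\<integral>\<^sup>+ x. ennreal (indicator S x * f x) \<partial>lborel) = ennreal b \<longleftrightarrow> (f has_integral b) S"
proof -
  have nn: "0 \<le> indicator S x * f x" for x using nonneg by (auto simp: indicator_def)
  have "(f has_integral b) S \<longleftrightarrow> ((\<lambda>x. indicator S x * f x) has_integral b) UNIV"
    by (subst has_integral_restrict_UNIV[symmetric]) (simp add: indicator_def of_bool_def if_distribR if_distrib[of "\<lambda>z. z * _"] cong: if_cong)
  also have "\<dots> \<longleftrightarrow> (\<integral>\<^sup>+ x. ennreal (indicator S x * f x) \<partial>lborel) = ennreal b"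
    using nn_integral_has_integral[OF m nn _ b] nn_integral_has_integral_lborel[OF m nn] by blast
  finally show ?thesis ..
qed

text \<open>The theorem for absolutely integrable functions shows that both integrals take the same
  finite values; if one of them takes no finite value, neither does the other, so they are also
  infinite together.\<close>

lemma nn_integral_change_of_variables_wellorder:
  fixes \<psi> :: "real^'m::{finite,wellorder} \<Rightarrow> real^'m::_"
  assumes A: "A \<in> sets borel"
    and der: "\<And>x. x \<in> A \<Longrightarrow> (\<psi> has_derivative \<psi>' x) (at x within A)" and inj: "inj_on \<psi> A"
    and m1: "(\<lambda>x. indicator A x * \<rho>1 x) \<in> borel_measurable borel"
    and m2: "(\<lambda>x. indicator (\<psi> ` A) x * \<rho>2 x) \<in> borel_measurable borel"
    and nn2: "\<And>y. y \<in> \<psi> ` A \<Longrightarrow> 0 \<le> \<rho>2 y"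
    and eq: "\<And>x. x \<in> A \<Longrightarrow> \<rho>1 x = \<bar>det (matrix (\<psi>' x))\<bar> * \<rho>2 (\<psi> x)"
  shows "(\<integral>\<^sup>+ x. ennreal (indicator (\<psi> ` A) x * \<rho>2 x) \<partial>lborel) = (\<integral>\<^sup>+ x. ennreal (indicator A x * \<rho>1 x) \<partial>lborel)"
    (is "?Y = ?X")
proof -
  have nn1: "0 \<le> \<rho>1 x" if "x \<in> A" for x using that eq nn2 by simp
  have "A \<in> sets lebesgue" using A by simp
  \<comment> \<open>The theorem is stated for functions into \<open>real^_\<close>, so the scalar
    densities are lifted to \<open>real^1\<close>.\<close>
  note cv = has_absolute_integral_change_of_variables[OF this der inj, of "\<lambda>y. vec (\<rho>2 y) :: real^1" "vec b" for b]
  have *: "(\<rho>1 has_integral b) A \<longleftrightarrow> (\<rho>2 has_integral b) (\<psi> ` A)" for b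
  proof -
    have abs: "f absolutely_integrable_on S \<longleftrightarrow> f integrable_on S" if "\<And>x. x \<in> S \<Longrightarrow> 0 \<le> f x" for f :: "real^'m::_ \<Rightarrow> real" and S
      using that nonnegative_absolutely_integrable_1 set_lebesgue_integral_eq_integral(1) by blast
    have lift: "(\<lambda>x. vec (f x) :: real^1) absolutely_integrable_on S \<and> integral S (\<lambda>x. vec (f x) :: real^1) = vec b
        \<longleftrightarrow> (f has_integral b) S" if "\<And>x. x \<in> S \<Longrightarrow> 0 \<le> f x" for f :: "real^'m::_ \<Rightarrow> real" and S
      using that by (auto simp: absolutely_integrable_on_1_iff integral_on_1_eq abs has_integral_iff vec_eq_iff)
    have "(\<rho>1 has_integral b) A \<longleftrightarrow> ((\<lambda>x. \<bar>det (matrix (\<psi>' x))\<bar> * \<rho>2 (\<psi> x)) has_integral b) A"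
      by (rule has_integral_cong) (rule eq)
    also have "\<dots> \<longleftrightarrow> (\<lambda>x. vec (\<bar>det (matrix (\<psi>' x))\<bar> * \<rho>2 (\<psi> x)) :: real^1) absolutely_integrable_on A \<and>
        integral A (\<lambda>x. vec (\<bar>det (matrix (\<psi>' x))\<bar> * \<rho>2 (\<psi> x)) :: real^1) = vec b"
      by (rule lift[symmetric]) (use nn2 in auto)
    also have "(\<lambda>x. vec (\<bar>det (matrix (\<psi>' x))\<bar> * \<rho>2 (\<psi> x)) :: real^1) = (\<lambda>x. \<bar>det (matrix (\<psi>' x))\<bar> *\<^sub>R vec (\<rho>2 (\<psi> x)))"
      by (simp add: vec_eq_iff fun_eq_iff)
    also note cv[of b]
    also note lift[OF nn2]
    finally show ?thesis .
  qed
  have **: "?X = ennreal b \<longleftrightarrow> ?Y = ennreal b" if "0 \<le> b" for b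
    using *[of b] nn_integral_eq_iff_has_integral[OF m1 nn1 that] nn_integral_eq_iff_has_integral[OF m2 nn2 that] by simp
  show ?thesis
  proof (cases ?X)
    case (real r)
    then show ?thesis using **[of r] by simp
  next
    case top
    then show ?thesis by (cases ?Y) (use ** in auto)
  qed
qed

text \<open>Conjugating \<open>\<psi>\<close> with the renaming of coordinates changes neither
  Lebesgue measure nor the Jacobian determinant.\<close>

lemma nn_integral_change_of_variables:
  fixes \<psi> :: "real^'n \<Rightarrow> real^'n"
  assumes A: "A \<in> sets borel"
    and der: "\<And>x. x \<in> A \<Longrightarrow> (\<psi> has_derivative \<psi>' x) (at x)" and inj: "inj_on \<psi> A"
    and m1: "(\<lambda>x. indicator A x * \<rho>1 x) \<in> borel_measurable borel"
    and m2: "(\<lambda>x. indicator (\<psi> ` A) x * \<rho>2 x) \<in> borel_measurable borel"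
    and nn2: "\<And>y. y \<in> \<psi> ` A \<Longrightarrow> 0 \<le> \<rho>2 y"
    and eq: "\<And>x. x \<in> A \<Longrightarrow> \<rho>1 x = \<bar>det (matrix (\<psi>' x))\<bar> * \<rho>2 (\<psi> x)"
  shows "(\<integral>\<^sup>+ x. ennreal (indicator (\<psi> ` A) x * \<rho>2 x) \<partial>lborel) = (\<integral>\<^sup>+ x. ennreal (indicator A x * \<rho>1 x) \<partial>lborel)"
proof -
  let ?A = "reindex ` A" and ?\<psi> = "\<lambda>x. reindex (\<psi> (unreindex x))" and ?\<psi>' = "\<lambda>x v. reindex (\<psi>' (unreindex x) (unreindex v))"
  note memA = mem_reindex_image[of _ A]
  have "?\<psi> ` ?A = reindex ` (\<psi> ` A)" by (simp add: image_image)
  then have memB: "x \<in> ?\<psi> ` ?A \<longleftrightarrow> unreindex x \<in> \<psi> ` A" for x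
    by (simp only: mem_reindex_image)
  have "?A = unreindex -` A \<inter> space borel" by (auto simp: memA)
  then have A': "?A \<in> sets borel" using measurable_sets[OF borel_measurable_reindex(2) A] by simp
  have "(\<integral>\<^sup>+ x. ennreal (indicator (?\<psi> ` ?A) x * \<rho>2 (unreindex x)) \<partial>lborel) =
      (\<integral>\<^sup>+ x. ennreal (indicator ?A x * \<rho>1 (unreindex x)) \<partial>lborel)"
  proof (rule nn_integral_change_of_variables_wellorder[OF A', where \<psi>' = ?\<psi>'])
    fix x assume "x \<in> ?A"
    then have x: "unreindex x \<in> A" by (simp add: memA)
    have *: "((\<lambda>x. \<psi> (unreindex x)) has_derivative (\<lambda>v. \<psi>' (unreindex x) (unreindex v))) (at x)"
      using diff_chain_at[OF bounded_linear_imp_has_derivative[OF bounded_linear_reindex(2)] der[OF x]] by (simp add: o_def)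
    show "(?\<psi> has_derivative ?\<psi>' x) (at x within ?A)"
      by (rule has_derivative_at_withinI[OF bounded_linear.has_derivative[OF bounded_linear_reindex(1) *]])
    have "unreindex (axis j 1) = axis (Rep_wo j) 1" for j :: "'n wo"
      by (auto simp: vec_eq_iff unreindex_def axis_def Abs_wo_inverse Rep_wo_inverse)
    then have "matrix (?\<psi>' x) = (\<chi> i j. matrix (\<psi>' (unreindex x)) $ Rep_wo i $ Rep_wo j)"
      by (simp add: matrix_def reindex_def)
    then have "det (matrix (?\<psi>' x)) = det (matrix (\<psi>' (unreindex x)))" by (simp add: det_reindex)
    then show "\<rho>1 (unreindex x) = \<bar>det (matrix (?\<psi>' x))\<bar> * \<rho>2 (unreindex (?\<psi> x))"
      using eq[OF x] by simp
  next
    show "inj_on ?\<psi> ?A"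
      by (rule inj_onI) (metis memA reindex_inverse inj_onD[OF inj])
    have "(\<lambda>x. indicator ?A x * \<rho>1 (unreindex x)) = (\<lambda>x. (\<lambda>x. indicator A x * \<rho>1 x) (unreindex x))"
      by (rule ext) (simp only: memA indicator_def)
    then show "(\<lambda>x. indicator ?A x * \<rho>1 (unreindex x)) \<in> borel_measurable borel"
      using measurable_compose[OF borel_measurable_reindex(2) m1] by simp
    have "(\<lambda>x. indicator (?\<psi> ` ?A) x * \<rho>2 (unreindex x)) = (\<lambda>x. (\<lambda>x. indicator (\<psi> ` A) x * \<rho>2 x) (unreindex x))"
      by (rule ext) (simp only: memB indicator_def)
    then show "(\<lambda>x. indicator (?\<psi> ` ?A) x * \<rho>2 (unreindex x)) \<in> borel_measurable borel"
      using measurable_compose[OF borel_measurable_reindex(2) m2] by simp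
  next
    show "0 \<le> \<rho>2 (unreindex y)" if "y \<in> ?\<psi> ` ?A" for y using that by (simp only: memB nn2)
  qed
  also have "(\<integral>\<^sup>+ x. ennreal (indicator ?A x * \<rho>1 (unreindex x)) \<partial>lborel) = (\<integral>\<^sup>+ x. ennreal (indicator A x * \<rho>1 x) \<partial>lborel)"
    using nn_integral_reindex[OF measurable_compose[OF m1 measurable_ennreal]]
    by (simp only: memA indicator_def)
  also have "(\<integral>\<^sup>+ x. ennreal (indicator (?\<psi> ` ?A) x * \<rho>2 (unreindex x)) \<partial>lborel) = (\<integral>\<^sup>+ x. ennreal (indicator (\<psi> ` A) x * \<rho>2 x) \<partial>lborel)"
    using nn_integral_reindex[OF measurable_compose[OF m2 measurable_ennreal]]
    by (simp only: memB indicator_def)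
  finally show ?thesis .
qed

section \<open>Charts, tangent vectors and differentials\<close>

lemma cinv_in: "y \<in> snd c ` fst c \<Longrightarrow> cinv c y \<in> fst c"
  and chart_cinv [simp]: "y \<in> snd c ` fst c \<Longrightarrow> snd c (cinv c y) = y"
  by (simp_all add: cinv_def inv_into_into f_inv_into_f)

context
  fixes M :: "('a, 'e::euclidean_space) mfd"
  assumes M: "smooth_manifold M"
begin

lemma chart_openin: "c \<in> atlas M \<Longrightarrow> openin (mtop M) (fst c)"
  and open_chart_range: "c \<in> atlas M \<Longrightarrow> open (snd c ` fst c)"
  and chart_homeomorphic:
    "c \<in> atlas M \<Longrightarrow> homeomorphic_map (subtopology (mtop M) (fst c)) (top_of_set (snd c ` fst c)) (snd c)"
  and transition_smooth:
    "c \<in> atlas M \<Longrightarrow> c' \<in> atlas M \<Longrightarrow> smooth_on (snd c ` (fst c \<inter> fst c')) (snd c' \<circ> cinv c)"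
  and Union_charts: "(\<Union>c\<in>atlas M. fst c) = points M"
  using M by (auto simp: smooth_manifold_def)

lemma chart_subset_points: "c \<in> atlas M \<Longrightarrow> fst c \<subseteq> points M"
  using Union_charts by blast

lemma chart_inj: "c \<in> atlas M \<Longrightarrow> inj_on (snd c) (fst c)"
  using chart_homeomorphic[of c] chart_subset_points[of c]
  by (auto simp: homeomorphic_map_def Int_absorb1)

lemma cinv_chart [simp]: "c \<in> atlas M \<Longrightarrow> p \<in> fst c \<Longrightarrow> cinv c (snd c p) = p"
  by (simp add: cinv_def chart_inj)

lemma open_chart_image:
  assumes "c \<in> atlas M" "openin (mtop M) U"
  shows "open (snd c ` (fst c \<inter> U))"
proof -
  have "openin (subtopology (mtop M) (fst c)) (fst c \<inter> U)"
    using assms(2) by (auto simp: openin_subtopology)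
  then have "openin (top_of_set (snd c ` fst c)) (snd c ` (fst c \<inter> U))"
    using chart_homeomorphic[OF assms(1)] homeomorphic_imp_open_map open_map_def by blast
  then show ?thesis using open_chart_range[OF assms(1)] openin_open_eq by blast
qed

lemma continuous_map_chart:
  "c \<in> atlas M \<Longrightarrow> continuous_map (subtopology (mtop M) (fst c)) euclidean (snd c)"
  using homeomorphic_imp_continuous_map[OF chart_homeomorphic] continuous_map_in_subtopology by blast

lemma continuous_map_cinv:
  assumes "c \<in> atlas M"
  shows "continuous_map (top_of_set (snd c ` fst c)) (mtop M) (cinv c)"
proof -
  from chart_homeomorphic[OF assms] obtain g where
    g: "homeomorphic_maps (subtopology (mtop M) (fst c)) (top_of_set (snd c ` fst c)) (snd c) g"
    using homeomorphic_map_maps by blast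
  have "continuous_map (top_of_set (snd c ` fst c)) (mtop M) g"
    using g by (simp add: homeomorphic_maps_def continuous_map_in_subtopology)
  moreover have "g y = cinv c y" if "y \<in> snd c ` fst c" for y
  proof -
    have "g y \<in> fst c" "snd c (g y) = y"
      using g that by (auto simp: homeomorphic_maps_def continuous_map_in_subtopology)
    then show ?thesis using cinv_chart[OF assms] by metis
  qed
  ultimately show ?thesis by (auto intro: continuous_map_eq)
qed

lemma open_chart_preimage:
  assumes "c \<in> atlas M" "continuous_map (mtop M) X F" "openin X W"
  shows "open (snd c ` {q \<in> fst c. F q \<in> W})"
proof -
  have "openin (mtop M) {q \<in> points M. F q \<in> W}"
    using assms(2,3) openin_continuous_map_preimage by blast
  moreover have "{q \<in> fst c. F q \<in> W} = fst c \<inter> {q \<in> points M. F q \<in> W}"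
    using chart_subset_points[OF assms(1)] by blast
  ultimately show ?thesis using open_chart_image[OF assms(1), of "{q \<in> points M. F q \<in> W}"] by simp
qed

lemma chart_at_in: "p \<in> points M \<Longrightarrow> chart_at M p \<in> charts_at M p"
  unfolding chart_at_def
proof (rule someI_ex)
  assume "p \<in> points M"
  then obtain c where "c \<in> atlas M" "p \<in> fst c" using Union_charts by blast
  then show "\<exists>c. c \<in> charts_at M p" by (intro exI[of _ c]) (simp add: charts_at_def)
qed

lemma charts_at_points: "c \<in> charts_at M p \<Longrightarrow> p \<in> points M"
  using Union_charts by (auto simp: charts_at_def)

end

text \<open>The chain rule in charts; the change of the chart at \<open>p\<close> is the case of the identity map.\<close>
lemma has_derivative_chart_compose:
  fixes M :: "('a, 'e::euclidean_space) mfd" and N :: "('b, 'f::euclidean_space) mfd"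
    and u :: "'b \<Rightarrow> 'v::real_normed_vector"
  assumes M: "smooth_manifold M" and N: "smooth_manifold N" and F: "continuous_map (mtop M) (mtop N) F"
    and c: "c \<in> charts_at M p" and d: "d \<in> charts_at N (F p)"
    and A: "((snd d \<circ> F \<circ> cinv c) has_derivative A) (at (snd c p))"
    and B: "((u \<circ> cinv d) has_derivative B) (at (snd d (F p)))"
  shows "((u \<circ> F \<circ> cinv c) has_derivative B \<circ> A) (at (snd c p))"
proof -
  have c': "c \<in> atlas M" "p \<in> fst c" and d': "d \<in> atlas N" "F p \<in> fst d"
    using c d by (auto simp: charts_at_def)
  note o = open_chart_preimage[OF M c'(1) F chart_openin[OF N d'(1)]]
  have "(u \<circ> cinv d \<circ> (snd d \<circ> F \<circ> cinv c) has_derivative B \<circ> A) (at (snd c p))"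
    using A B by (intro diff_chain_at) (simp_all add: cinv_chart[OF M c'])
  then show ?thesis
  proof (rule has_derivative_transform_within_open[OF _ o])
    show "snd c p \<in> snd c ` {q \<in> fst c. F q \<in> fst d}" using c' d' by auto
    fix y assume "y \<in> snd c ` {q \<in> fst c. F q \<in> fst d}"
    then obtain q where "q \<in> fst c" "F q \<in> fst d" "y = snd c q" by auto
    then show "(u \<circ> cinv d \<circ> (snd d \<circ> F \<circ> cinv c)) y = (u \<circ> F \<circ> cinv c) y"
      by (simp add: cinv_chart[OF M c'(1)] cinv_chart[OF N d'(1)])
  qed
qed

section \<open>Coordinate changes, tangent vectors and differentials\<close>

context
  fixes M :: "('a, 'e::euclidean_space) mfd"
  assumes M: "smooth_manifold M"
begin

lemma transition_has_derivative:
  assumes "c \<in> charts_at M p" "c' \<in> charts_at M p"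
  shows "((snd c' \<circ> cinv c) has_derivative frechet_derivative (snd c' \<circ> cinv c) (at (snd c p))) (at (snd c p))"
proof (rule smooth_on_has_derivative)
  show "smooth_on (snd c ` (fst c \<inter> fst c')) (snd c' \<circ> cinv c)"
    using assms transition_smooth[OF M] by (auto simp: charts_at_def)
qed (use assms in \<open>auto simp: charts_at_def\<close>)

lemma has_derivative_chart_change:
  fixes u :: "'a \<Rightarrow> 'v::real_normed_vector"
  assumes c: "c \<in> charts_at M p" and c': "c' \<in> charts_at M p"
    and B: "((u \<circ> cinv c) has_derivative B) (at (snd c p))"
  shows "((u \<circ> cinv c') has_derivative B \<circ> frechet_derivative (snd c \<circ> cinv c') (at (snd c' p))) (at (snd c' p))"
  using has_derivative_chart_compose[OF M M, where F = "\<lambda>x. x" and c = c' and p = p and d = c] c c' B transition_has_derivative[OF c' c]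
  by (simp add: o_def)

lemma transition_self:
  assumes "c \<in> charts_at M p"
  shows "frechet_derivative (snd c \<circ> cinv c) (at (snd c p)) = (\<lambda>e. e)"
proof -
  have "((snd c \<circ> cinv c) has_derivative (\<lambda>e. e)) (at (snd c p))"
    using assms open_chart_range[OF M, of c] cinv_chart[OF M, of c]
    by (intro has_derivative_transform_within_open[OF has_derivative_ident, of "snd c ` fst c"])
       (auto simp: charts_at_def)
  then show ?thesis using frechet_derivative_at by metis
qed

text \<open>The cocycle identity of the coordinate changes, by which a vector prescribed in one
  chart extends to a tangent vector.\<close>

lemma transition_compose:
  assumes "c \<in> charts_at M p" "c' \<in> charts_at M p" "c'' \<in> charts_at M p"
  shows "frechet_derivative (snd c'' \<circ> cinv c') (at (snd c' p)) (frechet_derivative (snd c' \<circ> cinv c) (at (snd c p)) e)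
    = frechet_derivative (snd c'' \<circ> cinv c) (at (snd c p)) e"
  using frechet_derivative_at[OF has_derivative_chart_change[OF assms(2,1) transition_has_derivative[OF assms(2,3)]]]
  by (metis comp_apply)

lemma tangent_spaceD:
  assumes "v \<in> tangent_space M p"
  shows "\<And>c c'. c \<in> charts_at M p \<Longrightarrow> c' \<in> charts_at M p \<Longrightarrow>
      frechet_derivative (snd c' \<circ> cinv c) (at (snd c p)) (v c) = v c'"
    and "\<And>c. c \<notin> charts_at M p \<Longrightarrow> v c = 0"
proof -
  note * = CollectD[OF assms[unfolded tangent_space_def]]
  show "frechet_derivative (snd c' \<circ> cinv c) (at (snd c p)) (v c) = v c'"
    if "c \<in> charts_at M p" "c' \<in> charts_at M p" for c c'
    by (rule sym[OF bspec[OF bspec[OF conjunct1[OF *] that(1)] that(2)]])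
  show "v c = 0" if "c \<notin> charts_at M p" for c
    using conjunct2[OF *] that by blast
qed

lemma coord_vec_in_tangent_space: "c \<in> charts_at M p \<Longrightarrow> coord_vec M c p e \<in> tangent_space M p"
  by (simp add: tangent_space_def coord_vec_def transition_compose)

lemma coord_vec_apply: "c \<in> charts_at M p \<Longrightarrow> coord_vec M c p e c = e"
  by (simp add: coord_vec_def transition_self)

lemma coord_vec_of_tangent:
  "c \<in> charts_at M p \<Longrightarrow> v \<in> tangent_space M p \<Longrightarrow> coord_vec M c p (v c) = v"
  by (rule ext) (simp add: tangent_spaceD coord_vec_def)

lemma tangent_eqI:
  "c \<in> charts_at M p \<Longrightarrow> v \<in> tangent_space M p \<Longrightarrow> w \<in> tangent_space M p \<Longrightarrow> v c = w c \<Longrightarrow> v = w"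
  by (metis coord_vec_of_tangent)

lemma coord_vec_linear:
  assumes "c \<in> charts_at M p"
  shows "coord_vec M c p (a *\<^sub>R e + b *\<^sub>R e') = (\<lambda>c'. a *\<^sub>R coord_vec M c p e c' + b *\<^sub>R coord_vec M c p e' c')"
proof
  fix c'
  show "coord_vec M c p (a *\<^sub>R e + b *\<^sub>R e') c' = a *\<^sub>R coord_vec M c p e c' + b *\<^sub>R coord_vec M c p e' c'"
  proof (cases "c' \<in> charts_at M p")
    case True
    interpret linear "frechet_derivative (snd c' \<circ> cinv c) (at (snd c p))"
      using transition_has_derivative[OF assms True] has_derivative_linear by blast
    show ?thesis using True by (simp add: coord_vec_def add scale)
  qed (simp add: coord_vec_def)
qed

lemma tangent_linear_combination:
  assumes "c \<in> charts_at M p" "v \<in> tangent_space M p" "w \<in> tangent_space M p"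
  shows "(\<lambda>c. a *\<^sub>R v c + b *\<^sub>R w c) \<in> tangent_space M p"
  using coord_vec_in_tangent_space[OF assms(1), of "a *\<^sub>R v c + b *\<^sub>R w c"]
    coord_vec_linear[OF assms(1), of a "v c" b "w c"] assms(2,3)
  by (simp add: coord_vec_of_tangent[OF assms(1)])

lemma zero_in_tangent: "c \<in> charts_at M p \<Longrightarrow> (\<lambda>_. 0) \<in> tangent_space M p"
  using tangent_linear_combination[of c p "coord_vec M c p 0" "coord_vec M c p 0" 0 0]
  by (simp add: coord_vec_in_tangent_space)

text \<open>A pointwise notion, because the action of the group is shown to be differentiable at
  each point and the differential calculus asks for nothing more.\<close>

definition mdifferentiable :: "('a \<Rightarrow> 'v::real_normed_vector) \<Rightarrow> 'a \<Rightarrow> bool" where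
  "mdifferentiable u p \<longleftrightarrow> p \<in> points M \<and> (\<forall>c\<in>charts_at M p. (u \<circ> cinv c) differentiable (at (snd c p)))"

lemma mdifferentiableI:
  assumes "c \<in> charts_at M p" "(u \<circ> cinv c) differentiable (at (snd c p))"
  shows "mdifferentiable u p"
proof -
  obtain B where B: "((u \<circ> cinv c) has_derivative B) (at (snd c p))"
    using assms(2) by (auto simp: differentiable_def)
  show ?thesis
    using has_derivative_chart_change[OF assms(1) _ B] charts_at_points[OF M assms(1)]
    unfolding mdifferentiable_def differentiable_def by blast
qed

lemma mdifferentiable_has_derivative:
  "mdifferentiable u p \<Longrightarrow> c \<in> charts_at M p \<Longrightarrow>
   ((u \<circ> cinv c) has_derivative frechet_derivative (u \<circ> cinv c) (at (snd c p))) (at (snd c p))"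
  by (simp add: mdifferentiable_def frechet_derivative_works[symmetric])

lemma smooth_fun_mdifferentiable:
  assumes "smooth_fun M u" "p \<in> points M"
  shows "mdifferentiable u p"
proof (rule mdifferentiableI[OF chart_at_in[OF M assms(2)]])
  show "(u \<circ> cinv (chart_at M p)) differentiable (at (snd (chart_at M p) p))"
    using assms(1) chart_at_in[OF M assms(2)]
    by (intro smooth_on_differentiable[of "snd (chart_at M p) ` fst (chart_at M p)"])
       (auto simp: smooth_fun_def charts_at_def)
qed

text \<open>\<open>dfun\<close> is evaluated in the chart chosen at \<open>p\<close>; the chain rule
  and the transformation law of tangent vectors compensate each other, so any chart at
  \<open>p\<close> may be used.\<close>

lemma dfun_chart:
  assumes c: "c \<in> charts_at M p" and v: "v \<in> tangent_space M p"
    and B: "((u \<circ> cinv c) has_derivative B) (at (snd c p))"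
  shows "dfun M u p v = B (v c)"
proof -
  have c': "chart_at M p \<in> charts_at M p" by (rule chart_at_in[OF M charts_at_points[OF M c]])
  have "frechet_derivative (snd c \<circ> cinv (chart_at M p)) (at (snd (chart_at M p) p)) (v (chart_at M p)) = v c"
    by (rule tangent_spaceD(1)[OF v c' c])
  then show ?thesis
    using frechet_derivative_at[OF has_derivative_chart_change[OF c c' B]] unfolding dfun_def
    by (metis comp_apply)
qed

lemma dfun_frechet:
  "mdifferentiable u p \<Longrightarrow> c \<in> charts_at M p \<Longrightarrow> v \<in> tangent_space M p \<Longrightarrow>
   dfun M u p v = frechet_derivative (u \<circ> cinv c) (at (snd c p)) (v c)"
  by (rule dfun_chart[OF _ _ mdifferentiable_has_derivative])

lemma dfun_linear:
  assumes "mdifferentiable u p" "v \<in> tangent_space M p" "w \<in> tangent_space M p"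
  shows "dfun M u p (\<lambda>c. a *\<^sub>R v c + b *\<^sub>R w c) = a *\<^sub>R dfun M u p v + b *\<^sub>R dfun M u p w"
proof -
  have c: "chart_at M p \<in> charts_at M p" using assms(1) chart_at_in[OF M] by (simp add: mdifferentiable_def)
  interpret linear "frechet_derivative (u \<circ> cinv (chart_at M p)) (at (snd (chart_at M p) p))"
    using mdifferentiable_has_derivative[OF assms(1) c] has_derivative_linear by blast
  show ?thesis by (simp add: dfun_def add scale)
qed

definition mdifferentiable_map :: "('b, 'f::euclidean_space) mfd \<Rightarrow> ('a \<Rightarrow> 'b) \<Rightarrow> 'a \<Rightarrow> bool" where
  "mdifferentiable_map N F p \<longleftrightarrow> F p \<in> points N \<and> (\<forall>d\<in>charts_at N (F p). mdifferentiable (snd d \<circ> F) p)"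

end

lemma differential_eq_dfun:
  fixes M :: "('a, 'e::euclidean_space) mfd" and N :: "('b, 'f::euclidean_space) mfd"
  shows
  "d \<in> charts_at N (F p) \<Longrightarrow> differential M N F p v d = dfun M (snd d \<circ> F) p v"
  by (simp add: differential_def dfun_def)

lemma smooth_map_mdifferentiable_map:
  assumes M: "smooth_manifold M" and N: "smooth_manifold N" and F: "smooth_map M N F" and p: "p \<in> points M"
  shows "mdifferentiable_map M N F p"
  unfolding mdifferentiable_map_def[OF M]
proof (intro conjI ballI)
  show "F p \<in> points N" using F p unfolding smooth_map_def by (meson continuous_map_image_subset_topspace image_subset_iff)
  fix d assume d: "d \<in> charts_at N (F p)"
  note c = chart_at_in[OF M p]
  have "smooth_on (snd (chart_at M p) ` {q \<in> fst (chart_at M p). F q \<in> fst d}) (snd d \<circ> F \<circ> cinv (chart_at M p))"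
    using F c d by (simp add: smooth_map_def charts_at_def)
  then have "(snd d \<circ> F \<circ> cinv (chart_at M p)) differentiable (at (snd (chart_at M p) p))"
    by (rule smooth_on_differentiable) (use c d in \<open>auto simp: charts_at_def\<close>)
  then show "mdifferentiable M (snd d \<circ> F) p" by (rule mdifferentiableI[OF M c])
qed

lemma mdifferentiable_mapI:
  assumes M: "smooth_manifold M" and N: "smooth_manifold N" and F: "continuous_map (mtop M) (mtop N) F"
    and c: "c \<in> charts_at M p" and d: "d \<in> charts_at N (F p)"
    and diff: "(snd d \<circ> F \<circ> cinv c) differentiable (at (snd c p))"
  shows "mdifferentiable_map M N F p"
  unfolding mdifferentiable_map_def[OF M]
proof (intro conjI ballI)
  show "F p \<in> points N" using charts_at_points[OF N d] .
  fix d' assume d': "d' \<in> charts_at N (F p)"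
  obtain A where "((snd d \<circ> F \<circ> cinv c) has_derivative A) (at (snd c p))"
    using diff by (auto simp: differentiable_def)
  from has_derivative_chart_compose[OF M N F c d this transition_has_derivative[OF N d d']]
  show "mdifferentiable M (snd d' \<circ> F) p"
    using mdifferentiableI[OF M c] differentiableI by blast
qed

text \<open>One chart computation yields all three conclusions: the differential of \<open>v\<close>
  is the \<open>coord_vec\<close> of its image coordinates, which places it in the tangent space at
  \<open>F p\<close> and turns the chain rule for coordinates into the chain rule for
  \<open>dfun\<close>.\<close>

lemma mdifferentiable_compose:
  assumes M: "smooth_manifold M" and N: "smooth_manifold N" and F: "continuous_map (mtop M) (mtop N) F"
    and dF: "mdifferentiable_map M N F p" and u: "mdifferentiable N u (F p)" and p: "p \<in> points M"
    and v: "v \<in> tangent_space M p"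
  shows "mdifferentiable M (u \<circ> F) p"
    and "differential M N F p v \<in> tangent_space N (F p)"
    and "dfun M (u \<circ> F) p v = dfun N u (F p) (differential M N F p v)"
proof -
  note c = chart_at_in[OF M p]
  have Fp: "F p \<in> points N" using dF by (simp add: mdifferentiable_map_def[OF M])
  note d = chart_at_in[OF N Fp]
  let ?c = "chart_at M p" and ?d = "chart_at N (F p)"
  let ?A = "frechet_derivative (snd ?d \<circ> F \<circ> cinv ?c) (at (snd ?c p))"
  have "mdifferentiable M (snd ?d \<circ> F) p" using dF d by (simp add: mdifferentiable_map_def[OF M])
  note A = mdifferentiable_has_derivative[OF M this c]
  note comp = has_derivative_chart_compose[OF M N F c d A]
  note 1 = comp[OF mdifferentiable_has_derivative[OF N u d]]
  then show "mdifferentiable M (u \<circ> F) p"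
    using mdifferentiableI[OF M c] differentiableI by blast
  have "differential M N F p v = coord_vec N ?d (F p) (?A (v ?c))"
  proof
    fix d'
    show "differential M N F p v d' = coord_vec N ?d (F p) (?A (v ?c)) d'"
    proof (cases "d' \<in> charts_at N (F p)")
      case True
      from frechet_derivative_at[OF comp[OF transition_has_derivative[OF N d True]]]
      show ?thesis using True by (simp add: differential_def coord_vec_def) (metis comp_apply)
    qed (simp add: differential_def coord_vec_def)
  qed
  then show t: "differential M N F p v \<in> tangent_space N (F p)"
    by (simp add: coord_vec_in_tangent_space[OF N d])
  show "dfun M (u \<circ> F) p v = dfun N u (F p) (differential M N F p v)"
    unfolding dfun_chart[OF M c v 1] dfun_frechet[OF N u d t]
    using d by (simp add: differential_def)
qed

section \<open>Riemannian metrics in charts\<close>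

lemma riemannian_metricD:
  assumes "riemannian_metric M g" "p \<in> points M"
  shows "\<And>v w. v \<in> tangent_space M p \<Longrightarrow> w \<in> tangent_space M p \<Longrightarrow> g p v w = g p w v"
    and "\<And>a b v w z. v \<in> tangent_space M p \<Longrightarrow> w \<in> tangent_space M p \<Longrightarrow> z \<in> tangent_space M p \<Longrightarrow>
      g p (\<lambda>c. a *\<^sub>R v c + b *\<^sub>R w c) z = a * g p v z + b * g p w z"
    and "\<And>v. v \<in> tangent_space M p \<Longrightarrow> v \<noteq> (\<lambda>_. 0) \<Longrightarrow> g p v v > 0"
  using assms unfolding riemannian_metric_def by blast+

definition metric_matrix :: "('a, real^'n) mfd \<Rightarrow> ('a, real^'n) metric \<Rightarrow> ('a, real^'n) chart \<Rightarrow> 'a \<Rightarrow> real^'n^'n" where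
  "metric_matrix M g c p = (\<chi> i j. g p (coord_vec M c p (axis i 1)) (coord_vec M c p (axis j 1)))"

lemma vol_density_eq: "vol_density M g c y = sqrt (det (metric_matrix M g c (cinv c y)))"
  by (simp add: vol_density_def metric_matrix_def)

lemma vec_axis_expansion: "(x::real^'n) = (\<Sum>i\<in>UNIV. x $ i *\<^sub>R axis i 1)"
  by (simp add: vec_eq_iff axis_def if_distrib[of "\<lambda>z. _ * z"] cong: if_cong)

lemma metric_in_chart:
  fixes M :: "('a, real^'n) mfd"
  assumes M: "smooth_manifold M" and g: "riemannian_metric M g" and c: "c \<in> charts_at M p"
    and v: "v \<in> tangent_space M p" and w: "w \<in> tangent_space M p"
  shows "g p v w = v c \<bullet> (metric_matrix M g c p *v w c)"
proof -
  note gD = riemannian_metricD[OF g charts_at_points[OF M c]]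
  note T = coord_vec_in_tangent_space[OF M c]
  let ?e = "coord_vec M c p"
  have lin1: "linear (\<lambda>e. g p (?e e) z)" if z: "z \<in> tangent_space M p" for z
  proof (rule linearI)
    show "g p (?e (x + y)) z = g p (?e x) z + g p (?e y) z" for x y
      using coord_vec_linear[OF M c, of 1 x 1 y] gD(2)[OF T T z, of 1 x 1 y] by simp
    show "g p (?e (r *\<^sub>R x)) z = r *\<^sub>R g p (?e x) z" for r x
      using coord_vec_linear[OF M c, of r x 0 x] gD(2)[OF T T z, of r x 0 x] by simp
  qed
  have expand1: "g p (?e x) z = (\<Sum>i\<in>UNIV. x $ i * g p (?e (axis i 1)) z)" if z: "z \<in> tangent_space M p" for x z
  proof -
    interpret linear "\<lambda>e. g p (?e e) z" by (rule lin1[OF z])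
    have "g p (?e x) z = g p (?e (\<Sum>i\<in>UNIV. x $ i *\<^sub>R axis i 1)) z"
      using vec_axis_expansion[of x] by simp
    then show ?thesis by (simp only: sum scale real_scaleR_def)
  qed
  have "g p (?e x) (?e y) = x \<bullet> (metric_matrix M g c p *v y)" for x y
  proof -
    \<comment> \<open>A metric is postulated to be linear in its first argument; linearity in the
      second comes from symmetry.\<close>
    have *: "g p (?e (axis i 1)) (?e y) = (metric_matrix M g c p *v y) $ i" for i
      by (subst gD(1)[OF T T], subst expand1[OF T, of y])
        (simp add: matrix_vector_mult_def metric_matrix_def mult.commute gD(1)[OF T T])
    show ?thesis
      unfolding expand1[OF T, of x] by (simp add: * inner_vec_def)
  qed
  from this[of "v c" "w c"] show ?thesis by (simp add: coord_vec_of_tangent[OF M c v] coord_vec_of_tangent[OF M c w])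
qed

text \<open>The determinant is 1 at the identity and continuous along the segment from the identity
  to \<open>A\<close>. A zero on the way would give a kernel vector \<open>x\<close>, but
  \<open>x \<bullet> (B *v x)\<close> is positive for every \<open>B\<close> on the segment.\<close>

lemma posdef_det_pos:
  fixes A :: "real^'n^'n"
  assumes "\<And>x. x \<noteq> 0 \<Longrightarrow> 0 < x \<bullet> (A *v x)"
  shows "0 < det A"
proof (rule ccontr)
  let ?B = "\<lambda>t. (1 - t) *\<^sub>R mat 1 + t *\<^sub>R A"
  assume "\<not> 0 < det A"
  have cont: "continuous_on {0..1} (\<lambda>t. det (?B t))"
    unfolding det_def by (intro continuous_intros)
  have "\<exists>t\<ge>0. t \<le> 1 \<and> det (?B t) = 0"
    using \<open>\<not> 0 < det A\<close> by (intro IVT2' cont) (auto simp: det_I)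
  then obtain t where t: "0 \<le> t" "t \<le> 1" "det (?B t) = 0" by blast
  then obtain x where x: "x \<noteq> 0" "?B t *v x = 0"
    using invertible_det_nz invertible_left_inverse matrix_left_invertible_ker by metis
  have "?B t *v x = (1 - t) *\<^sub>R x + t *\<^sub>R (A *v x)"
    by (simp add: matrix_vector_mult_add_rdistrib scaleR_matrix_vector_assoc[symmetric])
  then have "(1 - t) * (x \<bullet> x) + t * (x \<bullet> (A *v x)) = 0"
    using x(2) by (metis inner_add_right inner_scaleR_right inner_zero_right)
  moreover have "0 < x \<bullet> x" "0 < x \<bullet> (A *v x)" using x(1) assms by auto
  ultimately show False
    using t by (smt (verit) mult_nonneg_nonneg mult_pos_pos zero_less_mult_iff)
qed

lemma metric_matrix_posdef:
  fixes M :: "('a, real^'n) mfd"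
  assumes M: "smooth_manifold M" and g: "riemannian_metric M g" and c: "c \<in> charts_at M p" and x: "x \<noteq> 0"
  shows "0 < x \<bullet> (metric_matrix M g c p *v x)"
proof -
  have "coord_vec M c p x \<noteq> (\<lambda>_. 0)" using coord_vec_apply[OF M c, of x] x by auto
  then have "0 < g p (coord_vec M c p x) (coord_vec M c p x)"
    using riemannian_metricD(3)[OF g charts_at_points[OF M c] coord_vec_in_tangent_space[OF M c]] by blast
  then show ?thesis
    using metric_in_chart[OF M g c coord_vec_in_tangent_space[OF M c] coord_vec_in_tangent_space[OF M c], of x x]
    by (simp add: coord_vec_apply[OF M c])
qed

lemma det_metric_matrix_pos:
  fixes M :: "('a, real^'n) mfd"
  assumes "smooth_manifold M" "riemannian_metric M g" "c \<in> charts_at M p"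
  shows "0 < det (metric_matrix M g c p)"
  by (rule posdef_det_pos[OF metric_matrix_posdef[OF assms]])

lemma metric_matrix_smooth:
  assumes "riemannian_metric M g" "c \<in> atlas M"
  shows "smooth_on (snd c ` fst c) (\<lambda>y. metric_matrix M g c (cinv c y) $ i $ j)"
  using assms by (simp add: riemannian_metric_def metric_matrix_def)

lemma cinv_charts_at:
  "c \<in> atlas M \<Longrightarrow> y \<in> snd c ` fst c \<Longrightarrow> c \<in> charts_at M (cinv c y)"
  by (auto simp: charts_at_def cinv_def inv_into_into)

lemma vol_density_pos:
  assumes "smooth_manifold M" "riemannian_metric M g" "c \<in> atlas M" "y \<in> snd c ` fst c"
  shows "0 < vol_density M g c y"
  using det_metric_matrix_pos[OF assms(1,2) cinv_charts_at[OF assms(3,4)]] by (simp add: vol_density_eq)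

lemma det_metric_matrix_Ck:
  assumes "smooth_manifold M" "riemannian_metric M g" "c \<in> atlas M"
  shows "Ck_on k (\<lambda>y. det (metric_matrix M g c (cinv c y))) (snd c ` fst c)"
  using metric_matrix_smooth[OF assms(2,3)] open_chart_range[OF assms(1,3)]
  by (intro Ck_on_det) (auto simp: smooth_on_def)

lemma vol_density_continuous:
  assumes "smooth_manifold M" "riemannian_metric M g" "c \<in> atlas M"
  shows "continuous_on (snd c ` fst c) (vol_density M g c)"
  unfolding vol_density_eq
  by (intro continuous_on_real_sqrt Ck_on_imp_continuous_on[OF det_metric_matrix_Ck[OF assms]])

text \<open>In coordinates the hypothesis on the metrics reads \<open>C G = J^T H J\<close>. Taking
  determinants, which are homogeneous of degree n, and then square roots gives the Jacobian identity
  for the densities; this is where the exponent n/2 originates.\<close>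

lemma vol_density_dilation:
  fixes M :: "('a, real^'n) mfd" and N :: "('b, real^'n) mfd"
  assumes M: "smooth_manifold M" and N: "smooth_manifold N"
    and g: "riemannian_metric M g" and h: "riemannian_metric N h"
    and F: "continuous_map (mtop M) (mtop N) F" and dF: "mdifferentiable_map M N F p"
    and iso: "\<And>v w. v \<in> tangent_space M p \<Longrightarrow> w \<in> tangent_space M p \<Longrightarrow>
       h (F p) (differential M N F p v) (differential M N F p w) = C * g p v w"
    and C: "0 < C" and c: "c \<in> charts_at M p" and d: "d \<in> charts_at N (F p)"
  shows "C powr (real CARD('n) / 2) * vol_density M g c (snd c p) =
    \<bar>det (matrix (frechet_derivative (snd d \<circ> F \<circ> cinv c) (at (snd c p))))\<bar> * vol_density N h d (snd d (F p))"
proof -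
  let ?D = "frechet_derivative (snd d \<circ> F \<circ> cinv c) (at (snd c p))"
  let ?J = "matrix ?D" and ?G = "metric_matrix M g c p" and ?H = "metric_matrix N h d (F p)"
  note T = coord_vec_in_tangent_space[OF M c]
  have p: "p \<in> points M" by (rule charts_at_points[OF M c])
  have md: "mdifferentiable M (snd d \<circ> F) p" using dF d by (simp add: mdifferentiable_map_def[OF M])
  have lin: "linear ?D" using mdifferentiable_has_derivative[OF M md c] has_derivative_linear by blast
  have "mdifferentiable N (snd d) (F p)"
    using mdifferentiableI[OF N d] transition_has_derivative[OF N d d] differentiableI by blast
  note dT = mdifferentiable_compose(2)[OF M N F dF this p]
  have dd: "differential M N F p (coord_vec M c p e) d = ?J *v e" for e
    by (simp add: differential_eq_dfun[where F = F and p = p, OF d] dfun_frechet[OF M md c T] coord_vec_apply[OF M c] matrix_vector_mul(2)[OF lin, THEN fun_cong])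
  have "e \<bullet> ((C *\<^sub>R ?G) *v e') = e \<bullet> ((transpose ?J ** ?H ** ?J) *v e')" for e e'
  proof -
    have "e \<bullet> ((C *\<^sub>R ?G) *v e') = C * g p (coord_vec M c p e) (coord_vec M c p e')"
      by (simp add: metric_in_chart[OF M g c T T] coord_vec_apply[OF M c] scaleR_matrix_vector_assoc[symmetric])
    also have "\<dots> = (?J *v e) \<bullet> (?H *v (?J *v e'))"
      by (simp add: iso[OF T T, symmetric] metric_in_chart[OF N h d dT[OF T] dT[OF T]] dd)
    also have "\<dots> = e \<bullet> (transpose ?J *v (?H *v (?J *v e')))"
      using dot_lmul_matrix[of e "transpose ?J" "?H *v (?J *v e')"] by (simp only: vector_transpose_matrix)
    finally show ?thesis by (simp only: matrix_vector_mul_assoc matrix_mul_assoc)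
  qed
  then have "C *\<^sub>R ?G = transpose ?J ** ?H ** ?J"
    by (metis matrix_eq vector_eq_ldot)
  moreover have "det (C *\<^sub>R ?G) = C ^ CARD('n) * det ?G"
    by (simp add: det_def prod.distrib sum_distrib_left mult.left_commute)
  ultimately have "C ^ CARD('n) * det ?G = (det ?J)\<^sup>2 * det ?H"
    by (simp add: det_mul det_transpose power2_eq_square mult.commute mult.left_commute)
  then have "sqrt (C ^ CARD('n)) * sqrt (det ?G) = \<bar>det ?J\<bar> * sqrt (det ?H)"
    by (metis real_sqrt_abs real_sqrt_mult)
  moreover have "sqrt (C ^ CARD('n)) = C powr (real CARD('n) / 2)"
    using C by (simp add: powr_half_sqrt[symmetric] powr_powr powr_realpow[symmetric])
  ultimately show ?thesis
    using c d by (simp add: vol_density_eq charts_at_def cinv_chart[OF M] cinv_chart[OF N])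
qed

section \<open>The Riemannian measure\<close>

text \<open>The measurable structure without a measure, so that measurability can be discussed
  before the Riemannian measure is known to exist.\<close>

definition borel_space :: "('a, 'e) mfd \<Rightarrow> 'a measure" where
  "borel_space M = sigma (points M) {U. openin (mtop M) U}"

lemma openin_Pow: "{U. openin X U} \<subseteq> Pow (topspace X)"
  using openin_subset by blast

lemma space_borel_space [simp]: "space (borel_space M) = points M"
  by (simp add: borel_space_def space_measure_of[OF openin_Pow])

lemma sets_borel_space: "sets (borel_space M) = sigma_sets (points M) {U. openin (mtop M) U}"
  by (simp add: borel_space_def sets_measure_of[OF openin_Pow])

lemma openin_borel_space: "openin (mtop M) U \<Longrightarrow> U \<in> sets (borel_space M)"
  by (auto simp: sets_borel_space)

lemma measurable_to_borel_space:
  assumes "\<And>x. x \<in> space A \<Longrightarrow> f x \<in> points M"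
    and "\<And>U. openin (mtop M) U \<Longrightarrow> f -` U \<inter> space A \<in> sets A"
  shows "f \<in> measurable A (borel_space M)"
  unfolding borel_space_def using assms by (intro measurable_measure_of[OF openin_Pow]) auto

lemma continuous_map_measurable:
  assumes "continuous_map (mtop M) (mtop N) F"
  shows "F \<in> measurable (borel_space M) (borel_space N)"
proof (rule measurable_to_borel_space)
  show "F x \<in> points N" if "x \<in> space (borel_space M)" for x
    using that assms continuous_map_image_subset_topspace by fastforce
  fix U assume "openin (mtop N) U"
  then have "openin (mtop M) {x \<in> points M. F x \<in> U}" by (rule openin_continuous_map_preimage[OF assms])
  moreover have "F -` U \<inter> space (borel_space M) = {x \<in> points M. F x \<in> U}" by auto
  ultimately show "F -` U \<inter> space (borel_space M) \<in> sets (borel_space M)"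
    by (simp add: openin_borel_space)
qed

lemma continuous_map_preimage_sets:
  assumes "continuous_map (mtop M) (mtop N) F" "B \<in> sets (borel_space N)"
  shows "{x \<in> points M. F x \<in> B} \<in> sets (borel_space M)"
proof -
  have "{x \<in> points M. F x \<in> B} = F -` B \<inter> space (borel_space M)" by auto
  then show ?thesis using measurable_sets[OF continuous_map_measurable[OF assms(1)] assms(2)] by simp
qed

lemma mem_chart_image:
  fixes M :: "('a, 'e::euclidean_space) mfd"
  assumes "smooth_manifold M" "c \<in> atlas M" "A \<subseteq> fst c"
  shows "y \<in> snd c ` A \<longleftrightarrow> y \<in> snd c ` fst c \<and> cinv c y \<in> A"
proof
  assume "y \<in> snd c ` A"
  then obtain p where "p \<in> A" "y = snd c p" by blast
  then show "y \<in> snd c ` fst c \<and> cinv c y \<in> A" using cinv_chart[OF assms(1,2)] assms(3) by auto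
next
  assume "y \<in> snd c ` fst c \<and> cinv c y \<in> A"
  then show "y \<in> snd c ` A" using chart_cinv[of y c] by (metis imageI)
qed

text \<open>The image of \<open>A\<close> under the chart is the preimage of \<open>A\<close> under
  the continuous inverse of the chart, hence Borel.\<close>

lemma chart_image_borel:
  fixes M :: "('a, 'e::euclidean_space) mfd"
  assumes M: "smooth_manifold M" and c: "c \<in> atlas M" and A: "A \<in> sets (borel_space M)" "A \<subseteq> fst c"
  shows "snd c ` A \<in> sets borel"
proof (cases "A = {}")
  case False
  then obtain p0 where p0: "p0 \<in> A" by blast
  note R = open_chart_range[OF M c]
  \<comment> \<open>The default value \<open>p0\<close> makes the inverse chart total; what it adds
    lies outside the range of the chart and is cut off at the end.\<close>
  let ?k = "\<lambda>y. if y \<in> snd c ` fst c then cinv c y else p0"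
  have sub: "fst c \<subseteq> points M" by (rule chart_subset_points[OF M c])
  have "?k \<in> measurable borel (borel_space M)"
  proof (rule measurable_to_borel_space)
    show "?k y \<in> points M" for y using cinv_in[of y c] p0 A(2) sub by auto
    fix U assume U: "openin (mtop M) U"
    have "?k -` U \<inter> space borel = snd c ` (fst c \<inter> U) \<union> (if p0 \<in> U then - (snd c ` fst c) else {})"
      unfolding set_eq_iff Un_iff mem_chart_image[OF M c Int_lower1] using cinv_in[of _ c] by simp
    also have "\<dots> \<in> sets borel"
      using open_chart_image[OF M c U] R by auto
    finally show "?k -` U \<inter> space borel \<in> sets borel" .
  qed
  then have "(?k -` A \<inter> space borel) \<inter> snd c ` fst c \<in> sets borel"
    using A(1) R by (intro sets.Int measurable_sets) auto
  moreover have "(?k -` A \<inter> space borel) \<inter> snd c ` fst c = snd c ` A"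
    unfolding set_eq_iff Int_iff mem_chart_image[OF M c A(2)] by auto
  ultimately show ?thesis by simp
qed simp

lemma countable_subcover:
  assumes "second_countable_top X" "\<And>U. U \<in> \<U> \<Longrightarrow> openin X U" "\<Union>\<U> = topspace X"
  obtains \<V> where "countable \<V>" "\<V> \<subseteq> \<U>" "\<Union>\<V> = topspace X"
proof -
  obtain B where B: "countable B" "\<And>U. U \<in> B \<Longrightarrow> openin X U" "\<And>U. openin X U \<Longrightarrow> \<exists>C\<subseteq>B. U = \<Union>C"
    using assms(1) unfolding second_countable_top_def by auto
  have "second_countable X"
    unfolding second_countable_def
  proof (intro exI[of _ B] conjI ballI allI impI)
    fix U x assume "openin X U \<and> x \<in> U"
    moreover then obtain C where "C \<subseteq> B" "U = \<Union>C" using B(3) by blast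
    ultimately show "\<exists>V\<in>B. x \<in> V \<and> V \<subseteq> U" by blast
  qed (use B in auto)
  then have "Lindelof_space X" by (rule second_countable_imp_Lindelof_space)
  then have "\<exists>\<V>. countable \<V> \<and> \<V> \<subseteq> \<U> \<and> \<Union>\<V> = topspace X"
    using assms(2,3) by (simp add: Lindelof_space_def)
  then show thesis by (elim exE conjE) (rule that)
qed

text \<open>By second countability countably many chart domains suffice, and making them disjoint
  keeps them Borel. Statements about measures on the whole manifold are thereby reduced to sets
  inside a single chart.\<close>

lemma countable_chart_partition:
  fixes M :: "('a, 'e::euclidean_space) mfd"
  assumes M: "smooth_manifold M" and ne: "points M \<noteq> {}"
  obtains C :: "nat \<Rightarrow> ('a, 'e) chart" and P :: "nat \<Rightarrow> 'a set"
  where "\<And>i. C i \<in> atlas M" "\<And>i. P i \<subseteq> fst (C i)" "\<And>i. P i \<in> sets (borel_space M)"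
    "disjoint_family P" "(\<Union>i. P i) = points M"
proof -
  obtain \<V> where V: "countable \<V>" "\<V> \<subseteq> fst ` atlas M" "\<Union>\<V> = points M"
  proof (rule countable_subcover)
    show "second_countable_top (mtop M)" using M by (simp add: smooth_manifold_def)
    show "\<Union>(fst ` atlas M) = points M" using Union_charts[OF M] by simp
    show "\<And>U. U \<in> fst ` atlas M \<Longrightarrow> openin (mtop M) U" using chart_openin[OF M] by auto
  qed
  have Vne: "\<V> \<noteq> {}" using V(3) ne by (metis Union_empty)
  have "\<exists>c\<in>atlas M. fst c = from_nat_into \<V> i" for i
    using from_nat_into[OF Vne, of i] V(2) by force
  then obtain C where C: "\<And>i. C i \<in> atlas M" "\<And>i. fst (C i) = from_nat_into \<V> i"
    by metis
  have un: "(\<Union>i. fst (C i)) = points M"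
    using V(3) range_from_nat_into[OF Vne V(1)] by (simp add: C(2))
  show thesis
  proof (rule that[of C "disjointed (\<lambda>i. fst (C i))"])
    show "C i \<in> atlas M" for i by (rule C(1))
    show "disjointed (\<lambda>i. fst (C i)) i \<subseteq> fst (C i)" for i by (rule disjointed_subset)
    have "range (\<lambda>i. fst (C i)) \<subseteq> sets (borel_space M)"
      using chart_openin[OF M C(1)] openin_borel_space by blast
    then show "disjointed (\<lambda>i. fst (C i)) i \<in> sets (borel_space M)" for i
      using sets.range_disjointed_sets by blast
    show "disjoint_family (disjointed (\<lambda>i. fst (C i)))" by (rule disjoint_family_disjointed)
    show "(\<Union>i. disjointed (\<lambda>i. fst (C i)) i) = points M" by (simp add: UN_disjointed_eq un)
  qed
qed

section \<open>Chart integrals and volumes under dilations\<close>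

lemma chart_density_measurable:
  fixes M :: "('a, real^'n) mfd"
  assumes M: "smooth_manifold M" and g: "riemannian_metric M g" and c: "c \<in> atlas M"
    and A: "A \<in> sets (borel_space M)" "A \<subseteq> fst c"
  shows "(\<lambda>y. indicator (snd c ` A) y * vol_density M g c y) \<in> borel_measurable borel"
  using borel_measurable_continuous_on_indicator[OF chart_image_borel[OF M c A]
      continuous_on_subset[OF vol_density_continuous[OF M g c] image_mono[OF A(2)]]]
  by simp

lemma ennreal_indicator_mult: "ennreal (indicator S x * r) = ennreal r * indicator S x"
  by (simp split: split_indicator)

text \<open>Change of variables for \<open>F\<close> written in the two charts, with the Jacobian
  identity supplied by \<open>vol_density_dilation\<close>.\<close>

lemma chart_integral_dilation:
  fixes M :: "('a, real^'n) mfd" and N :: "('b, real^'n) mfd"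
  assumes M: "smooth_manifold M" and N: "smooth_manifold N"
    and g: "riemannian_metric M g" and h: "riemannian_metric N h"
    and F: "continuous_map (mtop M) (mtop N) F" and dF: "\<And>p. p \<in> A \<Longrightarrow> mdifferentiable_map M N F p"
    and iso: "\<And>p v w. p \<in> A \<Longrightarrow> v \<in> tangent_space M p \<Longrightarrow> w \<in> tangent_space M p \<Longrightarrow>
       h (F p) (differential M N F p v) (differential M N F p w) = C * g p v w"
    and C: "0 < C" and c: "c \<in> atlas M" and d: "d \<in> atlas N"
    and A: "A \<in> sets (borel_space M)" "A \<subseteq> fst c" and FA: "F ` A \<in> sets (borel_space N)" "F ` A \<subseteq> fst d"
    and inj: "inj_on F A"
  shows "(\<integral>\<^sup>+ y. ennreal (vol_density N h d y) * indicator (snd d ` F ` A) y \<partial>lborel) =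
    ennreal (C powr (real CARD('n) / 2)) * (\<integral>\<^sup>+ y. ennreal (vol_density M g c y) * indicator (snd c ` A) y \<partial>lborel)"
proof -
  let ?\<psi> = "snd d \<circ> F \<circ> cinv c"
  have img: "?\<psi> ` snd c ` A = snd d ` F ` A"
    using A(2) cinv_chart[OF M c] by (force simp: image_image)
  have at: "c \<in> charts_at M p" "d \<in> charts_at N (F p)" if "p \<in> A" for p
    using that A(2) FA(2) c d by (auto simp: charts_at_def)
  have m1: "(\<lambda>y. indicator (snd c ` A) y * (C powr (real CARD('n) / 2) * vol_density M g c y)) \<in> borel_measurable borel"
    using borel_measurable_times[OF borel_measurable_const[of "C powr (real CARD('n) / 2)"] chart_density_measurable[OF M g c A]]
    by (simp only: mult.left_commute[of "C powr (real CARD('n) / 2)" "indicator _ _"])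
  have "(\<integral>\<^sup>+ y. ennreal (indicator (?\<psi> ` snd c ` A) y * vol_density N h d y) \<partial>lborel) =
     (\<integral>\<^sup>+ y. ennreal (indicator (snd c ` A) y * (C powr (real CARD('n) / 2) * vol_density M g c y)) \<partial>lborel)"
  proof (rule nn_integral_change_of_variables[where \<psi>' = "\<lambda>y. frechet_derivative ?\<psi> (at y)"])
    show "snd c ` A \<in> sets borel" by (rule chart_image_borel[OF M c A])
    fix y assume "y \<in> snd c ` A"
    then obtain p where p: "p \<in> A" "y = snd c p" by blast
    then have pc: "cinv c y = p" using cinv_chart[OF M c] A(2) by auto
    have "mdifferentiable M (snd d \<circ> F) p"
      using dF[OF p(1)] at(2)[OF p(1)] by (simp add: mdifferentiable_map_def[OF M])
    from mdifferentiable_has_derivative[OF M this at(1)[OF p(1)]]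
    show "(?\<psi> has_derivative frechet_derivative ?\<psi> (at y)) (at y)" using p by simp
    have "?\<psi> y = snd d (F p)" by (simp add: pc)
    moreover have "C powr (real CARD('n) / 2) * vol_density M g c (snd c p) =
        \<bar>det (matrix (frechet_derivative ?\<psi> (at (snd c p))))\<bar> * vol_density N h d (snd d (F p))"
      by (rule vol_density_dilation[OF M N g h F dF[OF p(1)] _ C at[OF p(1)]]) (rule iso[OF p(1)])
    ultimately show "C powr (real CARD('n) / 2) * vol_density M g c y =
        \<bar>det (matrix (frechet_derivative ?\<psi> (at y)))\<bar> * vol_density N h d (?\<psi> y)"
      by (simp only: p(2))
  next
    show "inj_on ?\<psi> (snd c ` A)"
    proof (rule inj_onI)
      fix x y assume "x \<in> snd c ` A" "y \<in> snd c ` A" and eq: "?\<psi> x = ?\<psi> y"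
      then obtain p q where pq: "p \<in> A" "x = snd c p" "q \<in> A" "y = snd c q" by blast
      have "cinv c x = p" "cinv c y = q"
        unfolding pq by (rule cinv_chart[OF M c subsetD[OF A(2)]], rule pq)+
      then have "snd d (F p) = snd d (F q)" using eq by simp
      then have "F p = F q" using inj_onD[OF chart_inj[OF N d]] FA(2) pq by blast
      then show "x = y" using inj_onD[OF inj] pq by blast
    qed
    show "(\<lambda>y. indicator (?\<psi> ` snd c ` A) y * vol_density N h d y) \<in> borel_measurable borel"
      unfolding img by (rule chart_density_measurable[OF N h d FA])
    fix y assume "y \<in> ?\<psi> ` snd c ` A"
    then show "0 \<le> vol_density N h d y"
      unfolding img using vol_density_pos[OF N h d] FA(2) by (metis image_mono less_imp_le subsetD)
  qed (rule m1)
  also have "\<dots> = (\<integral>\<^sup>+ y. ennreal (C powr (real CARD('n) / 2)) * (ennreal (indicator (snd c ` A) y * vol_density M g c y)) \<partial>lborel)"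
    by (rule nn_integral_cong) (simp add: ennreal_mult'[symmetric] mult.left_commute)
  also have "\<dots> = ennreal (C powr (real CARD('n) / 2)) * (\<integral>\<^sup>+ y. ennreal (indicator (snd c ` A) y * vol_density M g c y) \<partial>lborel)"
    using chart_density_measurable[OF M g c A] by (intro nn_integral_cmult) simp
  finally show ?thesis by (simp only: img ennreal_indicator_mult)
qed

text \<open>The condition inside the definite description \<open>riemannian_measure\<close>, named
  so that its existence and uniqueness can be proved.\<close>

definition volume_measure :: "('a, real^'n) mfd \<Rightarrow> ('a, real^'n) metric \<Rightarrow> 'a measure \<Rightarrow> bool" where
  "volume_measure M g \<mu> \<longleftrightarrow>
     space \<mu> = points M \<and> sets \<mu> = sigma_sets (points M) {U. openin (mtop M) U} \<and>
     (\<forall>c\<in>atlas M. \<forall>B\<in>sets \<mu>. B \<subseteq> fst c \<longrightarrow>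
        emeasure \<mu> B = (\<integral>\<^sup>+ y. ennreal (vol_density M g c y) * indicator (snd c ` B) y \<partial>lborel))"

lemma volume_measureD:
  assumes "volume_measure M g \<mu>"
  shows "space \<mu> = points M" "sets \<mu> = sets (borel_space M)"
    and "\<And>c B. c \<in> atlas M \<Longrightarrow> B \<in> sets (borel_space M) \<Longrightarrow> B \<subseteq> fst c \<Longrightarrow>
      emeasure \<mu> B = (\<integral>\<^sup>+ y. ennreal (vol_density M g c y) * indicator (snd c ` B) y \<partial>lborel)"
  using assms by (auto simp: volume_measure_def sets_borel_space)

lemma emeasure_partition:
  assumes "\<And>i::nat. P i \<in> sets \<mu>" "disjoint_family P" "B \<subseteq> (\<Union>i. P i)" "B \<in> sets \<mu>"
  shows "emeasure \<mu> B = (\<Sum>i. emeasure \<mu> (B \<inter> P i))"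
proof -
  have "(\<Sum>i. emeasure \<mu> (B \<inter> P i)) = emeasure \<mu> (\<Union>i. B \<inter> P i)"
    using assms by (intro suminf_emeasure) (auto simp: disjoint_family_on_def)
  moreover have "(\<Union>i. B \<inter> P i) = B" using assms(3) by blast
  ultimately show ?thesis by simp
qed

text \<open>\<open>B\<close> is cut along a chart partition of \<open>M\<close> and the preimages of
  a chart partition of \<open>N\<close>, so that each piece and its image lie in single charts. That
  images of Borel sets are Borel is a hypothesis here; in the applications it is provided by a
  continuous inverse of \<open>F\<close>.\<close>

lemma volume_measure_dilation:
  fixes M :: "('a, real^'n) mfd" and N :: "('b, real^'n) mfd"
  assumes M: "smooth_manifold M" and N: "smooth_manifold N"
    and g: "riemannian_metric M g" and h: "riemannian_metric N h"
    and mu: "volume_measure M g \<mu>" and nu: "volume_measure N h \<nu>"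
    and F: "continuous_map (mtop M) (mtop N) F" and dF: "\<And>p. p \<in> points M \<Longrightarrow> mdifferentiable_map M N F p"
    and iso: "\<And>p v w. p \<in> points M \<Longrightarrow> v \<in> tangent_space M p \<Longrightarrow> w \<in> tangent_space M p \<Longrightarrow>
       h (F p) (differential M N F p v) (differential M N F p w) = C * g p v w"
    and C: "0 < C" and B: "B \<in> sets (borel_space M)"
    and FB: "\<And>A. A \<in> sets (borel_space M) \<Longrightarrow> A \<subseteq> B \<Longrightarrow> F ` A \<in> sets (borel_space N)"
    and inj: "inj_on F B"
  shows "emeasure \<nu> (F ` B) = ennreal (C powr (real CARD('n) / 2)) * emeasure \<mu> B"
proof (cases "B = {}")
  case False
  note muD = volume_measureD[OF mu] and nuD = volume_measureD[OF nu]
  have Bsub: "B \<subseteq> points M" using sets.sets_into_space[OF B] by simp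
  have FM: "F p \<in> points N" if "p \<in> points M" for p
    using that F continuous_map_image_subset_topspace by blast
  obtain b where "b \<in> B" using False by blast
  then have ne: "points M \<noteq> {}" "points N \<noteq> {}" using Bsub FM by blast+
  obtain c P where P: "\<And>i. c i \<in> atlas M" "\<And>i::nat. P i \<subseteq> fst (c i)" "\<And>i. P i \<in> sets (borel_space M)"
    "disjoint_family P" "(\<Union>i. P i) = points M"
    using countable_chart_partition[OF M ne(1)] by metis
  obtain d Q where Q: "\<And>i. d i \<in> atlas N" "\<And>i::nat. Q i \<subseteq> fst (d i)" "\<And>i. Q i \<in> sets (borel_space N)"
    "disjoint_family Q" "(\<Union>i. Q i) = points N"
    using countable_chart_partition[OF N ne(2)] by metis
  let ?k = "ennreal (C powr (real CARD('n) / 2))"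
  have preQ: "{x \<in> points M. F x \<in> Q j} \<in> sets (borel_space M)" for j
    by (rule continuous_map_preimage_sets[OF F Q(3)])
  have piece: "emeasure \<nu> (F ` (B \<inter> P i \<inter> {x \<in> points M. F x \<in> Q j})) =
      ?k * emeasure \<mu> (B \<inter> P i \<inter> {x \<in> points M. F x \<in> Q j})" (is "emeasure \<nu> (F ` ?A) = _") for i j
  proof -
    have A: "?A \<in> sets (borel_space M)" using B P(3) preQ by auto
    have FA: "F ` ?A \<in> sets (borel_space N)" by (rule FB[OF A]) auto
    have Asub: "?A \<subseteq> fst (c i)" and FAsub: "F ` ?A \<subseteq> fst (d j)" using P(2) Q(2) by auto
    show ?thesis
      unfolding nuD(3)[OF Q(1) FA FAsub] muD(3)[OF P(1) A Asub]
      by (rule chart_integral_dilation[OF M N g h F dF iso C P(1) Q(1) A Asub FA FAsub])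
        (use inj in \<open>auto intro: inj_on_subset\<close>)
  qed
  have row: "emeasure \<nu> (F ` (B \<inter> P i)) = ?k * emeasure \<mu> (B \<inter> P i)" for i
  proof -
    have A: "B \<inter> P i \<in> sets (borel_space M)" using B P(3) by auto
    have FA: "F ` (B \<inter> P i) \<in> sets (borel_space N)" by (rule FB[OF A]) auto
    have "emeasure \<nu> (F ` (B \<inter> P i)) = (\<Sum>j. emeasure \<nu> (F ` (B \<inter> P i) \<inter> Q j))"
      by (rule emeasure_partition) (use Q nuD FA Bsub FM in auto)
    also have "\<dots> = (\<Sum>j. emeasure \<nu> (F ` (B \<inter> P i \<inter> {x \<in> points M. F x \<in> Q j})))"
      by (rule suminf_cong, rule arg_cong[where f = "emeasure \<nu>"]) (use Bsub in auto)
    also have "\<dots> = ?k * (\<Sum>j. emeasure \<mu> (B \<inter> P i \<inter> {x \<in> points M. F x \<in> Q j}))"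
      by (simp only: piece ennreal_suminf_cmult)
    also have "(\<Sum>j. emeasure \<mu> (B \<inter> P i \<inter> {x \<in> points M. F x \<in> Q j})) = emeasure \<mu> (B \<inter> P i)"
    proof (rule emeasure_partition[symmetric])
      show "disjoint_family (\<lambda>j. {x \<in> points M. F x \<in> Q j})"
        using Q(4) by (fastforce simp: disjoint_family_on_def)
      show "B \<inter> P i \<subseteq> (\<Union>j. {x \<in> points M. F x \<in> Q j})"
        using Q(5) FM Bsub by blast
    qed (use A preQ muD in auto)
    finally show ?thesis .
  qed
  have "emeasure \<nu> (F ` B) = (\<Sum>i. emeasure \<nu> (F ` (B \<inter> P i)))"
  proof -
    have "(\<Sum>i. emeasure \<nu> (F ` (B \<inter> P i))) = emeasure \<nu> (\<Union>i. F ` (B \<inter> P i))"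
    proof (rule suminf_emeasure)
      show "range (\<lambda>i. F ` (B \<inter> P i)) \<subseteq> sets \<nu>" using FB B P(3) nuD(2) by auto
      show "disjoint_family (\<lambda>i. F ` (B \<inter> P i))"
        using P(4) inj unfolding disjoint_family_on_def inj_on_def by blast
    qed
    moreover have "(\<Union>i. F ` (B \<inter> P i)) = F ` B" using P(5) Bsub by blast
    ultimately show ?thesis by simp
  qed
  also have "\<dots> = ?k * (\<Sum>i. emeasure \<mu> (B \<inter> P i))"
    by (simp only: row ennreal_suminf_cmult)
  also have "(\<Sum>i. emeasure \<mu> (B \<inter> P i)) = emeasure \<mu> B"
    by (rule emeasure_partition[symmetric]) (use P muD B Bsub in auto)
  finally show ?thesis .
qed simp

section \<open>Existence and uniqueness of the Riemannian measure\<close>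

lemma differential_ident:
  fixes M :: "('a, 'e::euclidean_space) mfd"
  assumes M: "smooth_manifold M" and p: "p \<in> points M"
  shows "mdifferentiable_map M M (\<lambda>x. x) p"
    and "v \<in> tangent_space M p \<Longrightarrow> differential M M (\<lambda>x. x) p v = v"
proof -
  note c = chart_at_in[OF M p]
  show "mdifferentiable_map M M (\<lambda>x. x) p"
    by (rule mdifferentiable_mapI[OF M M, where F = "\<lambda>x. x", OF _ c c])
      (use transition_has_derivative[OF M c c] differentiableI in \<open>auto simp: o_def\<close>)
  assume v: "v \<in> tangent_space M p"
  show "differential M M (\<lambda>x. x) p v = v"
  proof
    fix d
    show "differential M M (\<lambda>x. x) p v d = v d"
      using tangent_spaceD[OF M v] c by (simp add: differential_def o_def)
  qed
qed

lemma suminf_swap_ennreal: "(\<Sum>i. \<Sum>j. f i j :: ennreal) = (\<Sum>j. \<Sum>i. f i j)"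
proof -
  have "(\<Sum>i. \<Sum>j. f i j) = (\<integral>\<^sup>+ i. (\<Sum>j. f i j) \<partial>count_space UNIV)"
    by (rule nn_integral_count_space_nat[symmetric])
  also have "\<dots> = (\<Sum>j. \<integral>\<^sup>+ i. f i j \<partial>count_space UNIV)"
    by (rule nn_integral_suminf) simp
  finally show ?thesis by (simp add: nn_integral_count_space_nat)
qed

lemma chart_integral_countably_additive:
  fixes M :: "('a, real^'n) mfd"
  assumes M: "smooth_manifold M" and g: "riemannian_metric M g" and c: "c \<in> atlas M"
    and A: "\<And>j::nat. A j \<in> sets (borel_space M)" "\<And>j. A j \<subseteq> fst c" "disjoint_family A"
  shows "(\<integral>\<^sup>+ y. ennreal (vol_density M g c y) * indicator (snd c ` (\<Union>j. A j)) y \<partial>lborel) =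
    (\<Sum>j. \<integral>\<^sup>+ y. ennreal (vol_density M g c y) * indicator (snd c ` A j) y \<partial>lborel)"
proof -
  have disj: "disjoint_family (\<lambda>j. snd c ` A j)"
    using A(2,3) chart_inj[OF M c] unfolding disjoint_family_on_def inj_on_def by blast
  have "(\<integral>\<^sup>+ y. ennreal (vol_density M g c y) * indicator (snd c ` (\<Union>j. A j)) y \<partial>lborel) =
      (\<integral>\<^sup>+ y. (\<Sum>j. ennreal (vol_density M g c y) * indicator (snd c ` A j) y) \<partial>lborel)"
    by (rule nn_integral_cong) (simp add: suminf_indicator[OF disj] image_UN)
  also have "\<dots> = (\<Sum>j. \<integral>\<^sup>+ y. ennreal (vol_density M g c y) * indicator (snd c ` A j) y \<partial>lborel)"
  proof (rule nn_integral_suminf)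
    fix j
    have "(\<lambda>y. ennreal (indicator (snd c ` A j) y * vol_density M g c y)) \<in> borel_measurable lborel"
      using chart_density_measurable[OF M g c A(1,2)[of j]] by simp
    then show "(\<lambda>y. ennreal (vol_density M g c y) * indicator (snd c ` A j) y) \<in> borel_measurable lborel"
      by (simp only: ennreal_indicator_mult)
  qed
  finally show ?thesis .
qed

text \<open>Chart integrals over the pieces of a countable chart partition are added up. The formula
  then holds in every chart because a set lying in two chart domains has the same integral in
  both.\<close>

lemma volume_measure_exists:
  fixes M :: "('a, real^'n) mfd"
  assumes M: "smooth_manifold M" and g: "riemannian_metric M g" and ne: "points M \<noteq> {}"
  shows "\<exists>\<mu>. volume_measure M g \<mu>"
proof -
  obtain C P where P: "\<And>i. C i \<in> atlas M" "\<And>i::nat. P i \<subseteq> fst (C i)" "\<And>i. P i \<in> sets (borel_space M)"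
    "disjoint_family P" "(\<Union>i. P i) = points M"
    using countable_chart_partition[OF M ne] by metis
  define I where "I c B = (\<integral>\<^sup>+ y. ennreal (vol_density M g c y) * indicator (snd c ` B) y \<partial>lborel)" for c B
  have I_UN: "I c (\<Union>j. A j) = (\<Sum>j. I c (A j))"
    if "c \<in> atlas M" "\<And>j::nat. A j \<in> sets (borel_space M)" "\<And>j. A j \<subseteq> fst c" "disjoint_family A" for c A
    unfolding I_def by (rule chart_integral_countably_additive[OF M g that])
  define m where "m B = (\<Sum>i. I (C i) (B \<inter> P i))" for B
  let ?\<mu> = "measure_of (points M) {U. openin (mtop M) U} m"
  have sp: "space ?\<mu> = points M" and st: "sets ?\<mu> = sets (borel_space M)"
    by (simp_all add: space_measure_of[OF openin_Pow] sets_measure_of[OF openin_Pow] sets_borel_space)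
  have em: "emeasure ?\<mu> B = m B" if "B \<in> sets (borel_space M)" for B
  proof (rule emeasure_measure_of[OF refl])
    show "{U. openin (mtop M) U} \<subseteq> Pow (points M)" by (rule openin_Pow)
    show "B \<in> sets ?\<mu>" using that st by simp
    show "positive (sets ?\<mu>) m" by (simp add: positive_def m_def I_def)
    show "countably_additive (sets ?\<mu>) m"
    proof (rule countably_additiveI)
      fix A :: "nat \<Rightarrow> 'a set" assume A: "range A \<subseteq> sets ?\<mu>" "disjoint_family A"
      have "I (C i) ((\<Union>j. A j) \<inter> P i) = (\<Sum>j. I (C i) (A j \<inter> P i))" for i
      proof -
        have "I (C i) (\<Union>j. A j \<inter> P i) = (\<Sum>j. I (C i) (A j \<inter> P i))"
        proof (rule I_UN[OF P(1)])
          show "A j \<inter> P i \<in> sets (borel_space M)" for j using A(1) P(3) st by auto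
          show "A j \<inter> P i \<subseteq> fst (C i)" for j using P(2) by auto
          show "disjoint_family (\<lambda>j. A j \<inter> P i)" using A(2) by (auto simp: disjoint_family_on_def)
        qed
        then show ?thesis by simp
      qed
      then show "(\<Sum>j. m (A j)) = m (\<Union>j. A j)"
        unfolding m_def by (simp add: suminf_swap_ennreal[of "\<lambda>j i. I (C i) (A j \<inter> P i)"])
    qed
  qed
  \<comment> \<open>Independence of the chart is the dilation formula for the identity map, with
    factor 1.\<close>
  have trans: "I c A = I c' A" if "c \<in> atlas M" "c' \<in> atlas M" "A \<in> sets (borel_space M)" "A \<subseteq> fst c" "A \<subseteq> fst c'" for c c' A
  proof -
    have sub: "p \<in> points M" if "p \<in> A" for p using that \<open>A \<subseteq> fst c\<close> chart_subset_points[OF M \<open>c \<in> atlas M\<close>] by auto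
    have "I c' ((\<lambda>x. x) ` A) = ennreal (1 powr (real CARD('n) / 2)) * I c A"
      unfolding I_def using that
      by (intro chart_integral_dilation[OF M M g g]) (auto simp: differential_ident[OF M sub])
    then show ?thesis by simp
  qed
  have "emeasure ?\<mu> B = I c B" if c: "c \<in> atlas M" and B: "B \<in> sets (borel_space M)" "B \<subseteq> fst c" for c B
  proof -
    have "emeasure ?\<mu> B = (\<Sum>i. I (C i) (B \<inter> P i))" using em[OF B(1)] by (simp add: m_def)
    also have "\<dots> = (\<Sum>i. I c (B \<inter> P i))"
      by (rule suminf_cong, rule trans) (use P c B in auto)
    also have "\<dots> = I c (\<Union>i. B \<inter> P i)"
    proof (rule I_UN[OF c, symmetric])
      show "B \<inter> P i \<in> sets (borel_space M)" for i using B(1) P(3) by blast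
      show "B \<inter> P i \<subseteq> fst c" for i using B(2) by blast
      show "disjoint_family (\<lambda>i. B \<inter> P i)" using P(4) unfolding disjoint_family_on_def by blast
    qed
    also have "(\<Union>i. B \<inter> P i) = B" using P(5) B(2) chart_subset_points[OF M c] by blast
    finally show ?thesis .
  qed
  then have "volume_measure M g ?\<mu>"
    unfolding volume_measure_def using sp st by (auto simp: I_def sets_borel_space)
  then show ?thesis by blast
qed

text \<open>The dilation formula for the identity also compares two candidate measures on the same
  manifold.\<close>

lemma volume_measure_unique:
  fixes M :: "('a, real^'n) mfd"
  assumes M: "smooth_manifold M" and g: "riemannian_metric M g"
    and mu: "volume_measure M g \<mu>" and nu: "volume_measure M g \<nu>"
  shows "\<mu> = \<nu>"
proof (rule measure_eqI)
  show "sets \<mu> = sets \<nu>" using volume_measureD(2)[OF mu] volume_measureD(2)[OF nu] by simp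
  fix B assume "B \<in> sets \<mu>"
  then have B: "B \<in> sets (borel_space M)" using volume_measureD(2)[OF mu] by simp
  have "emeasure \<nu> ((\<lambda>x. x) ` B) = ennreal (1 powr (real CARD('n) / 2)) * emeasure \<mu> B"
    by (rule volume_measure_dilation[OF M M g g mu nu]) (use B in \<open>auto simp: differential_ident[OF M]\<close>)
  then show "emeasure \<mu> B = emeasure \<nu> B" by simp
qed

lemma riemannian_measure_volume_measure:
  fixes M :: "('a, real^'n) mfd"
  assumes M: "smooth_manifold M" and g: "riemannian_metric M g" and ne: "points M \<noteq> {}"
  shows "volume_measure M g (riemannian_measure M g)"
proof -
  have "\<exists>!\<mu>. volume_measure M g \<mu>"
    using volume_measure_exists[OF assms] volume_measure_unique[OF M g] by blast
  from theI'[OF this] show ?thesis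
    by (simp add: riemannian_measure_def volume_measure_def)
qed

section \<open>The action on a homogeneous space\<close>

locale homogeneous_manifold =
  fixes K :: "('k, 'b) monoid_scheme" and KM :: "('k, 'd::euclidean_space) mfd"
    and L :: "'k set" and M :: "('k set, 'e::euclidean_space) mfd"
  assumes lie: "lie_group K KM" and L: "subgroup L K" and hom: "homogeneous_space K KM L M"
begin

sublocale group K
  using lie by (simp add: lie_group_def)

lemma KM: "smooth_manifold KM" and points_KM: "points KM = carrier K"
  and mult_smooth: "smooth_map (prod_mfd KM KM) KM (\<lambda>(x, y). x \<otimes>\<^bsub>K\<^esub> y)"
  using lie by (auto simp: lie_group_def)

abbreviation proj :: "'k \<Rightarrow> 'k set" where "proj x \<equiv> x <#\<^bsub>K\<^esub> L"

lemma M: "smooth_manifold M" and points_M: "points M = lcosets\<^bsub>K\<^esub> L"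
  and proj_quotient: "quotient_map (mtop KM) (mtop M) proj"
  and proj_smooth: "smooth_map KM M proj"
  and proj_submersion: "x \<in> carrier K \<Longrightarrow> differential KM M proj x ` tangent_space KM x = tangent_space M (proj x)"
  using hom by (auto simp: homogeneous_space_def)

lemma L_sub: "L \<subseteq> carrier K" using L subgroup.subset by blast

lemma proj_in: "x \<in> carrier K \<Longrightarrow> proj x \<in> points M"
  by (auto simp: points_M LCOSETS_def)

lemma points_proj: "p \<in> points M \<Longrightarrow> \<exists>x\<in>carrier K. p = proj x"
  by (auto simp: points_M LCOSETS_def)

lemma proj_one: "proj \<one>\<^bsub>K\<^esub> = L"
  by (rule lcos_mult_one[OF L_sub])

lemma base_point: "L \<in> points M"
  using proj_in[OF one_closed] by (simp add: proj_one)

lemma act_proj: "k \<in> carrier K \<Longrightarrow> x \<in> carrier K \<Longrightarrow> k <#\<^bsub>K\<^esub> proj x = proj (k \<otimes>\<^bsub>K\<^esub> x)"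
  by (rule lcos_m_assoc[OF L_sub])

lemma act_in: "k \<in> carrier K \<Longrightarrow> p \<in> points M \<Longrightarrow> k <#\<^bsub>K\<^esub> p \<in> points M"
  using points_proj[of p] by (auto simp: act_proj intro!: proj_in)

lemma act_mult:
  "k \<in> carrier K \<Longrightarrow> l \<in> carrier K \<Longrightarrow> p \<in> points M \<Longrightarrow> k <#\<^bsub>K\<^esub> (l <#\<^bsub>K\<^esub> p) = (k \<otimes>\<^bsub>K\<^esub> l) <#\<^bsub>K\<^esub> p"
  using points_proj[of p] by (auto simp: act_proj m_assoc)

lemma act_one: "p \<in> points M \<Longrightarrow> \<one>\<^bsub>K\<^esub> <#\<^bsub>K\<^esub> p = p"
  using points_proj[of p] by (auto simp: act_proj)

lemma act_inv:
  assumes "k \<in> carrier K" "p \<in> points M"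
  shows "k <#\<^bsub>K\<^esub> (inv\<^bsub>K\<^esub> k <#\<^bsub>K\<^esub> p) = p" "inv\<^bsub>K\<^esub> k <#\<^bsub>K\<^esub> (k <#\<^bsub>K\<^esub> p) = p"
  using assms by (simp_all add: act_mult act_one)

lemma act_transitive:
  assumes "p \<in> points M" "q \<in> points M"
  obtains k where "k \<in> carrier K" "q = k <#\<^bsub>K\<^esub> p"
proof -
  obtain x y where "x \<in> carrier K" "p = proj x" "y \<in> carrier K" "q = proj y"
    using points_proj assms by metis
  then show thesis
    using that[of "y \<otimes>\<^bsub>K\<^esub> inv\<^bsub>K\<^esub> x"] by (simp add: act_proj m_assoc)
qed

lemma mult_continuous: "continuous_map (prod_topology (mtop KM) (mtop KM)) (mtop KM) (\<lambda>(x, y). x \<otimes>\<^bsub>K\<^esub> y)"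
  using mult_smooth by (simp add: smooth_map_def prod_mfd_def)

lemma left_translation_continuous:
  assumes "k \<in> carrier K"
  shows "continuous_map (mtop KM) (mtop KM) (\<lambda>x. k \<otimes>\<^bsub>K\<^esub> x)"
proof -
  have "continuous_map (mtop KM) (prod_topology (mtop KM) (mtop KM)) (\<lambda>x. (k, x))"
    using assms by (simp add: continuous_map_pairedI points_KM)
  from continuous_map_compose[OF this mult_continuous] show ?thesis by (simp add: o_def)
qed

lemma right_translation_continuous:
  assumes "k \<in> carrier K"
  shows "continuous_map (mtop KM) (mtop KM) (\<lambda>x. x \<otimes>\<^bsub>K\<^esub> k)"
proof -
  have "continuous_map (mtop KM) (prod_topology (mtop KM) (mtop KM)) (\<lambda>x. (x, k))"
    using assms by (simp add: continuous_map_pairedI points_KM)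
  from continuous_map_compose[OF this mult_continuous] show ?thesis by (simp add: o_def)
qed

lemma proj_continuous: "continuous_map (mtop KM) (mtop M) proj"
  using proj_smooth by (simp add: smooth_map_def)

lemma act_continuous:
  assumes k: "k \<in> carrier K"
  shows "continuous_map (mtop M) (mtop M) (\<lambda>p. k <#\<^bsub>K\<^esub> p)"
proof (rule continuous_compose_quotient_map[OF proj_quotient])
  show "continuous_map (mtop KM) (mtop M) ((\<lambda>p. k <#\<^bsub>K\<^esub> p) \<circ> proj)"
    by (rule continuous_map_eq[OF continuous_map_compose[OF left_translation_continuous[OF k] proj_continuous]])
      (simp add: act_proj k points_KM)
qed

text \<open>Left translation is the smooth multiplication restricted to the slice with first factor
  \<open>k\<close>, read in a product chart.\<close>

lemma left_translation_differentiable: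
  assumes k: "k \<in> carrier K" and x: "x \<in> carrier K"
  shows "mdifferentiable_map KM KM (\<lambda>x. k \<otimes>\<^bsub>K\<^esub> x) x"
proof -
  have kx: "k \<otimes>\<^bsub>K\<^esub> x \<in> points KM" using k x by (simp add: points_KM)
  obtain \<kappa> a b where ch: "\<kappa> \<in> charts_at KM k" "a \<in> charts_at KM x" "b \<in> charts_at KM (k \<otimes>\<^bsub>K\<^esub> x)"
    using chart_at_in[OF KM] kx k x by (metis points_KM)
  then have at: "\<kappa> \<in> atlas KM" "k \<in> fst \<kappa>" "a \<in> atlas KM" "x \<in> fst a" "b \<in> atlas KM" "k \<otimes>\<^bsub>K\<^esub> x \<in> fst b"
    by (auto simp: charts_at_def)
  let ?m = "\<lambda>(x, y). x \<otimes>\<^bsub>K\<^esub> y" and ?c = "(fst \<kappa> \<times> fst a, map_prod (snd \<kappa>) (snd a))"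
  have "?c \<in> atlas (prod_mfd KM KM)"
    unfolding prod_mfd_def mfd.select_convs mem_Collect_eq by (intro exI[of _ \<kappa>] exI[of _ a] conjI refl at)
  then have "smooth_on (snd ?c ` {p \<in> fst ?c. ?m p \<in> fst b}) (snd b \<circ> ?m \<circ> cinv ?c)"
    using mult_smooth at(5) unfolding smooth_map_def by blast
  then have "(snd b \<circ> ?m \<circ> cinv ?c) differentiable (at (snd \<kappa> k, snd a x))"
    by (rule smooth_on_differentiable) (use at in force)
  moreover have "(\<lambda>y. (snd \<kappa> k, y)) differentiable (at (snd a x))"
    by (rule differentiableI, rule has_derivative_Pair[OF has_derivative_const has_derivative_ident])
  ultimately have "((snd b \<circ> ?m \<circ> cinv ?c) \<circ> (\<lambda>y. (snd \<kappa> k, y))) differentiable (at (snd a x))"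
    by (intro differentiable_chain_at)
  then obtain D where D: "((snd b \<circ> ?m \<circ> cinv ?c) \<circ> (\<lambda>y. (snd \<kappa> k, y)) has_derivative D) (at (snd a x))"
    by (auto simp: differentiable_def)
  have "(snd b \<circ> (\<lambda>x. k \<otimes>\<^bsub>K\<^esub> x) \<circ> cinv a has_derivative D) (at (snd a x))"
  proof (rule has_derivative_transform_within_open[OF D open_chart_range[OF KM at(3)]])
    show "snd a x \<in> snd a ` fst a" using at by auto
    fix y assume "y \<in> snd a ` fst a"
    then obtain z where z: "z \<in> fst a" "y = snd a z" by blast
    have "inj_on (map_prod (snd \<kappa>) (snd a)) (fst \<kappa> \<times> fst a)"
      by (rule map_prod_inj_on[OF chart_inj[OF KM at(1)] chart_inj[OF KM at(3)]])
    then have "cinv ?c (snd \<kappa> k, y) = (k, z)"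
      using inv_into_f_f[of "map_prod (snd \<kappa>) (snd a)" "fst \<kappa> \<times> fst a" "(k, z)"] at z by (simp add: cinv_def)
    then show "((snd b \<circ> ?m \<circ> cinv ?c) \<circ> (\<lambda>y. (snd \<kappa> k, y))) y = (snd b \<circ> (\<lambda>x. k \<otimes>\<^bsub>K\<^esub> x) \<circ> cinv a) y"
      using cinv_chart[OF KM at(3) z(1)] z(2) by simp
  qed
  then show ?thesis
    using mdifferentiable_mapI[OF KM KM left_translation_continuous[OF k] ch(2,3)] differentiableI by blast
qed

text \<open>Locally the action is \<open>proj\<close> after a left translation after a differentiable section of the
  submersion \<open>proj\<close>.\<close>
lemma act_differentiable:
  assumes k: "k \<in> carrier K" and p: "p \<in> points M"
  shows "mdifferentiable_map M M (\<lambda>p. k <#\<^bsub>K\<^esub> p) p"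
proof -
  obtain x where x: "x \<in> carrier K" "p = proj x" using points_proj[OF p] by blast
  have kx: "k \<otimes>\<^bsub>K\<^esub> x \<in> carrier K" using k x by simp
  obtain a where a: "a \<in> charts_at KM x" using chart_at_in[OF KM] x points_KM by metis
  obtain c where c: "c \<in> charts_at M p" using chart_at_in[OF M p] by blast
  obtain d where d: "d \<in> charts_at M (k <#\<^bsub>K\<^esub> p)" using chart_at_in[OF M act_in[OF k p]] by blast
  have a': "a \<in> atlas KM" "x \<in> fst a" and c': "c \<in> atlas M" "p \<in> fst c"
    using a c by (auto simp: charts_at_def)
  let ?P = "snd c \<circ> proj \<circ> cinv a" and ?O = "snd a ` {q \<in> fst a. proj q \<in> fst c}"
  let ?D = "frechet_derivative ?P (at (snd a x))"
  have O: "open ?O" by (rule open_chart_preimage[OF KM a'(1) proj_continuous chart_openin[OF M c'(1)]])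
  have sm: "smooth_on ?O ?P" using proj_smooth a' c' by (simp add: smooth_map_def)
  have x0: "snd a x \<in> ?O" using a' c' x(2) by auto
  have linD: "linear ?D" using smooth_on_has_derivative[OF sm x0] has_derivative_linear by blast
  \<comment> \<open>The submersion property read in charts: each coordinate vector at
    \<open>p\<close> comes from a tangent vector at \<open>x\<close>.\<close>
  have "surj ?D"
  proof -
    have "e \<in> range ?D" for e
    proof -
    have "coord_vec M c p e \<in> differential KM M proj x ` tangent_space KM x"
      using proj_submersion[OF x(1)] coord_vec_in_tangent_space[OF M c] x(2) by simp
    then obtain v where v: "v \<in> tangent_space KM x" "coord_vec M c p e = differential KM M proj x v" by blast
    have "mdifferentiable KM (snd c \<circ> proj) x"
      using smooth_map_mdifferentiable_map[OF KM M proj_smooth] x c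
      by (simp add: mdifferentiable_map_def[OF KM] points_KM)
    from dfun_frechet[OF KM this a v(1)]
    have "differential KM M proj x v c = ?D (v a)"
      using c x(2) by (simp add: differential_def dfun_def)
    then show "e \<in> range ?D" using v(2) coord_vec_apply[OF M c, of e] by (metis rangeI)
    qed
    then show ?thesis by blast
  qed
  \<comment> \<open>On the affine slice through \<open>snd a x\<close> in the directions of a linear
    right inverse \<open>J\<close>, the projection has the identity as its derivative at 0;
    inverting it there produces the section.\<close>
  then obtain J where J: "linear J" "?D \<circ> J = id"
    using linear_surjective_right_inverse[OF linD] by blast
  have bJ: "bounded_linear J" using J(1) by (simp add: linear_conv_bounded_linear)
  let ?A = "\<lambda>z. snd a x + J z"
  define U where "U = ?A -` ?O"
  have U: "open U"
    unfolding U_def by (rule open_vimage[OF O]) (intro continuous_intros linear_continuous_on[OF bJ])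
  have U0: "0 \<in> U" using x0 J(1) by (simp add: U_def linear_0)
  have CA: "Ck_on (Suc 0) ?A U"
    by (rule Ck_on_add[OF U Ck_on_const Ck_on_bounded_linear[OF bJ U]])
  have "Ck_on (Suc 0) ?P ?O" using sm unfolding smooth_on_def by (rule spec)
  moreover have "?A ` U \<subseteq> ?O" unfolding U_def by (rule image_vimage_subset)
  ultimately have CQ: "Ck_on (Suc 0) (\<lambda>z. ?P (?A z)) U"
    by (rule Ck_on_compose[OF U O _ CA])
  have "(?A has_derivative J) (at 0)"
    using has_derivative_add[OF has_derivative_const bounded_linear_imp_has_derivative[OF bJ]] by simp
  moreover have "(?P has_derivative ?D) (at (?A 0))"
    using smooth_on_has_derivative[OF sm x0] J(1) by (simp add: linear_0)
  ultimately have "((\<lambda>z. ?P (?A z)) has_derivative (\<lambda>z. ?D (J z))) (at 0)"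
    using diff_chain_at[of ?A J 0 ?P ?D] by (simp add: o_def)
  from frechet_derivative_at[OF this]
  have "frechet_derivative (\<lambda>z. ?P (?A z)) (at 0) = ?D \<circ> J"
    unfolding o_def by (rule sym)
  then have "inj (frechet_derivative (\<lambda>z. ?P (?A z)) (at 0))" by (simp add: J(2))
  from C1_local_inverse[OF U CQ U0 this] obtain U' V s where V: "U' \<subseteq> U" "0 \<in> U'" "open V" "?P (?A 0) \<in> V"
    "homeomorphism U' V (\<lambda>z. ?P (?A z)) s" "\<And>y. y \<in> V \<Longrightarrow> s differentiable (at y)"
    by metis
  have P0: "?P (?A 0) = snd c p"
    using J(1) cinv_chart[OF KM a'] x(2) by (simp add: linear_0)
  have s0: "s (snd c p) = 0" using V(2,5) P0 by (metis homeomorphism_apply1)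
  \<comment> \<open>\<open>?S\<close> is the section in coordinates and \<open>?G\<close> is left
    translation followed by \<open>proj\<close>, so \<open>?G \<circ> ?S\<close> represents the
    action near \<open>p\<close>.\<close>
  let ?S = "\<lambda>w. ?A (s w)" and ?G = "snd d \<circ> proj \<circ> (\<lambda>x. k \<otimes>\<^bsub>K\<^esub> x) \<circ> cinv a"
  have "?G differentiable (at (snd a x))"
  proof -
    have "mdifferentiable KM (snd d \<circ> proj) (k \<otimes>\<^bsub>K\<^esub> x)"
      using smooth_map_mdifferentiable_map[OF KM M proj_smooth] kx d x k
      by (simp add: mdifferentiable_map_def[OF KM] points_KM act_proj)
    moreover have "x \<in> points KM" using x(1) by (simp add: points_KM)
    ultimately have "mdifferentiable KM (snd d \<circ> proj \<circ> (\<lambda>x. k \<otimes>\<^bsub>K\<^esub> x)) x"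
      by (rule mdifferentiable_compose(1)[OF KM KM left_translation_continuous[OF k]
            left_translation_differentiable[OF k x(1)] _ _ zero_in_tangent[OF KM a]])
    then show ?thesis using a by (simp add: mdifferentiable_def[OF KM])
  qed
  moreover have "?S differentiable (at (snd c p))"
  proof -
    have "s differentiable (at (snd c p))" using V(4,6) P0 by simp
    then show ?thesis
      using has_derivative_add[OF has_derivative_const bounded_linear.has_derivative[OF bJ]] unfolding differentiable_def by blast
  qed
  moreover have "?S (snd c p) = snd a x" using s0 J(1) by (simp add: linear_0)
  ultimately have "(?G \<circ> ?S) differentiable (at (snd c p))"
    by (intro differentiable_chain_at) simp_all
  then obtain E where E: "((?G \<circ> ?S) has_derivative E) (at (snd c p))" by (auto simp: differentiable_def)
  have "((snd d \<circ> (\<lambda>p. k <#\<^bsub>K\<^esub> p) \<circ> cinv c) has_derivative E) (at (snd c p))"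
  proof (rule has_derivative_transform_within_open[OF E V(3)])
    show "snd c p \<in> V" using V(4) P0 by simp
    fix w assume "w \<in> V"
    then have "s w \<in> U'" "?P (?S w) = w"
      using V(5) by (auto simp: homeomorphism_def)
    then obtain q where q: "q \<in> fst a" "proj q \<in> fst c" "?S w = snd a q" using V(1) by (auto simp: U_def)
    then have "w = snd c (proj q)" using \<open>?P (?S w) = w\<close> cinv_chart[OF KM a'(1) q(1)] by simp
    then have "cinv c w = proj q" using cinv_chart[OF M c'(1) q(2)] by simp
    moreover have "q \<in> carrier K" using q(1) chart_subset_points[OF KM a'(1)] points_KM by auto
    ultimately show "(?G \<circ> ?S) w = (snd d \<circ> (\<lambda>p. k <#\<^bsub>K\<^esub> p) \<circ> cinv c) w"
      using cinv_chart[OF KM a'(1) q(1)] q(3) k by (simp add: act_proj)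
  qed
  then show ?thesis
    using mdifferentiable_mapI[OF M M act_continuous[OF k] c d] differentiableI by blast
qed

end

section \<open>Gradients and the Laplacian\<close>

lemma linear_axis_expansion:
  fixes D :: "real^'n \<Rightarrow> 'v::real_normed_vector"
  assumes "linear D"
  shows "D x = (\<Sum>i\<in>UNIV. x $ i *\<^sub>R D (axis i 1))"
proof -
  interpret linear D by fact
  have "D x = D (\<Sum>i\<in>UNIV. x $ i *\<^sub>R axis i 1)" by (simp only: vec_axis_expansion[symmetric])
  then show ?thesis by (simp only: sum scale)
qed

lemma posdef_inverse:
  fixes A :: "real^'n^'n"
  assumes "\<And>x. x \<noteq> 0 \<Longrightarrow> 0 < x \<bullet> (A *v x)"
  obtains B where "A ** B = mat 1" "B ** A = mat 1"
proof -
  have "invertible A" using posdef_det_pos[OF assms] by (simp add: invertible_det_nz)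
  then show thesis using that unfolding invertible_def by blast
qed

definition partials :: "('a, real^'n) chart \<Rightarrow> ('a \<Rightarrow> real) \<Rightarrow> real^'n \<Rightarrow> real^'n" where
  "partials c u y = (\<chi> j. frechet_derivative (u \<circ> cinv c) (at y) (axis j 1))"

lemma frechet_eq_partials:
  fixes M :: "('a, real^'n) mfd"
  assumes "smooth_manifold M" "smooth_fun M u" "c \<in> charts_at M p"
  shows "frechet_derivative (u \<circ> cinv c) (at (snd c p)) x = x \<bullet> partials c u (snd c p)"
proof -
  have "mdifferentiable M u p"
    by (rule smooth_fun_mdifferentiable[OF assms(1,2) charts_at_points[OF assms(1,3)]])
  from mdifferentiable_has_derivative[OF assms(1) this assms(3)]
  have "linear (frechet_derivative (u \<circ> cinv c) (at (snd c p)))" by (rule has_derivative_linear)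
  from linear_axis_expansion[OF this, of x] show ?thesis
    by (simp only: partials_def inner_vec_def vec_lambda_beta real_scaleR_def inner_real_def)
qed

text \<open>The defining condition of the gradient amounts to a linear system with the metric matrix
  as coefficients. Since that matrix is invertible, the system has exactly one solution and the
  definite description \<open>gradient\<close> denotes it.\<close>

lemma gradient_chart:
  fixes M :: "('a, real^'n) mfd"
  assumes M: "smooth_manifold M" and g: "riemannian_metric M g" and u: "smooth_fun M u"
    and c: "c \<in> charts_at M p"
  shows "gradient M g u p \<in> tangent_space M p"
    and "metric_matrix M g c p *v gradient M g u p c = partials c u (snd c p)"
proof -
  let ?G = "metric_matrix M g c p" and ?b = "partials c u (snd c p)"
  have p: "p \<in> points M" by (rule charts_at_points[OF M c])
  note du = smooth_fun_mdifferentiable[OF M u p]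
  note T = coord_vec_in_tangent_space[OF M c]
  have iff: "(\<forall>v\<in>tangent_space M p. g p w v = dfun M u p v) \<longleftrightarrow> ?G *v w c = ?b"
    if w: "w \<in> tangent_space M p" for w
  proof -
    have "g p w v = v c \<bullet> (?G *v w c)" "dfun M u p v = v c \<bullet> ?b" if v: "v \<in> tangent_space M p" for v
      using riemannian_metricD(1)[OF g p w v] metric_in_chart[OF M g c v w]
        dfun_frechet[OF M du c v] frechet_eq_partials[OF M u c] by simp_all
    then have "(\<forall>v\<in>tangent_space M p. g p w v = dfun M u p v) \<longleftrightarrow>
        (\<forall>v\<in>tangent_space M p. v c \<bullet> (?G *v w c) = v c \<bullet> ?b)" by simp
    also have "\<dots> \<longleftrightarrow> (\<forall>e. e \<bullet> (?G *v w c) = e \<bullet> ?b)"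
      using T coord_vec_apply[OF M c] by metis
    also have "\<dots> \<longleftrightarrow> ?G *v w c = ?b" by (simp add: vector_eq_ldot)
    finally show ?thesis .
  qed
  obtain B where B: "?G ** B = mat 1" "B ** ?G = mat 1"
    using posdef_inverse[OF metric_matrix_posdef[OF M g c]] by blast
  have "\<exists>!w. w \<in> tangent_space M p \<and> (\<forall>v\<in>tangent_space M p. g p w v = dfun M u p v)"
  proof (rule ex1I)
    show "coord_vec M c p (B *v ?b) \<in> tangent_space M p \<and>
        (\<forall>v\<in>tangent_space M p. g p (coord_vec M c p (B *v ?b)) v = dfun M u p v)"
      using T iff[OF T] by (simp add: coord_vec_apply[OF M c] matrix_vector_mul_assoc B)
    fix w assume w: "w \<in> tangent_space M p \<and> (\<forall>v\<in>tangent_space M p. g p w v = dfun M u p v)"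
    then have "?G *v w c = ?b" using iff by blast
    then have "w c = B *v ?b"
      by (metis B(2) matrix_vector_mul_assoc matrix_vector_mul_lid)
    then show "w = coord_vec M c p (B *v ?b)"
      using w coord_vec_of_tangent[OF M c] by metis
  qed
  then have "gradient M g u p \<in> tangent_space M p \<and> (\<forall>v\<in>tangent_space M p. g p (gradient M g u p) v = dfun M u p v)"
    unfolding gradient_def by (rule theI')
  then show "gradient M g u p \<in> tangent_space M p" "?G *v gradient M g u p c = ?b"
    using iff by blast+
qed

lemma partials_smooth:
  fixes M :: "('a, real^'n) mfd"
  assumes "smooth_fun M u" "c \<in> atlas M"
  shows "Ck_on k (\<lambda>y. partials c u y $ i) (snd c ` fst c)"
  using assms smooth_on_frechet_derivative[of "snd c ` fst c" "u \<circ> cinv c"]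
  by (simp add: partials_def smooth_fun_def smooth_on_def)

text \<open>Makes the derivatives in the divergence of a gradient genuine ones: the coordinates of
  the gradient solve a linear system with smooth coefficients, so Cramer's rule applies.\<close>

lemma gradient_components_differentiable:
  fixes M :: "('a, real^'n) mfd"
  assumes M: "smooth_manifold M" and g: "riemannian_metric M g" and u: "smooth_fun M u"
    and c: "c \<in> atlas M" and y: "y \<in> snd c ` fst c"
  shows "(\<lambda>y. vol_density M g c y * (gradient M g u (cinv c y) c $ i)) differentiable (at y)"
proof -
  let ?R = "snd c ` fst c"
  note R = open_chart_range[OF M c]
  have det: "0 < det (metric_matrix M g c (cinv c y))" if "y \<in> ?R" for y
    by (rule det_metric_matrix_pos[OF M g cinv_charts_at[OF c that]])
  have "Ck_on (Suc 0) (\<lambda>y. gradient M g u (cinv c y) c) ?R"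
  proof (rule Ck_on_linear_system[OF R])
    show "Ck_on (Suc 0) (\<lambda>y. metric_matrix M g c (cinv c y) $ i $ j) ?R" for i j
      using metric_matrix_smooth[OF g c] unfolding smooth_on_def by (rule spec)
    show "Ck_on (Suc 0) (\<lambda>y. partials c u y $ i) ?R" for i by (rule partials_smooth[OF u c])
    show "det (metric_matrix M g c (cinv c y)) \<noteq> 0" if "y \<in> ?R" for y using det[OF that] by simp
    show "metric_matrix M g c (cinv c y) *v gradient M g u (cinv c y) c = partials c u y" if "y \<in> ?R" for y
      using gradient_chart(2)[OF M g u cinv_charts_at[OF c that]] chart_cinv[OF that] by simp
  qed
  from differentiableI[OF Ck_on_SucD(1)[OF this y]]
  have "(\<lambda>y. gradient M g u (cinv c y) c) differentiable (at y)" .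
  from bounded_linear.has_derivative[OF bounded_linear_vec_nth this[unfolded frechet_derivative_works]]
  have 1: "(\<lambda>y. gradient M g u (cinv c y) c $ i) differentiable (at y)" by (rule differentiableI)
  have "Ck_on (Suc 0) (\<lambda>y. det (metric_matrix M g c (cinv c y))) ?R"
    by (rule det_metric_matrix_Ck[OF M g c])
  from has_derivative_real_sqrt[OF det[OF y] Ck_on_SucD(1)[OF this y]]
  have 2: "vol_density M g c differentiable (at y)"
    unfolding vol_density_eq[abs_def] by (rule differentiableI)
  show ?thesis by (rule differentiable_mult[OF 2 1])
qed

text \<open>Take the divergence of \<open>\<Sum>\<^sub>i f\<^sub>i grad f\<^sub>i = grad \<bar>f\<bar>\<^sup>2 / 2 = 0\<close>.\<close>
lemma sum_gradient_laplacian: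
  fixes M :: "('a, real^'n) mfd" and f :: "'a \<Rightarrow> real^'N"
  assumes M: "smooth_manifold M" and g: "riemannian_metric M g"
    and f: "\<And>k. smooth_fun M (\<lambda>x. f x $ k)" and r: "\<And>x. x \<in> points M \<Longrightarrow> f x \<bullet> f x = r"
    and p: "p \<in> points M"
  shows "(\<Sum>k\<in>UNIV. dfun M (\<lambda>x. f x $ k) p (gradient M g (\<lambda>x. f x $ k) p)) =
    - (\<Sum>k\<in>UNIV. f p $ k * laplacian M g (\<lambda>x. f x $ k) p)"
proof -
  let ?c = "chart_at M p"
  note c = chart_at_in[OF M p]
  have ca: "?c \<in> atlas M" and pc: "p \<in> fst ?c" using c by (auto simp: charts_at_def)
  let ?R = "snd ?c ` fst ?c" and ?y = "snd ?c p"
  have R: "open ?R" by (rule open_chart_range[OF M ca])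
  have y: "?y \<in> ?R" using pc by blast
  define u where "u k = (\<lambda>x. f x $ k)" for k
  have us: "smooth_fun M (u k)" for k using f by (simp add: u_def)
  define F where "F k = u k \<circ> cinv ?c" for k
  define X where "X k y = gradient M g (u k) (cinv ?c y) ?c" for k y
  define \<rho> where "\<rho> = vol_density M g ?c"
  define D where "D k i = frechet_derivative (\<lambda>y. \<rho> y * X k y $ i) (at ?y)" for k i
  have dF: "(F k has_derivative frechet_derivative (F k) (at y)) (at y)" if "y \<in> ?R" for k y
    using us[of k] ca that by (intro smooth_on_has_derivative) (auto simp: smooth_fun_def F_def)
  have dX: "((\<lambda>y. \<rho> y * X k y $ i) has_derivative D k i) (at ?y)" for k i
    using gradient_components_differentiable[OF M g us ca y]
    unfolding D_def \<rho>_def X_def by (simp only: frechet_derivative_works)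
  \<comment> \<open>Differentiating the constant \<open>f x \<bullet> f x\<close> shows that the
    metric matrix sends this sum to 0, and a positive definite matrix has no kernel.\<close>
  have sum0: "(\<Sum>k\<in>UNIV. F k y *\<^sub>R X k y) = 0" if y: "y \<in> ?R" for y
  proof -
    note cy = cinv_charts_at[OF ca y]
    let ?G = "metric_matrix M g ?c (cinv ?c y)"
    have "(\<Sum>k\<in>UNIV. F k y * partials ?c (u k) y $ j) = 0" for j
    proof -
      have "((\<lambda>y. \<Sum>k\<in>UNIV. F k y * F k y) has_derivative
          (\<lambda>v. \<Sum>k\<in>UNIV. F k y * frechet_derivative (F k) (at y) v + frechet_derivative (F k) (at y) v * F k y)) (at y)"
        by (intro has_derivative_sum has_derivative_mult dF y)
      moreover have "((\<lambda>y. \<Sum>k\<in>UNIV. F k y * F k y) has_derivative (\<lambda>v. 0)) (at y)"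
      proof (rule has_derivative_transform_within_open[OF has_derivative_const R y])
        fix z assume "z \<in> ?R"
        then have "cinv ?c z \<in> points M" 
          using cinv_in[of z ?c] chart_subset_points[OF M ca] by (metis subsetD)
        from r[OF this] show "r = (\<Sum>k\<in>UNIV. F k z * F k z)"
          by (simp add: F_def u_def inner_vec_def)
      qed
      ultimately have "(\<lambda>v. \<Sum>k\<in>UNIV. F k y * frechet_derivative (F k) (at y) v + frechet_derivative (F k) (at y) v * F k y) = (\<lambda>v. 0)"
        by (rule has_derivative_unique)
      then have "(\<Sum>k\<in>UNIV. F k y * frechet_derivative (F k) (at y) (axis j 1) + frechet_derivative (F k) (at y) (axis j 1) * F k y) = 0"
        by (rule fun_cong)
      then have "(\<Sum>k\<in>UNIV. 2 * (F k y * frechet_derivative (F k) (at y) (axis j 1))) = 0"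
        by (simp add: mult.commute)
      then have "(\<Sum>k\<in>UNIV. F k y * frechet_derivative (F k) (at y) (axis j 1)) = 0"
        by (simp add: sum_distrib_left[symmetric])
      then show ?thesis by (simp add: partials_def F_def)
    qed
    moreover have "?G *v (\<Sum>k\<in>UNIV. F k y *\<^sub>R X k y) = (\<Sum>k\<in>UNIV. F k y *\<^sub>R partials ?c (u k) y)"
      using gradient_chart(2)[OF M g us cy] chart_cinv[OF y]
      by (simp add: linear_sum[OF matrix_vector_mul_linear] matrix_vector_mult_scaleR X_def)
    ultimately have "?G *v (\<Sum>k\<in>UNIV. F k y *\<^sub>R X k y) = 0" by (simp add: vec_eq_iff)
    then show ?thesis
      using metric_matrix_posdef[OF M g cy, of "\<Sum>k\<in>UNIV. F k y *\<^sub>R X k y"] by fastforce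
  qed
  \<comment> \<open>The product rule for component \<open>i\<close> of the vanishing sum, weighted
    by the density. Summed over \<open>i\<close>, the first terms form the Laplacians and the second
    ones the values of \<open>dfun\<close> on the gradients, both multiplied by the density at the
    point.\<close>
  have key: "(\<Sum>k\<in>UNIV. F k ?y * D k i (axis i 1) + frechet_derivative (F k) (at ?y) (axis i 1) * (\<rho> ?y * X k ?y $ i)) = 0" for i
  proof -
    have "((\<lambda>y. \<Sum>k\<in>UNIV. F k y * (\<rho> y * X k y $ i)) has_derivative
        (\<lambda>v. \<Sum>k\<in>UNIV. F k ?y * D k i v + frechet_derivative (F k) (at ?y) v * (\<rho> ?y * X k ?y $ i))) (at ?y)"
      by (intro has_derivative_sum has_derivative_mult dF y dX)
    moreover have "((\<lambda>y. \<Sum>k\<in>UNIV. F k y * (\<rho> y * X k y $ i)) has_derivative (\<lambda>v. 0)) (at ?y)"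
    proof (rule has_derivative_transform_within_open[OF has_derivative_const R y])
      fix z assume z: "z \<in> ?R"
      have "(\<Sum>k\<in>UNIV. F k z * (\<rho> z * X k z $ i)) = \<rho> z * (\<Sum>k\<in>UNIV. F k z *\<^sub>R X k z) $ i"
        by (simp add: sum_distrib_left mult.left_commute)
      then show "0 = (\<Sum>k\<in>UNIV. F k z * (\<rho> z * X k z $ i))" by (simp add: sum0[OF z])
    qed
    ultimately have "(\<lambda>v. \<Sum>k\<in>UNIV. F k ?y * D k i v + frechet_derivative (F k) (at ?y) v * (\<rho> ?y * X k ?y $ i)) = (\<lambda>v. 0)"
      by (rule has_derivative_unique)
    then show ?thesis by (rule fun_cong)
  qed
  have \<rho>pos: "0 < \<rho> ?y" unfolding \<rho>_def by (rule vol_density_pos[OF M g ca y])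
  have lap: "laplacian M g (u k) p = (\<Sum>i\<in>UNIV. D k i (axis i 1)) / \<rho> ?y" for k
    unfolding laplacian_def divergence_def Let_def D_def \<rho>_def X_def ..
  have Xp: "X k ?y = gradient M g (u k) p ?c" for k
    by (simp add: X_def cinv_chart[OF M ca pc])
  have df: "dfun M (u k) p (gradient M g (u k) p) = (\<Sum>i\<in>UNIV. frechet_derivative (F k) (at ?y) (axis i 1) * X k ?y $ i)" for k
  proof -
    have "dfun M (u k) p (gradient M g (u k) p) = frechet_derivative (F k) (at ?y) (X k ?y)"
      by (simp add: dfun_def F_def Xp)
    also have "\<dots> = (\<Sum>i\<in>UNIV. X k ?y $ i *\<^sub>R frechet_derivative (F k) (at ?y) (axis i 1))"
      by (rule linear_axis_expansion[OF has_derivative_linear[OF dF[OF y]]])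
    finally show ?thesis by (simp add: mult.commute)
  qed
  have "0 = (\<Sum>i\<in>UNIV. \<Sum>k\<in>UNIV. F k ?y * D k i (axis i 1) + frechet_derivative (F k) (at ?y) (axis i 1) * (\<rho> ?y * X k ?y $ i))"
    by (simp add: key)
  also have "\<dots> = (\<Sum>k\<in>UNIV. \<Sum>i\<in>UNIV. F k ?y * D k i (axis i 1) + frechet_derivative (F k) (at ?y) (axis i 1) * (\<rho> ?y * X k ?y $ i))"
    by (rule sum.swap)
  also have "\<dots> = (\<Sum>k\<in>UNIV. \<rho> ?y * (F k ?y * laplacian M g (u k) p + dfun M (u k) p (gradient M g (u k) p)))"
  proof (rule sum.cong[OF refl])
    fix k
    have "(\<Sum>i\<in>UNIV. D k i (axis i 1)) = \<rho> ?y * laplacian M g (u k) p" using \<rho>pos by (simp add: lap)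
    moreover have "(\<Sum>i\<in>UNIV. frechet_derivative (F k) (at ?y) (axis i 1) * (\<rho> ?y * X k ?y $ i)) =
        \<rho> ?y * dfun M (u k) p (gradient M g (u k) p)"
      unfolding df sum_distrib_left by (simp add: mult.left_commute)
    ultimately show "(\<Sum>i\<in>UNIV. F k ?y * D k i (axis i 1) + frechet_derivative (F k) (at ?y) (axis i 1) * (\<rho> ?y * X k ?y $ i))
        = \<rho> ?y * (F k ?y * laplacian M g (u k) p + dfun M (u k) p (gradient M g (u k) p))"
      by (simp only: sum.distrib sum_distrib_left[symmetric] distrib_left mult.left_commute[of "F k ?y"])
  qed
  also have "\<dots> = \<rho> ?y * ((\<Sum>k\<in>UNIV. F k ?y * laplacian M g (u k) p) + (\<Sum>k\<in>UNIV. dfun M (u k) p (gradient M g (u k) p)))"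
    by (simp only: sum_distrib_left[symmetric] sum.distrib)
  finally have "(\<Sum>k\<in>UNIV. F k ?y * laplacian M g (u k) p) + (\<Sum>k\<in>UNIV. dfun M (u k) p (gradient M g (u k) p)) = 0"
    using \<rho>pos by simp
  moreover have "F k ?y = f p $ k" for k by (simp add: F_def u_def cinv_chart[OF M ca pc])
  ultimately show ?thesis by (simp add: u_def)
qed

text \<open>With \<open>b k\<close> the vector of partial derivatives of the k-th component and
  \<open>B\<close> the inverse of the metric matrix \<open>G\<close>, the gradients are
  \<open>B *v b k\<close>, and the hypothesis says that the sum of the dyads of the
  \<open>b k\<close> is \<open>C G\<close>. The left-hand side is therefore the trace of
  \<open>B ** (C G)\<close>.\<close>

lemma trace_gradient:
  fixes M :: "('a, real^'n) mfd" and f :: "'a \<Rightarrow> real^'N"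
  assumes M: "smooth_manifold M" and g: "riemannian_metric M g"
    and f: "\<And>k. smooth_fun M (\<lambda>x. f x $ k)" and p: "p \<in> points M"
    and C: "\<And>v w. v \<in> tangent_space M p \<Longrightarrow> w \<in> tangent_space M p \<Longrightarrow>
      (\<Sum>k\<in>UNIV. dfun M (\<lambda>x. f x $ k) p v * dfun M (\<lambda>x. f x $ k) p w) = C * g p v w"
  shows "(\<Sum>k\<in>UNIV. dfun M (\<lambda>x. f x $ k) p (gradient M g (\<lambda>x. f x $ k) p)) = C * real CARD('n)"
proof -
  let ?c = "chart_at M p"
  note c = chart_at_in[OF M p]
  let ?G = "metric_matrix M g ?c p" and ?u = "\<lambda>k x. f x $ k"
  define b where "b k = partials ?c (?u k) (snd ?c p)" for k
  note T = coord_vec_in_tangent_space[OF M c]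
  have d: "dfun M (?u k) p v = v ?c \<bullet> b k" if "v \<in> tangent_space M p" for k v
    using dfun_frechet[OF M smooth_fun_mdifferentiable[OF M f p] c that] frechet_eq_partials[OF M f c]
    by (simp add: b_def)
  have bb: "(\<Sum>k\<in>UNIV. b k $ i * b k $ j) = C * ?G $ i $ j" for i j
    using C[OF T T, of "axis i 1" "axis j 1"] d[OF T]
    by (simp add: coord_vec_apply[OF M c] inner_axis' metric_matrix_def)
  obtain B where B: "?G ** B = mat 1" "B ** ?G = mat 1"
    using posdef_inverse[OF metric_matrix_posdef[OF M g c]] by blast
  have X: "gradient M g (?u k) p ?c = B *v b k" for k
    using gradient_chart(2)[OF M g f c] unfolding b_def
    by (metis B(2) matrix_vector_mul_assoc matrix_vector_mul_lid)
  have "(\<Sum>k\<in>UNIV. dfun M (?u k) p (gradient M g (?u k) p)) = (\<Sum>k\<in>UNIV. \<Sum>i\<in>UNIV. \<Sum>j\<in>UNIV. B $ i $ j * (b k $ i * b k $ j))"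
    by (simp add: d[OF gradient_chart(1)[OF M g f c]] X inner_vec_def matrix_vector_mult_def sum_distrib_left
        sum_distrib_right mult.assoc mult.left_commute mult.commute)
  also have "\<dots> = (\<Sum>i\<in>UNIV. \<Sum>k\<in>UNIV. \<Sum>j\<in>UNIV. B $ i $ j * (b k $ i * b k $ j))" by (rule sum.swap)
  also have "\<dots> = (\<Sum>i\<in>UNIV. \<Sum>j\<in>UNIV. \<Sum>k\<in>UNIV. B $ i $ j * (b k $ i * b k $ j))"
    by (intro sum.cong refl sum.swap)
  also have "\<dots> = (\<Sum>i\<in>UNIV. \<Sum>j\<in>UNIV. B $ i $ j * (C * ?G $ j $ i))"
    by (simp add: sum_distrib_left[symmetric] bb[symmetric] mult.commute)
  also have "\<dots> = C * (\<Sum>i\<in>UNIV. (B ** ?G) $ i $ i)"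
    by (simp add: matrix_matrix_mult_def sum_distrib_left mult.left_commute)
  also have "\<dots> = C * real CARD('n)" by (simp add: B(2) mat_def)
  finally show ?thesis .
qed

section \<open>Pencils of quadratic forms\<close>

text \<open>The Rayleigh quotient attains its minimum on the compact unit sphere, and homogeneity of
  degree 0 makes this minimum global.\<close>

lemma rayleigh_minimum:
  fixes A B :: "real^'n^'n"
  assumes pos: "\<And>x. x \<noteq> 0 \<Longrightarrow> 0 < x \<bullet> (A *v x)"
  obtains c x0 where "x0 \<noteq> 0" "x0 \<bullet> (B *v x0) = c * (x0 \<bullet> (A *v x0))" "\<And>x. c * (x \<bullet> (A *v x)) \<le> x \<bullet> (B *v x)"
proof -
  let ?q = "\<lambda>x. (x \<bullet> (B *v x)) / (x \<bullet> (A *v x))"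
  have ne: "x \<bullet> (A *v x) \<noteq> 0" if "x \<in> sphere 0 1" for x
  proof -
    have "x \<noteq> 0" using that by auto
    then show ?thesis using pos[of x] by simp
  qed
  have "continuous_on (sphere 0 1) ?q"
    by (intro continuous_on_divide continuous_on_inner continuous_on_id linear_continuous_on ballI ne
        matrix_vector_mul_bounded_linear)
  moreover have "sphere (0::real^'n) 1 \<noteq> {}" by simp
  ultimately obtain x0 where x0: "x0 \<in> sphere 0 1" "\<And>x. x \<in> sphere 0 1 \<Longrightarrow> ?q x0 \<le> ?q x"
    using continuous_attains_inf[OF compact_sphere] by blast
  have x0n: "x0 \<noteq> 0" using x0(1) by auto
  show thesis
  proof (rule that[of x0 "?q x0"])
    show "x0 \<noteq> 0" by (rule x0n)
    show "x0 \<bullet> (B *v x0) = ?q x0 * (x0 \<bullet> (A *v x0))" using ne[OF x0(1)] by simp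
    fix x
    show "?q x0 * (x \<bullet> (A *v x)) \<le> x \<bullet> (B *v x)"
    proof (cases "x = 0")
      case False
      let ?z = "(1 / norm x) *\<^sub>R x"
      have "?z \<in> sphere 0 1" using False by simp
      from x0(2)[OF this] have "?q x0 \<le> ?q x"
        using False by (simp add: matrix_vector_mult_scaleR)
      then show ?thesis using pos[OF False] by (simp add: pos_le_divide_eq)
    qed simp
  qed
qed

text \<open>A zero of a positive semidefinite form is a minimum, so the gradient
  \<open>2 Q x\<close> vanishes there; otherwise a small step from \<open>x\<close> against
  \<open>Q *v x\<close> would make the form negative.\<close>

lemma psd_kernel:
  fixes Q :: "real^'n^'n"
  assumes sym: "\<And>x y. x \<bullet> (Q *v y) = y \<bullet> (Q *v x)" and psd: "\<And>x. 0 \<le> x \<bullet> (Q *v x)" and x: "x \<bullet> (Q *v x) = 0"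
  shows "Q *v x = 0"
proof (rule ccontr)
  assume ne: "Q *v x \<noteq> 0"
  define y where "y = Q *v x"
  define s where "s = y \<bullet> (Q *v x)"
  define r where "r = y \<bullet> (Q *v y)"
  have s: "0 < s" using ne by (simp add: s_def y_def)
  have r: "0 \<le> r" using psd by (simp add: r_def)
  have "0 \<le> 2 * t * s + t\<^sup>2 * r" for t
  proof -
    have "0 \<le> (x + t *\<^sub>R y) \<bullet> (Q *v (x + t *\<^sub>R y))" by (rule psd)
    also have "\<dots> = 2 * t * s + t\<^sup>2 * r"
      using sym[of x y] x
      by (simp add: matrix_vector_right_distrib matrix_vector_mult_scaleR inner_add_left inner_add_right
          s_def r_def power2_eq_square algebra_simps)
    finally show ?thesis .
  qed
  \<comment> \<open>A step length for which the linear term outweighs the quadratic one; adding 1 to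
    the denominator covers the case \<open>r = 0\<close>.\<close>
  moreover define a where "a = s / (r + 1)"
  then have a: "s = a * (r + 1)" "0 < a" using r s by (simp_all add: divide_pos_pos)
  ultimately have "0 \<le> 2 * (- a) * s + (- a)\<^sup>2 * r" by blast
  also have "\<dots> = - (a * a) * (r + 2)" by (simp add: a(1) power2_eq_square algebra_simps)
  also have "\<dots> < 0" using a(2) r by (intro mult_neg_pos) auto
  finally show False by simp
qed

section \<open>Smooth functions and integration\<close>

text \<open>\<open>smooth_fun\<close> constrains only the chart representations, so open preimages
  have to be glued from their parts in the charts.\<close>

lemma smooth_fun_continuous_map:
  fixes M :: "('a, 'e::euclidean_space) mfd" and u :: "'a \<Rightarrow> 'v::real_normed_vector"
  assumes M: "smooth_manifold M" and u: "smooth_fun M u"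
  shows "continuous_map (mtop M) euclidean u"
proof -
  have "openin (mtop M) {x \<in> points M. u x \<in> W}" if W: "open W" for W
  proof -
    have "openin (mtop M) {x \<in> fst c. u x \<in> W}" if c: "c \<in> atlas M" for c
    proof -
      have "continuous_on (snd c ` fst c) (u \<circ> cinv c)"
        using u c by (intro smooth_on_imp_continuous_on) (auto simp: smooth_fun_def)
      from continuous_openin_preimage_gen[OF this W]
      have "openin (top_of_set (snd c ` fst c)) (snd c ` fst c \<inter> (u \<circ> cinv c) -` W)" .
      then have o: "open (snd c ` fst c \<inter> (u \<circ> cinv c) -` W)"
        using open_chart_range[OF M c] openin_open_trans by blast
      have "openin (subtopology (mtop M) (fst c))
          {x \<in> topspace (subtopology (mtop M) (fst c)). snd c x \<in> snd c ` fst c \<inter> (u \<circ> cinv c) -` W}"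
        by (rule openin_continuous_map_preimage[OF continuous_map_chart[OF M c]]) (use o in simp)
      moreover have "{x \<in> topspace (subtopology (mtop M) (fst c)). snd c x \<in> snd c ` fst c \<inter> (u \<circ> cinv c) -` W} = {x \<in> fst c. u x \<in> W}"
        using chart_subset_points[OF M c] cinv_chart[OF M c] by auto metis
      ultimately show ?thesis
        using openin_trans_full[OF _ chart_openin[OF M c]] by simp
    qed
    then have "openin (mtop M) (\<Union>c\<in>atlas M. {x \<in> fst c. u x \<in> W})" by (intro openin_Union) auto
    moreover have "(\<Union>c\<in>atlas M. {x \<in> fst c. u x \<in> W}) = {x \<in> points M. u x \<in> W}"
      using Union_charts[OF M] by auto
    ultimately show ?thesis by simp
  qed
  then show ?thesis by (simp add: continuous_map_def)
qed

lemma continuous_map_borel_measurable: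
  fixes u :: "'a \<Rightarrow> 'v::topological_space"
  assumes "continuous_map (mtop M) euclidean u"
  shows "u \<in> borel_measurable (borel_space M)"
proof (rule borel_measurableI)
  fix W :: "'v set" assume "open W"
  then have "openin (mtop M) {x \<in> points M. u x \<in> W}"
    using openin_continuous_map_preimage[OF assms] by simp
  moreover have "u -` W \<inter> space (borel_space M) = {x \<in> points M. u x \<in> W}" by auto
  ultimately show "u -` W \<inter> space (borel_space M) \<in> sets (borel_space M)"
    by (simp add: openin_borel_space)
qed

lemma dfun_cong:
  fixes M :: "('a, 'e::euclidean_space) mfd"
  assumes M: "smooth_manifold M" and u: "mdifferentiable M u p" and eq: "\<And>x. x \<in> points M \<Longrightarrow> u x = w x"
  shows "dfun M u p v = dfun M w p v"
proof -
  have p: "p \<in> points M" using u by (simp add: mdifferentiable_def[OF M])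
  note c = chart_at_in[OF M p]
  have ca: "chart_at M p \<in> atlas M" "p \<in> fst (chart_at M p)" using c by (auto simp: charts_at_def)
  have "frechet_derivative (u \<circ> cinv (chart_at M p)) (at (snd (chart_at M p) p)) =
      frechet_derivative (w \<circ> cinv (chart_at M p)) (at (snd (chart_at M p) p))"
  proof (rule frechet_derivative_transform_within_open[OF _ open_chart_range[OF M ca(1)]])
    show "(u \<circ> cinv (chart_at M p)) differentiable at (snd (chart_at M p) p)"
      using u c by (simp add: mdifferentiable_def[OF M])
    show "snd (chart_at M p) p \<in> snd (chart_at M p) ` fst (chart_at M p)" using ca by blast
    fix y assume "y \<in> snd (chart_at M p) ` fst (chart_at M p)"
    then have "cinv (chart_at M p) y \<in> points M"
      using cinv_in[of y "chart_at M p"] chart_subset_points[OF M ca(1)] by (metis subsetD)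
    then show "(u \<circ> cinv (chart_at M p)) y = (w \<circ> cinv (chart_at M p)) y" by (simp add: eq)
  qed
  then show ?thesis by (simp add: dfun_def)
qed

lemma dfun_bounded_linear:
  fixes M :: "('a, 'e::euclidean_space) mfd"
  assumes M: "smooth_manifold M" and u: "mdifferentiable M u p" and h: "bounded_linear h"
  shows "dfun M (\<lambda>x. h (u x)) p v = h (dfun M u p v)"
proof -
  have p: "p \<in> points M" using u by (simp add: mdifferentiable_def[OF M])
  note c = chart_at_in[OF M p]
  have "((\<lambda>y. h ((u \<circ> cinv (chart_at M p)) y)) has_derivative
      (\<lambda>v. h (frechet_derivative (u \<circ> cinv (chart_at M p)) (at (snd (chart_at M p) p)) v))) (at (snd (chart_at M p) p))"
    by (rule bounded_linear.has_derivative[OF h mdifferentiable_has_derivative[OF M u c]])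
  from frechet_derivative_at[OF this] show ?thesis
    unfolding dfun_def by (simp add: o_def) metis
qed

section \<open>Invariance under the group\<close>

lemma orthogonal_matrix_inner:
  fixes A :: "real^'N^'N"
  assumes "orthogonal_matrix A"
  shows "(A *v x) \<bullet> (A *v y) = x \<bullet> y"
proof -
  have "(A *v x) \<bullet> (A *v y) = x \<bullet> (transpose A *v (A *v y))"
    using dot_lmul_matrix[of x "transpose A" "A *v y"] by (simp only: vector_transpose_matrix)
  then show ?thesis
    using assms by (simp only: matrix_vector_mul_assoc orthogonal_matrix_def matrix_vector_mul_lid)
qed

locale eigenmap = homogeneous_manifold K KM L M
  for K :: "('k, 'b) monoid_scheme" and KM :: "('k, 'd::euclidean_space) mfd"
    and L :: "'k set" and M :: "('k set, real^'n) mfd" +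
  fixes g :: "('k set, real^'n) metric" and lam :: real and H :: "('k set \<Rightarrow> real) set" and f :: "'k set \<Rightarrow> real^'N"
  assumes compact_group: "compact_space (mtop KM)"
    and metric: "riemannian_metric M g" and invariant: "invariant_metric K M g"
    and lam_pos: "lam > 0" and eigen: "H \<subseteq> eigenspace M g lam"
    and H_invariant: "invariant_functions K M H" and basis: "orthonormal_basis M g H f"
    and irreducible: "isotropy_irreducible K L M"
begin

abbreviation act :: "'k \<Rightarrow> 'k set \<Rightarrow> 'k set" where "act k \<equiv> (\<lambda>p. k <#\<^bsub>K\<^esub> p)"

abbreviation "\<mu> \<equiv> riemannian_measure M g"

lemma points_ne: "points M \<noteq> {}" using base_point by blast

lemma mu: "volume_measure M g \<mu>"
  by (rule riemannian_measure_volume_measure[OF M metric points_ne])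

lemma sets_mu [measurable_cong]: "sets \<mu> = sets (borel_space M)" and space_mu: "space \<mu> = points M"
  using volume_measureD[OF mu] by auto

lemma component_in_H: "(\<lambda>x. f x $ i) \<in> H"
  and component_orthonormal: "L2_prod M g (\<lambda>x. f x $ i) (\<lambda>x. f x $ j) = (if i = j then 1 else 0)"
  and H_span: "u \<in> H \<Longrightarrow> \<exists>a. u = (\<lambda>x. \<Sum>i\<in>UNIV. a i * f x $ i)"
  using basis by (auto simp: orthonormal_basis_def)

lemma component_smooth: "smooth_fun M (\<lambda>x. f x $ i)"
  and component_eigen: "x \<in> points M \<Longrightarrow> laplacian M g (\<lambda>x. f x $ i) x = - lam * f x $ i"
  using component_in_H[of i] eigen by (auto simp: eigenspace_def smooth_functions_def eq_neg_iff_add_eq_0)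

lemma f_smooth: "smooth_fun M f"
  unfolding smooth_fun_def smooth_on_def
proof (intro ballI allI)
  fix c k assume c: "c \<in> atlas M"
  show "Ck_on k (f \<circ> cinv c) (snd c ` fst c)"
  proof (rule Ck_on_vec[OF open_chart_range[OF M c]])
    show "Ck_on k (\<lambda>x. (f \<circ> cinv c) x $ i) (snd c ` fst c)" for i
      using component_smooth[of i] c by (auto simp: smooth_fun_def smooth_on_def o_def)
  qed
qed

lemma f_differentiable: "p \<in> points M \<Longrightarrow> mdifferentiable M f p"
  by (rule smooth_fun_mdifferentiable[OF M f_smooth])

lemma component_measurable [measurable]: "(\<lambda>x. f x $ i) \<in> borel_measurable \<mu>"
  using continuous_map_borel_measurable[OF smooth_fun_continuous_map[OF M component_smooth]]
  by (simp add: measurable_cong_sets[OF sets_mu refl])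

lemma differential_act:
  assumes k: "k \<in> carrier K" and p: "p \<in> points M" and v: "v \<in> tangent_space M p"
  shows "differential M M (act k) p v \<in> tangent_space M (act k p)"
proof -
  \<comment> \<open>\<open>f\<close> serves as the function at the image point to which the chain
    rule is applied.\<close>
  have "mdifferentiable M f (act k p)" by (rule f_differentiable[OF act_in[OF k p]])
  then show ?thesis
    by (rule mdifferentiable_compose(2)[OF M M act_continuous[OF k] act_differentiable[OF k p] _ p v])
qed

lemma metric_act:
  "k \<in> carrier K \<Longrightarrow> p \<in> points M \<Longrightarrow> v \<in> tangent_space M p \<Longrightarrow> w \<in> tangent_space M p \<Longrightarrow>
   g (act k p) (differential M M (act k) p v) (differential M M (act k) p w) = g p v w"
  using invariant by (simp add: invariant_metric_def)

text \<open>The preimage of \<open>B\<close> under \<open>act k\<close> is its image under the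
  action of the inverse element, which is an isometry; so the dilation formula applies with factor
  1.\<close>

lemma emeasure_act:
  assumes k: "k \<in> carrier K" and B: "B \<in> sets (borel_space M)"
  shows "emeasure \<mu> {x \<in> points M. act k x \<in> B} = emeasure \<mu> B"
proof -
  have Bsub: "B \<subseteq> points M" using sets.sets_into_space[OF B] by simp
  have img: "act (inv\<^bsub>K\<^esub> k) ` A = {x \<in> points M. act k x \<in> A}" if "A \<subseteq> points M" for A
  proof (intro equalityI subsetI)
    fix x assume "x \<in> act (inv\<^bsub>K\<^esub> k) ` A"
    then obtain y where "y \<in> A" "x = act (inv\<^bsub>K\<^esub> k) y" by blast
    then show "x \<in> {x \<in> points M. act k x \<in> A}"
      using that act_in[OF inv_closed[OF k]] act_inv(1)[OF k] by auto
  next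
    fix x assume "x \<in> {x \<in> points M. act k x \<in> A}"
    then show "x \<in> act (inv\<^bsub>K\<^esub> k) ` A" using act_inv(2)[OF k] by (metis (mono_tags, lifting) image_iff mem_Collect_eq)
  qed
  have "emeasure \<mu> (act (inv\<^bsub>K\<^esub> k) ` B) = ennreal (1 powr (real CARD('n) / 2)) * emeasure \<mu> B"
  proof (rule volume_measure_dilation[OF M M metric metric mu mu act_continuous act_differentiable])
    show "inj_on (act (inv\<^bsub>K\<^esub> k)) B"
      by (rule inj_onI) (metis Bsub act_inv(1)[OF k] subsetD)
    fix A assume A: "A \<in> sets (borel_space M)" "A \<subseteq> B"
    show "act (inv\<^bsub>K\<^esub> k) ` A \<in> sets (borel_space M)"
      using continuous_map_preimage_sets[OF act_continuous[OF k] A(1)] img A(2) Bsub by simp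
  qed (use k B metric_act in auto)
  then show ?thesis by (simp add: img[OF Bsub])
qed

lemma distr_act:
  assumes k: "k \<in> carrier K"
  shows "distr \<mu> \<mu> (act k) = \<mu>"
proof (rule measure_eqI)
  have m: "act k \<in> measurable \<mu> \<mu>"
    using continuous_map_measurable[OF act_continuous[OF k]]
    by (simp add: measurable_cong_sets[OF sets_mu sets_mu])
  fix B assume "B \<in> sets (distr \<mu> \<mu> (act k))"
  then have B: "B \<in> sets \<mu>" by simp
  have "emeasure (distr \<mu> \<mu> (act k)) B = emeasure \<mu> (act k -` B \<inter> space \<mu>)"
    by (rule emeasure_distr[OF m B])
  also have "act k -` B \<inter> space \<mu> = {x \<in> points M. act k x \<in> B}" by (auto simp: space_mu)
  also have "emeasure \<mu> \<dots> = emeasure \<mu> B" using emeasure_act[OF k] B by (simp add: sets_mu)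
  finally show "emeasure (distr \<mu> \<mu> (act k)) B = emeasure \<mu> B" .
qed simp

lemma integral_act:
  fixes u :: "'k set \<Rightarrow> real"
  assumes k: "k \<in> carrier K" and u: "u \<in> borel_measurable \<mu>"
  shows "(\<integral>x. u (act k x) \<partial>\<mu>) = (\<integral>x. u x \<partial>\<mu>)"
proof -
  have m: "act k \<in> measurable \<mu> \<mu>"
    using continuous_map_measurable[OF act_continuous[OF k]]
    by (simp add: measurable_cong_sets[OF sets_mu sets_mu])
  show ?thesis using integral_distr[OF m u] by (simp add: distr_act[OF k])
qed

lemma component_integral: "(\<integral>x. f x $ i * f x $ j \<partial>\<mu>) = (if i = j then 1 else 0)"
  using component_orthonormal[of i j] by (simp add: L2_prod_def)

text \<open>The integral of a non-integrable function is 0 by convention, so squares with integral 1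
  are integrable; they dominate the mixed products because
  \<open>2 |a b| \<le> a^2 + b^2\<close>.\<close>

lemma component_integrable: "integrable \<mu> (\<lambda>x. f x $ i * f x $ j)"
proof -
  have sq: "integrable \<mu> (\<lambda>x. f x $ i * f x $ i)" for i
    using component_integral[of i i] not_integrable_integral_eq by fastforce
  have "integrable \<mu> (\<lambda>x. f x $ i * f x $ i + f x $ j * f x $ j)"
    by (rule Bochner_Integration.integrable_add[OF sq sq])
  then show ?thesis
  proof (rule Bochner_Integration.integrable_bound)
    show "AE x in \<mu>. norm (f x $ i * f x $ j) \<le> norm (f x $ i * f x $ i + f x $ j * f x $ j)"
    proof (rule AE_I2)
      fix x
      have "0 \<le> (\<bar>f x $ i\<bar> - \<bar>f x $ j\<bar>)\<^sup>2" by simp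
      then have "2 * \<bar>f x $ i * f x $ j\<bar> \<le> f x $ i * f x $ i + f x $ j * f x $ j"
        by (simp add: power2_eq_square algebra_simps abs_mult)
      then show "norm (f x $ i * f x $ j) \<le> norm (f x $ i * f x $ i + f x $ j * f x $ j)"
        unfolding real_norm_def by linarith
    qed
  qed measurable
qed

lemma f_equivariant:
  assumes k: "k \<in> carrier K"
  obtains A :: "real^'N^'N" where "orthogonal_matrix A" "\<And>x. x \<in> points M \<Longrightarrow> f (act k x) = A *v f x"
proof -
  have "\<exists>a. \<forall>x\<in>points M. f (act k x) $ i = (\<Sum>j\<in>UNIV. a j * f x $ j)" for i
  proof -
    \<comment> \<open>\<open>act_fun\<close> composes with the inverse element, so passing to the
      inverse of \<open>k\<close> gives the components of \<open>f \<circ> act k\<close>.\<close>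
    have "act_fun K M (inv\<^bsub>K\<^esub> k) (\<lambda>x. f x $ i) \<in> H"
      using H_invariant component_in_H k by (simp add: invariant_functions_def)
    from H_span[OF this] obtain a where
      a: "act_fun K M (inv\<^bsub>K\<^esub> k) (\<lambda>x. f x $ i) = (\<lambda>x. \<Sum>j\<in>UNIV. a j * f x $ j)" by blast
    have "f (act k x) $ i = (\<Sum>j\<in>UNIV. a j * f x $ j)" if "x \<in> points M" for x
      using fun_cong[OF a, of x] that k by (simp add: act_fun_def)
    then show ?thesis by blast
  qed
  then obtain a where a: "\<And>i x. x \<in> points M \<Longrightarrow> f (act k x) $ i = (\<Sum>j\<in>UNIV. a i j * f x $ j)" by metis
  define A :: "real^'N^'N" where "A = (\<chi> i j. a i j)"
  have eq: "f (act k x) = A *v f x" if "x \<in> points M" for x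
    using a[OF that] by (simp add: vec_eq_iff A_def matrix_vector_mult_def)
  \<comment> \<open>This entry is the scalar product of components \<open>i\<close> and
    \<open>j\<close> of \<open>f \<circ> act k\<close>; it equals the one for \<open>f\<close>
    because the action preserves the measure.\<close>
  have "(A ** transpose A) $ i $ j = (mat 1 :: real^'N^'N) $ i $ j" for i j
  proof -
    have "(if i = j then 1 else 0) = (\<integral>x. f x $ i * f x $ j \<partial>\<mu>)" by (simp add: component_integral)
    also have "\<dots> = (\<integral>x. f (act k x) $ i * f (act k x) $ j \<partial>\<mu>)"
      by (rule integral_act[OF k, of "\<lambda>x. f x $ i * f x $ j", symmetric]) measurable
    also have "\<dots> = (\<integral>x. (\<Sum>l\<in>UNIV. \<Sum>m\<in>UNIV. a i l * a j m * (f x $ l * f x $ m)) \<partial>\<mu>)"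
      by (rule Bochner_Integration.integral_cong[OF refl])
        (simp add: a space_mu sum_product mult.assoc mult.left_commute)
    also have "\<dots> = (\<Sum>l\<in>UNIV. \<Sum>m\<in>UNIV. a i l * a j m * (if l = m then 1 else 0))"
      by (simp add: component_integrable component_integral)
    also have "\<dots> = (\<Sum>l\<in>UNIV. a i l * a j l)"
      by (simp add: if_distrib[of "\<lambda>z. _ * z"] cong: if_cong)
    finally show ?thesis by (simp add: A_def matrix_matrix_mult_def transpose_def mat_def)
  qed
  then have "A ** transpose A = mat 1" by (simp add: vec_eq_iff)
  then have "orthogonal_matrix A"
    by (metis orthogonal_matrix matrix_left_right_inverse)
  then show thesis using that eq by blast
qed

lemma norm_f_act: "k \<in> carrier K \<Longrightarrow> x \<in> points M \<Longrightarrow> f (act k x) \<bullet> f (act k x) = f x \<bullet> f x"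
  using f_equivariant orthogonal_matrix_inner by metis

text \<open>Points identified by \<open>f\<close> stay identified after the action, which is what
  makes the action descend to the image.\<close>

lemma f_act_eq:
  assumes "k \<in> carrier K" "x \<in> points M" "y \<in> points M" "f x = f y"
  shows "f (act k x) = f (act k y)"
  using f_equivariant[OF assms(1)] assms by metis

abbreviation "V \<equiv> riemannian_volume M g"

text \<open>Transitivity makes the squared norm a constant r, and integrating it gives
  \<open>V * r = CARD('N)\<close>. As the right-hand side is nonzero, so is \<open>V\<close>; since
  \<open>measure\<close> is 0 when the extended measure is infinite, this also shows that the volume
  is finite.\<close>

lemma inner_f: "x \<in> points M \<Longrightarrow> f x \<bullet> f x = real CARD('N) / V" and volume_pos: "0 < V"
proof -
  let ?r = "f L \<bullet> f L"
  have r: "f x \<bullet> f x = ?r" if "x \<in> points M" for x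
    using act_transitive[OF base_point that] norm_f_act[OF _ base_point] by metis
  have "V * ?r = (\<integral>x. ?r \<partial>\<mu>)" by (simp add: riemannian_volume_def space_mu)
  also have "\<dots> = (\<integral>x. (\<Sum>i\<in>UNIV. f x $ i * f x $ i) \<partial>\<mu>)"
    by (rule Bochner_Integration.integral_cong[OF refl])
      (use r in \<open>simp add: space_mu inner_vec_def\<close>)
  also have "\<dots> = real CARD('N)" by (simp add: component_integrable component_integral)
  finally have Vr: "V * ?r = real CARD('N)" .
  have "0 \<le> V" by (simp add: riemannian_volume_def)
  moreover have "V \<noteq> 0" using Vr by auto
  ultimately show V: "0 < V" by simp
  show "f x \<bullet> f x = real CARD('N) / V" if "x \<in> points M"
    using Vr V r[OF that] by (simp add: field_simps)
qed

section \<open>The pullback of the Euclidean metric\<close>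

abbreviation "h \<equiv> pullback_euclidean M f"

text \<open>Differentiating \<open>f \<circ> act k = A f\<close> trades the differential of the
  action for the orthogonal matrix \<open>A\<close>, which leaves inner products unchanged.\<close>

lemma pullback_act:
  assumes k: "k \<in> carrier K" and p: "p \<in> points M" and v: "v \<in> tangent_space M p" and w: "w \<in> tangent_space M p"
  shows "h (act k p) (differential M M (act k) p v) (differential M M (act k) p w) = h p v w"
proof -
  obtain A :: "real^'N^'N" where A: "orthogonal_matrix A" "\<And>x. x \<in> points M \<Longrightarrow> f (act k x) = A *v f x"
    using f_equivariant[OF k] by blast
  have "dfun M f (act k p) (differential M M (act k) p v) = A *v dfun M f p v" if v: "v \<in> tangent_space M p" for v
  proof -
    note comp = mdifferentiable_compose[OF M M act_continuous[OF k] act_differentiable[OF k p]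
        f_differentiable[OF act_in[OF k p]] p v]
    have "dfun M f (act k p) (differential M M (act k) p v) = dfun M (f \<circ> act k) p v" by (rule comp(3)[symmetric])
    also have "\<dots> = dfun M (\<lambda>x. A *v f x) p v" by (rule dfun_cong[OF M comp(1)]) (simp add: A(2))
    also have "\<dots> = A *v dfun M f p v"
      by (rule dfun_bounded_linear[OF M f_differentiable[OF p]]) simp
    finally show ?thesis .
  qed
  then show ?thesis using v w A(1) by (simp add: pullback_euclidean_def orthogonal_matrix_inner)
qed

definition pullback_matrix :: "('k set, real^'n) chart \<Rightarrow> 'k set \<Rightarrow> real^'n^'n" where
  "pullback_matrix c p = (\<chi> i j. frechet_derivative (f \<circ> cinv c) (at (snd c p)) (axis i 1)
     \<bullet> frechet_derivative (f \<circ> cinv c) (at (snd c p)) (axis j 1))"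

lemma pullback_in_chart:
  assumes c: "c \<in> charts_at M p" and v: "v \<in> tangent_space M p" and w: "w \<in> tangent_space M p"
  shows "h p v w = v c \<bullet> (pullback_matrix c p *v w c)"
proof -
  have p: "p \<in> points M" by (rule charts_at_points[OF M c])
  let ?D = "frechet_derivative (f \<circ> cinv c) (at (snd c p))"
  have lin: "linear ?D" using mdifferentiable_has_derivative[OF M f_differentiable[OF p] c] has_derivative_linear by blast
  have "h p v w = ?D (v c) \<bullet> ?D (w c)"
    by (simp add: pullback_euclidean_def dfun_frechet[OF M f_differentiable[OF p] c] v w)
  also have "\<dots> = (\<Sum>i\<in>UNIV. v c $ i *\<^sub>R ?D (axis i 1)) \<bullet> (\<Sum>i\<in>UNIV. w c $ i *\<^sub>R ?D (axis i 1))"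
    by (simp only: linear_axis_expansion[OF lin, symmetric])
  also have "\<dots> = (\<Sum>i\<in>UNIV. \<Sum>j\<in>UNIV. v c $ i * (w c $ j * (?D (axis i 1) \<bullet> ?D (axis j 1))))"
    by (subst inner_sum_left, subst inner_sum_right) (simp add: mult.left_commute)
  also have "\<dots> = v c \<bullet> (pullback_matrix c p *v w c)"
    by (simp add: inner_vec_def[of "v c"] matrix_vector_mult_def pullback_matrix_def
        sum_distrib_left mult.commute mult.left_commute)
  finally show ?thesis .
qed

text \<open>Schur's lemma: the vectors minimising the Rayleigh quotient of the pullback metric form a nonzero
  invariant subspace.\<close>
lemma pullback_proportional_base:
  obtains C where "\<And>v w. v \<in> tangent_space M L \<Longrightarrow> w \<in> tangent_space M L \<Longrightarrow> h L v w = C * g L v w"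
proof -
  note L = base_point
  let ?c = "chart_at M L" and ?T = "tangent_space M L"
  note c = chart_at_in[OF M L]
  let ?G = "metric_matrix M g ?c L" and ?B = "pullback_matrix ?c L"
  note T = coord_vec_in_tangent_space[OF M c]
  obtain C x0 where C: "x0 \<noteq> 0" "x0 \<bullet> (?B *v x0) = C * (x0 \<bullet> (?G *v x0))"
    "\<And>x. C * (x \<bullet> (?G *v x)) \<le> x \<bullet> (?B *v x)"
    using rayleigh_minimum[OF metric_matrix_posdef[OF M metric c]] by blast
  \<comment> \<open>The matrix of the form \<open>h - C g\<close>, positive semidefinite because
    \<open>C\<close> is the least value of the Rayleigh quotient.\<close>
  define Q where "Q = ?B - C *\<^sub>R ?G"
  have Qapp: "Q *v x = ?B *v x - C *\<^sub>R (?G *v x)" for x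
    by (simp add: Q_def matrix_vector_mult_diff_rdistrib scaleR_matrix_vector_assoc)
  have Q: "v ?c \<bullet> (Q *v w ?c) = h L v w - C * g L v w" if "v \<in> ?T" "w \<in> ?T" for v w
    by (simp add: Qapp inner_diff_right pullback_in_chart[OF c that] metric_in_chart[OF M metric c that])
  have sym: "x \<bullet> (Q *v y) = y \<bullet> (Q *v x)" for x y
    using Q[OF T T, of x y] Q[OF T T, of y x] riemannian_metricD(1)[OF metric L T T, of x y]
    by (simp add: coord_vec_apply[OF M c] pullback_euclidean_def inner_commute)
  have psd: "0 \<le> x \<bullet> (Q *v x)" for x
    using C(3)[of x] by (simp add: Qapp inner_diff_right)
  \<comment> \<open>The quadratic description shows at once that \<open>S\<close> is invariant under
    isometries preserving \<open>h\<close>; the description by the kernel of \<open>Q\<close> in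
    \<open>S_iff\<close> shows that it is a linear subspace.\<close>
  define S where "S = {v \<in> ?T. h L v v = C * g L v v}"
  have S_iff: "v \<in> S \<longleftrightarrow> v \<in> ?T \<and> Q *v v ?c = 0" for v
  proof -
    have "h L v v = C * g L v v \<longleftrightarrow> Q *v v ?c = 0" if "v \<in> ?T"
    proof
      assume "h L v v = C * g L v v"
      then have "v ?c \<bullet> (Q *v v ?c) = 0" using Q[OF that that] by simp
      then show "Q *v v ?c = 0" by (rule psd_kernel[OF sym psd])
    next
      assume "Q *v v ?c = 0"
      then show "h L v v = C * g L v v" using Q[OF that that] by simp
    qed
    then show ?thesis by (auto simp: S_def)
  qed
  have "tangent_subspace M L S"
    unfolding tangent_subspace_def
  proof (intro conjI ballI allI)
    show "S \<subseteq> ?T" by (auto simp: S_def)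
    show "(\<lambda>_. 0) \<in> S" by (simp add: S_iff zero_in_tangent[OF M c])
    show "(\<lambda>c. v c + w c) \<in> S" if "v \<in> S" "w \<in> S" for v w
      using that tangent_linear_combination[OF M c, of v w 1 1] by (simp add: S_iff matrix_vector_right_distrib)
    show "(\<lambda>c. a *\<^sub>R v c) \<in> S" if "v \<in> S" for a v
      using that tangent_linear_combination[OF M c, of v v a 0] by (simp add: S_iff matrix_vector_mult_scaleR)
  qed
  moreover have "differential M M (act l) L ` S \<subseteq> S" if l: "l \<in> L" for l
  proof -
    have lK: "l \<in> carrier K" using l L_sub by blast
    \<comment> \<open>Elements of the isotropy group fix the base point, so their differentials act
      on the tangent space there.\<close>
    have lL: "act l L = L" by (rule coset_join3[OF lK homogeneous_manifold.L[OF homogeneous_manifold_axioms] l])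
    show ?thesis
      using differential_act[OF lK L] pullback_act[OF lK L] metric_act[OF lK L] by (auto simp: S_def lL)
  qed
  ultimately have "S = {\<lambda>_. 0} \<or> S = ?T" using irreducible unfolding isotropy_irreducible_def by blast
  moreover have "coord_vec M ?c L x0 \<in> S"
    unfolding S_def using C(2) T
    by (simp add: pullback_in_chart[OF c T T] metric_in_chart[OF M metric c T T] coord_vec_apply[OF M c])
  moreover have "coord_vec M ?c L x0 \<noteq> (\<lambda>_. 0)" using coord_vec_apply[OF M c, of x0] C(1) by auto
  ultimately have "S = ?T" by blast
  then have "h L v w = C * g L v w" if "v \<in> ?T" "w \<in> ?T" for v w
    using Q[OF that] S_iff[of w] that by simp
  then show thesis using that by blast
qed

lemma pullback_eq:
  assumes p: "p \<in> points M" and v: "v \<in> tangent_space M p" and w: "w \<in> tangent_space M p"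
  shows "h p v w = lam * real CARD('N) / (real CARD('n) * V) * g p v w"
proof -
  obtain C where C: "\<And>v w. v \<in> tangent_space M L \<Longrightarrow> w \<in> tangent_space M L \<Longrightarrow> h L v w = C * g L v w"
    using pullback_proportional_base by blast
  have all: "h p v w = C * g p v w" if p: "p \<in> points M" and v: "v \<in> tangent_space M p" and w: "w \<in> tangent_space M p" for p v w
  proof -
    \<comment> \<open>Both forms are invariant, so they may be compared at the base point after
      moving \<open>p\<close> there.\<close>
    obtain k where k: "k \<in> carrier K" "L = act k p" using act_transitive[OF p base_point] by blast
    show ?thesis
      using C[of "differential M M (act k) p v" "differential M M (act k) p w"]
        differential_act[OF k(1) p v] differential_act[OF k(1) p w]
      unfolding k(2) pullback_act[OF k(1) p v w] metric_act[OF k(1) p v w] by blast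
  qed
  have comp: "dfun M (\<lambda>x. f x $ i) L v = dfun M f L v $ i" for i v
    by (rule dfun_bounded_linear[OF M f_differentiable[OF base_point] bounded_linear_vec_nth])
  have "C * real CARD('n) = (\<Sum>k\<in>UNIV. dfun M (\<lambda>x. f x $ k) L (gradient M g (\<lambda>x. f x $ k) L))"
    by (rule trace_gradient[OF M metric component_smooth base_point, symmetric])
      (simp add: comp C[symmetric] pullback_euclidean_def inner_vec_def)
  also have "\<dots> = - (\<Sum>k\<in>UNIV. f L $ k * laplacian M g (\<lambda>x. f x $ k) L)"
    by (rule sum_gradient_laplacian[OF M metric component_smooth inner_f base_point])
  also have "\<dots> = lam * (f L \<bullet> f L)"
    by (simp add: component_eigen[OF base_point] inner_vec_def sum_distrib_left sum_negf mult.left_commute)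
  finally have "C * real CARD('n) = lam * (real CARD('N) / V)" by (simp only: inner_f[OF base_point])
  then have "C = lam * real CARD('N) / (real CARD('n) * V)" using volume_pos by (simp add: field_simps)
  then show ?thesis using all[OF p v w] by simp
qed

end

section \<open>The image as a submanifold\<close>

lemma disjoint_neighbourhoods:
  assumes "Hausdorff_space X" "finite A" "A \<subseteq> topspace X"
  obtains W where "\<And>x. x \<in> A \<Longrightarrow> openin X (W x) \<and> x \<in> W x" "\<And>x y. x \<in> A \<Longrightarrow> y \<in> A \<Longrightarrow> x \<noteq> y \<Longrightarrow> W x \<inter> W y = {}"
proof -
  have "\<exists>U V. openin X U \<and> openin X V \<and> x \<in> U \<and> y \<in> V \<and> disjnt U V" if "x \<in> A" "y \<in> A" "x \<noteq> y" for x y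
    using assms(1,3) that unfolding Hausdorff_space_def by blast
  then obtain U V where UV: "\<And>x y. x \<in> A \<Longrightarrow> y \<in> A \<Longrightarrow> x \<noteq> y \<Longrightarrow>
      openin X (U x y) \<and> openin X (V x y) \<and> x \<in> U x y \<and> y \<in> V x y \<and> disjnt (U x y) (V x y)"
    by metis
  \<comment> \<open>When \<open>A\<close> has only one point the inner intersection is over an empty
    family; meeting it with \<open>topspace X\<close> keeps \<open>W x\<close> inside the
    space.\<close>
  define W where "W x = topspace X \<inter> (\<Inter>y\<in>A - {x}. U x y \<inter> V y x)" for x
  show thesis
  proof
    fix x assume x: "x \<in> A"
    have "openin X (topspace X \<inter> \<Inter>((\<lambda>y. U x y \<inter> V y x) ` (A - {x})))"
    proof (cases "A - {x} = {}")
      case False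
      then show ?thesis using assms(2) UV x by (intro openin_Int openin_topspace openin_Inter) auto
    qed (simp only: image_empty Inter_empty, simp)
    then show "openin X (W x) \<and> x \<in> W x" using UV x assms(3) by (auto simp: W_def)
    fix y assume y: "y \<in> A" "x \<noteq> y"
    then have "W x \<subseteq> U x y" "W y \<subseteq> V x y" using x by (auto simp: W_def)
    then show "W x \<inter> W y = {}" using UV[OF x y] unfolding disjnt_def by blast
  qed
qed

lemma second_countable_top_of_set:
  fixes A :: "'v::second_countable_topology set"
  shows "second_countable_top (top_of_set A)"
proof -
  obtain B :: "'v set set" where B: "countable B" "topological_basis B" using ex_countable_basis by blast
  show ?thesis
    unfolding second_countable_top_def
  proof (rule exI[of _ "(\<inter>) A ` B"], intro conjI ballI allI impI)
    show "countable ((\<inter>) A ` B)" using B(1) by blast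
    show "openin (top_of_set A) U" if "U \<in> (\<inter>) A ` B" for U
      using that topological_basis_open[OF B(2)] by (auto simp: openin_open)
    fix U assume "openin (top_of_set A) U"
    then obtain W where W: "open W" "U = A \<inter> W" by (auto simp: openin_open)
    then obtain C where C: "C \<subseteq> B" "\<Union>C = W" using B(2) unfolding topological_basis_def by blast
    show "\<exists>C\<subseteq>(\<inter>) A ` B. U = \<Union>C"
      by (rule exI[of _ "(\<inter>) A ` C"]) (use C W in auto)
  qed
qed

lemma atlas_open_submfdE:
  assumes "d \<in> atlas (open_submfd M U)"
  obtains c where "c \<in> atlas M" "d = (U \<inter> fst c, snd c)"
  using assms unfolding open_submfd_def mfd.select_convs mem_Collect_eq by blast

section \<open>The map onto its image: immersion, closedness, openness\<close>

context eigenmap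
begin

abbreviation "Q \<equiv> f ` points M"

definition scale :: real where "scale = lam * real CARD('N) / (real CARD('n) * V)"

lemma scale_pos: "0 < scale"
  using lam_pos volume_pos by (simp add: scale_def)

lemma pullback_scale: "p \<in> points M \<Longrightarrow> v \<in> tangent_space M p \<Longrightarrow> w \<in> tangent_space M p \<Longrightarrow> h p v w = scale * g p v w"
  unfolding scale_def by (rule pullback_eq)

text \<open>The pullback form is a positive multiple of a positive definite one, so the derivative
  of \<open>f\<close> kills no nonzero vector. Positivity of the factor rests on that of the
  eigenvalue.\<close>

lemma f_immersion:
  assumes c: "c \<in> atlas M" and y: "y \<in> snd c ` fst c"
  shows "inj (frechet_derivative (f \<circ> cinv c) (at y))"
proof -
  let ?p = "cinv c y" and ?D = "frechet_derivative (f \<circ> cinv c) (at y)"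
  note cy = cinv_charts_at[OF c y]
  have p: "?p \<in> points M" by (rule charts_at_points[OF M cy])
  have yp: "snd c ?p = y" by (rule chart_cinv[OF y])
  have lin: "linear ?D"
    using mdifferentiable_has_derivative[OF M f_differentiable[OF p] cy] has_derivative_linear unfolding yp by blast
  have "e = 0" if "?D e = 0" for e
  proof (rule ccontr)
    assume "e \<noteq> 0"
    note T = coord_vec_in_tangent_space[OF M cy, of e]
    have "coord_vec M c ?p e \<noteq> (\<lambda>_. 0)" using coord_vec_apply[OF M cy, of e] \<open>e \<noteq> 0\<close> by auto
    then have "0 < h ?p (coord_vec M c ?p e) (coord_vec M c ?p e)"
      using riemannian_metricD(3)[OF metric p T] scale_pos by (simp add: pullback_scale[OF p T T])
    moreover have "dfun M f ?p (coord_vec M c ?p e) = 0"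
      using dfun_frechet[OF M f_differentiable[OF p] cy T] that by (simp add: yp coord_vec_apply[OF M cy])
    ultimately show False by (simp add: pullback_euclidean_def)
  qed
  then show ?thesis using linear_injective_0[OF lin] by blast
qed

lemma f_chart_smooth: "c \<in> atlas M \<Longrightarrow> smooth_on (snd c ` fst c) (f \<circ> cinv c)"
  using f_smooth by (simp add: smooth_fun_def)

lemma compact_M: "compact_space (mtop M)"
  using compact_group proj_quotient
  by (metis compact_space_def image_compactin proj_continuous quotient_imp_surjective_map)

lemma f_continuous: "continuous_map (mtop M) (top_of_set Q) f"
  using smooth_fun_continuous_map[OF M f_smooth] by (auto simp: continuous_map_in_subtopology)

lemma f_closed: "closed_map (mtop M) (top_of_set Q) f"
  by (rule continuous_imp_closed_map[OF f_continuous compact_M])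
    (simp add: Hausdorff_space_subtopology)

lemma f_quotient: "quotient_map (mtop M) (top_of_set Q) f"
  by (rule continuous_closed_imp_quotient_map[OF f_continuous f_closed]) simp

text \<open>\<open>proj\<close> and \<open>f\<close> (continuous and closed onto its image) are both
  quotient maps, so openness of a subset of the image can be tested on its preimage in the group.
  There it is visible, because translations are homeomorphisms.\<close>

lemma f_open: "open_map (mtop M) (top_of_set Q) f"
  unfolding open_map_def
proof (intro allI impI)
  fix U assume U: "openin (mtop M) U"
  have Usub: "U \<subseteq> points M" using U openin_subset by blast
  define W where "W = {x \<in> carrier K. proj x \<in> U}"
  have W: "openin (mtop KM) W"
    using openin_continuous_map_preimage[OF proj_continuous U] by (simp add: W_def points_KM)
  \<comment> \<open>The stabilizer of the point \<open>f L\<close> when the group acts on the image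
    through the matrices of \<open>f_equivariant\<close>.\<close>
  define L' where "L' = {l \<in> carrier K. f (proj l) = f L}"
  have eq: "{x \<in> carrier K. f (proj x) \<in> f ` U} = (\<Union>l\<in>L'. {x \<in> carrier K. x \<otimes>\<^bsub>K\<^esub> inv\<^bsub>K\<^esub> l \<in> W})"
  proof (intro equalityI subsetI)
    fix x assume "x \<in> {x \<in> carrier K. f (proj x) \<in> f ` U}"
    then obtain u where x: "x \<in> carrier K" and u: "u \<in> U" "f (proj x) = f u" by auto
    then obtain z where z: "z \<in> carrier K" "u = proj z" using points_proj Usub by blast
    let ?l = "inv\<^bsub>K\<^esub> z \<otimes>\<^bsub>K\<^esub> x"
    have "f (proj ?l) = f (act (inv\<^bsub>K\<^esub> z) (proj x))" using x z by (simp add: act_proj)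
    also have "\<dots> = f (act (inv\<^bsub>K\<^esub> z) (proj z))"
      using x z u by (intro f_act_eq) (auto intro: proj_in)
    also have "\<dots> = f L" using z by (simp add: act_proj proj_one)
    finally have "?l \<in> L'" using x z by (simp add: L'_def)
    moreover have "x \<otimes>\<^bsub>K\<^esub> inv\<^bsub>K\<^esub> ?l = z" using x z by (simp add: inv_mult_group m_assoc[symmetric])
    ultimately show "x \<in> (\<Union>l\<in>L'. {x \<in> carrier K. x \<otimes>\<^bsub>K\<^esub> inv\<^bsub>K\<^esub> l \<in> W})"
      using x z u by (intro UN_I[of ?l]) (simp_all add: W_def)
  next
    fix x assume "x \<in> (\<Union>l\<in>L'. {x \<in> carrier K. x \<otimes>\<^bsub>K\<^esub> inv\<^bsub>K\<^esub> l \<in> W})"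
    then obtain l where l: "l \<in> carrier K" "f (proj l) = f L" and x: "x \<in> carrier K" "x \<otimes>\<^bsub>K\<^esub> inv\<^bsub>K\<^esub> l \<in> W"
      by (auto simp: L'_def)
    let ?z = "x \<otimes>\<^bsub>K\<^esub> inv\<^bsub>K\<^esub> l"
    have "f (proj x) = f (act ?z (proj l))" using x l by (simp add: act_proj m_assoc)
    also have "\<dots> = f (act ?z L)" using x l by (intro f_act_eq) (auto intro: proj_in base_point)
    finally show "x \<in> {x \<in> carrier K. f (proj x) \<in> f ` U}" using x by (auto simp: W_def)
  qed
  have "openin (mtop KM) {x \<in> carrier K. x \<otimes>\<^bsub>K\<^esub> inv\<^bsub>K\<^esub> l \<in> W}" if "l \<in> L'" for l
  proof -
    have "inv\<^bsub>K\<^esub> l \<in> carrier K" using that by (simp add: L'_def)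
    from openin_continuous_map_preimage[OF right_translation_continuous[OF this] W] show ?thesis
      by (simp add: points_KM)
  qed
  then have "openin (mtop KM) {x \<in> carrier K. f (proj x) \<in> f ` U}"
    unfolding eq by (intro openin_Union) auto
  moreover have "{x \<in> points KM. proj x \<in> {p \<in> points M. f p \<in> f ` U}} = {x \<in> carrier K. f (proj x) \<in> f ` U}"
    using proj_in by (auto simp: points_KM)
  ultimately have "openin (mtop M) {p \<in> points M. f p \<in> f ` U}"
    using conjunct2[OF proj_quotient[unfolded quotient_map_def], rule_format, of "{p \<in> points M. f p \<in> f ` U}"] by simp
  then show "openin (top_of_set Q) (f ` U)"
    using f_quotient Usub unfolding quotient_map_def by (simp add: image_mono)
qed

section \<open>Sheets, finite fibers and the covering\<close>

definition sheet :: "'k set set \<Rightarrow> ('k set, real^'n) chart \<Rightarrow> bool" where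
  "sheet U c \<longleftrightarrow> c \<in> atlas M \<and> openin (mtop M) U \<and> U \<subseteq> fst c \<and> inj_on f U"

lemma sheetD:
  assumes "sheet U c"
  shows "c \<in> atlas M" "openin (mtop M) U" "U \<subseteq> fst c" "inj_on f U" "U \<subseteq> points M"
  using assms chart_subset_points[OF M, of c] by (auto simp: sheet_def)

lemma sheet_subset: "sheet U c \<Longrightarrow> openin (mtop M) U' \<Longrightarrow> U' \<subseteq> U \<Longrightarrow> sheet U' c"
  by (auto simp: sheet_def intro: inj_on_subset)

text \<open>In the chart, \<open>f\<close> followed by a suitable linear map \<open>P\<close> is
  injective near the coordinates of \<open>p\<close>; hence \<open>f\<close> itself is injective on
  the corresponding neighbourhood of \<open>p\<close>.\<close>

lemma sheet_exists:
  assumes p: "p \<in> points M"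
  obtains U c where "sheet U c" "p \<in> U"
proof -
  let ?c = "chart_at M p"
  have c: "?c \<in> atlas M" "p \<in> fst ?c" using chart_at_in[OF M p] by (auto simp: charts_at_def)
  note R = open_chart_range[OF M c(1)]
  have y: "snd ?c p \<in> snd ?c ` fst ?c" using c by blast
  have C1: "Ck_on (Suc 0) (f \<circ> cinv ?c) (snd ?c ` fst ?c)"
    using f_chart_smooth[OF c(1)] unfolding smooth_on_def by (rule spec)
  obtain P U V g where "bounded_linear (P :: real^'N \<Rightarrow> real^'n)" and P: "open U" "U \<subseteq> snd ?c ` fst ?c" "snd ?c p \<in> U"
    and "open V" "P ((f \<circ> cinv ?c) (snd ?c p)) \<in> V"
    and PV: "homeomorphism U V (\<lambda>y. P ((f \<circ> cinv ?c) y)) g" 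
    by (rule immersion_local_inverse[OF R C1 y f_immersion[OF c(1) y]]) blast
  let ?U = "{x \<in> fst ?c. snd ?c x \<in> U}"
  have "openin (subtopology (mtop M) (fst ?c)) {x \<in> topspace (subtopology (mtop M) (fst ?c)). snd ?c x \<in> U}"
    by (rule openin_continuous_map_preimage[OF continuous_map_chart[OF M c(1)]]) (use P(1) in simp)
  moreover have "{x \<in> topspace (subtopology (mtop M) (fst ?c)). snd ?c x \<in> U} = ?U"
    using chart_subset_points[OF M c(1)] by auto
  ultimately have "openin (mtop M) ?U"
    using openin_trans_full[OF _ chart_openin[OF M c(1)]] by simp
  moreover have "inj_on f ?U"
  proof (rule inj_onI)
    fix x x' assume x: "x \<in> ?U" and x': "x' \<in> ?U" and eq: "f x = f x'"
    have cx: "cinv ?c (snd ?c x) = x" "cinv ?c (snd ?c x') = x'"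
      using x x' cinv_chart[OF M c(1)] by auto
    then have "P ((f \<circ> cinv ?c) (snd ?c x)) = P ((f \<circ> cinv ?c) (snd ?c x'))" using eq by simp
    then have "snd ?c x = snd ?c x'"
      using PV x x' unfolding homeomorphism_def by (metis (mono_tags, lifting) mem_Collect_eq)
    then show "x = x'" using cx by metis
  qed
  ultimately have "sheet ?U ?c" using c by (auto simp: sheet_def)
  then show thesis using that c(2) P(3) by blast
qed

lemma sheet_image_open: "sheet U c \<Longrightarrow> openin (top_of_set Q) (f ` U)"
  using f_open sheetD(2) unfolding open_map_def by blast

lemma sheet_homeomorphic:
  assumes "sheet U c"
  shows "homeomorphic_map (subtopology (mtop M) U) (top_of_set (f ` U)) f"
proof (rule bijective_open_imp_homeomorphic_map)
  note U = sheetD[OF assms]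
  have top: "topspace (subtopology (mtop M) U) = U" using U(5) by auto
  show "continuous_map (subtopology (mtop M) U) (top_of_set (f ` U)) f"
    using f_continuous U(5) by (auto simp: continuous_map_in_subtopology continuous_map_from_subtopology)
  show "f ` topspace (subtopology (mtop M) U) = topspace (top_of_set (f ` U))" using top by simp
  show "inj_on f (topspace (subtopology (mtop M) U))" using top U(4) by simp
  show "open_map (subtopology (mtop M) U) (top_of_set (f ` U)) f"
    unfolding open_map_def
  proof (intro allI impI)
    fix A assume A: "openin (subtopology (mtop M) U) A"
    then have Asub: "A \<subseteq> U" using openin_subset top by blast
    have "openin (mtop M) A" using openin_trans_full[OF A U(2)] .
    then have "openin (top_of_set Q) (f ` A)" using f_open unfolding open_map_def by blast
    then show "openin (top_of_set (f ` U)) (f ` A)"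
      by (rule openin_subset_trans) (use Asub U(5) in auto)
  qed
qed

lemma sheet_inverse_continuous:
  assumes "sheet U c"
  shows "continuous_map (top_of_set (f ` U)) (subtopology (mtop M) U) (inv_into U f)"
proof -
  note U = sheetD[OF assms]
  obtain k where k: "homeomorphic_maps (subtopology (mtop M) U) (top_of_set (f ` U)) f k"
    using sheet_homeomorphic[OF assms] homeomorphic_map_maps by blast
  have "k y = inv_into U f y" if y: "y \<in> f ` U" for y
  proof -
    obtain x where "y = f x" "x \<in> U" using y by (rule imageE)
    then show ?thesis using k U(4,5) by (auto simp: homeomorphic_maps_def inv_into_f_f)
  qed
  then show ?thesis
    using k by (auto simp: homeomorphic_maps_def intro: continuous_map_eq)
qed

text \<open>By compactness finitely many sheets cover \<open>M\<close>, and each of them meets a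
  fiber in at most one point.\<close>

lemma fiber_finite: "finite {x \<in> points M. f x = y}"
proof -
  obtain \<F> where F: "finite \<F>" "\<F> \<subseteq> {U. \<exists>c. sheet U c}" "points M \<subseteq> \<Union>\<F>"
  proof -
    have "\<exists>\<F>. finite \<F> \<and> \<F> \<subseteq> {U. \<exists>c. sheet U c} \<and> points M \<subseteq> \<Union>\<F>"
      using compact_M unfolding compact_space_alt
    proof (elim allE impE)
      show "(\<forall>U\<in>{U. \<exists>c. sheet U c}. openin (mtop M) U) \<and> points M \<subseteq> \<Union>{U. \<exists>c. sheet U c}"
      proof (intro conjI ballI subsetI)
        show "openin (mtop M) U" if "U \<in> {U. \<exists>c. sheet U c}" for U using that sheetD(2) by auto
        show "x \<in> \<Union>{U. \<exists>c. sheet U c}" if "x \<in> points M" for x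
          by (rule sheet_exists[OF that]) auto
      qed
    qed
    then show thesis using that by blast
  qed
  have "finite (U \<inter> {x \<in> points M. f x = y})" if "U \<in> \<F>" for U
  proof -
    have "inj_on f U" using F(2) that sheetD(4) by blast
    then have "inj_on f (U \<inter> {x \<in> points M. f x = y})" by (rule inj_on_subset) auto
    moreover have "finite (f ` (U \<inter> {x \<in> points M. f x = y}))"
      by (rule finite_subset[of _ "{y}"]) auto
    ultimately show ?thesis using finite_imageD by blast
  qed
  then have "finite (\<Union>U\<in>\<F>. U \<inter> {x \<in> points M. f x = y})" using F(1) by blast
  then show ?thesis by (rule finite_subset[rotated]) (use F(3) in auto)
qed

definition deg :: nat where "deg = card {x \<in> points M. f x = f L}"

lemma deg_pos: "0 < deg"
  unfolding deg_def using base_point fiber_finite by (subst card_gt_0_iff) auto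

lemma fiber_card:
  assumes "y \<in> Q"
  shows "card {x \<in> points M. f x = y} = deg"
proof -
  obtain p where p: "p \<in> points M" "y = f p" using assms by blast
  obtain k where k: "k \<in> carrier K" "p = act k L" using act_transitive[OF base_point p(1)] by blast
  have "bij_betw (act k) {x \<in> points M. f x = f L} {x \<in> points M. f x = y}"
  proof (rule bij_betw_byWitness[where f' = "act (inv\<^bsub>K\<^esub> k)"])
    show "\<forall>a\<in>{x \<in> points M. f x = f L}. act (inv\<^bsub>K\<^esub> k) (act k a) = a" using act_inv(2)[OF k(1)] by blast
    show "\<forall>a\<in>{x \<in> points M. f x = y}. act k (act (inv\<^bsub>K\<^esub> k) a) = a" using act_inv(1)[OF k(1)] by blast
    show "act k ` {x \<in> points M. f x = f L} \<subseteq> {x \<in> points M. f x = y}"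
      using f_act_eq[OF k(1) _ base_point] act_in[OF k(1)] p(2) k(2) by auto
    show "act (inv\<^bsub>K\<^esub> k) ` {x \<in> points M. f x = y} \<subseteq> {x \<in> points M. f x = f L}"
    proof clarify
      fix x assume x: "x \<in> points M" "y = f x"
      have "f (act (inv\<^bsub>K\<^esub> k) x) = f (act (inv\<^bsub>K\<^esub> k) p)"
        using x p by (intro f_act_eq[OF inv_closed[OF k(1)]]) auto
      also have "act (inv\<^bsub>K\<^esub> k) p = L" using act_inv(2)[OF k(1) base_point] k(2) by simp
      finally show "act (inv\<^bsub>K\<^esub> k) x \<in> points M \<and> f (act (inv\<^bsub>K\<^esub> k) x) = f L"
        using act_in[OF inv_closed[OF k(1)] x(1)] by simp
    qed
  qed
  then show ?thesis unfolding deg_def by (rule bij_betw_same_card[symmetric])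
qed

text \<open>Disjoint sheets are chosen around the finitely many points of the fiber and then cut
  down to the preimage of a small neighbourhood \<open>T\<close>. One sheet belongs to each point of
  the fiber, whence the number \<open>deg\<close>.\<close>

lemma evenly_covered:
  assumes y: "y \<in> Q"
  obtains T \<V> where "y \<in> T" "openin (top_of_set Q) T" "\<Union>\<V> = {x \<in> points M. f x \<in> T}"
    "\<And>U. U \<in> \<V> \<Longrightarrow> \<exists>c. sheet U c" "\<And>U. U \<in> \<V> \<Longrightarrow> f ` U = T" "pairwise disjnt \<V>" "finite \<V>" "card \<V> = deg"
proof -
  let ?A = "{x \<in> points M. f x = y}"
  have ne: "?A \<noteq> {}" using y by auto
  have haus: "Hausdorff_space (mtop M)" using M by (simp add: smooth_manifold_def)
  have Asub: "?A \<subseteq> points M" by blast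
  obtain W where W: "\<And>x. x \<in> ?A \<Longrightarrow> openin (mtop M) (W x) \<and> x \<in> W x"
    "\<And>x x'. x \<in> ?A \<Longrightarrow> x' \<in> ?A \<Longrightarrow> x \<noteq> x' \<Longrightarrow> W x \<inter> W x' = {}"
    by (rule disjoint_neighbourhoods[OF haus fiber_finite Asub]) blast
  have "\<exists>U c. sheet U c \<and> x \<in> U" if "x \<in> ?A" for x using sheet_exists that by blast
  then obtain G c where G: "\<And>x. x \<in> ?A \<Longrightarrow> sheet (G x) (c x) \<and> x \<in> G x" by metis
  define U where "U x = G x \<inter> W x" for x
  have U: "sheet (U x) (c x)" "x \<in> U x" if "x \<in> ?A" for x
    using G[OF that] W(1)[OF that] sheet_subset[of "G x" "c x" "U x"] sheetD(2)[of "G x" "c x"]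
    by (auto simp: U_def)
  define Z where "Z = points M - (\<Union>x\<in>?A. U x)"
  have "openin (mtop M) (U x)" if "x \<in> ?A" for x by (rule sheetD(2)[OF U(1)[OF that]])
  then have "openin (mtop M) (\<Union>x\<in>?A. U x)" by (intro openin_Union) blast
  then have "closedin (mtop M) Z" unfolding Z_def by (intro closedin_diff closedin_topspace)
  then have fZ: "closedin (top_of_set Q) (f ` Z)" using f_closed unfolding closed_map_def by blast
  define T where "T = (\<Inter>x\<in>?A. f ` U x) - f ` Z"
  have TU: "T \<subseteq> f ` U x" if "x \<in> ?A" for x using that by (auto simp: T_def)
  have "openin (top_of_set Q) (\<Inter>x\<in>?A. f ` U x)"
    using ne fiber_finite sheet_image_open[OF U(1)] by (intro openin_Inter) auto
  then have T: "openin (top_of_set Q) T" unfolding T_def using fZ by (rule openin_diff)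
  define V where "V x = {z \<in> U x. f z \<in> T}" for x
  have Vsub: "V x \<subseteq> U x" for x by (auto simp: V_def)
  have fV: "f ` V x = T" if "x \<in> ?A" for x using TU[OF that] by (auto simp: V_def)
  have Vop: "openin (mtop M) (V x)" if "x \<in> ?A" for x
  proof -
    have "V x = U x \<inter> {z \<in> points M. f z \<in> T}" using sheetD(5)[OF U(1)[OF that]] by (auto simp: V_def)
    then show ?thesis
      using sheetD(2)[OF U(1)[OF that]] openin_continuous_map_preimage[OF f_continuous T] by (simp add: openin_Int)
  qed
  have yT: "y \<in> T"
  proof -
    have "y \<in> f ` U x" if "x \<in> ?A" for x using U(2)[OF that] that by blast
    moreover have "y \<notin> f ` Z" using U(2) by (auto simp: Z_def)
    ultimately show ?thesis by (auto simp: T_def)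
  qed
  have xV: "x \<in> V x" if "x \<in> ?A" for x using U(2)[OF that] that yT by (auto simp: V_def)
  have Vdisj: "V x \<inter> V x' = {}" if "x \<in> ?A" "x' \<in> ?A" "x \<noteq> x'" for x x'
    using W(2)[OF that] Vsub by (auto simp: U_def)
  show thesis
  proof (rule that[of T "V ` ?A"])
    show "y \<in> T" by (rule yT)
    show "openin (top_of_set Q) T" by (rule T)
    show "\<Union>(V ` ?A) = {x \<in> points M. f x \<in> T}"
    proof (intro equalityI subsetI)
      fix z assume "z \<in> \<Union>(V ` ?A)"
      then show "z \<in> {x \<in> points M. f x \<in> T}" using U(1) sheetD(5) by (fastforce simp: V_def)
    next
      fix z assume z: "z \<in> {x \<in> points M. f x \<in> T}"
      then have "z \<notin> Z" by (auto simp: T_def)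
      then show "z \<in> \<Union>(V ` ?A)" using z by (auto simp: Z_def V_def)
    qed
    show "\<exists>c. sheet V' c" if V': "V' \<in> V ` ?A" for V'
    proof -
      obtain x where x: "x \<in> ?A" "V' = V x" using V' by blast
      then show ?thesis using sheet_subset[OF U(1) Vop Vsub] by metis
    qed
    show "f ` V' = T" if "V' \<in> V ` ?A" for V' using that fV by auto
    show "pairwise disjnt (V ` ?A)" using Vdisj by (auto simp: pairwise_def disjnt_def)
    show "finite (V ` ?A)" using fiber_finite by blast
    have "inj_on V ?A" by (rule inj_onI) (use xV Vdisj in blast)
    then show "card (V ` ?A) = deg" using fiber_card[OF y] by (simp add: card_image)
  qed
qed

lemma f_covering: "covering_of_degree (mtop M) (top_of_set Q) f deg"
  unfolding covering_of_degree_def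
proof (intro conjI ballI)
  show "continuous_map (mtop M) (top_of_set Q) f" by (rule f_continuous)
  show "f ` points M = topspace (top_of_set Q)" by simp
  show "0 < deg" by (rule deg_pos)
  fix y assume "y \<in> topspace (top_of_set Q)"
  then have y: "y \<in> Q" by simp
  show "card {x \<in> points M. f x = y} = deg" by (rule fiber_card[OF y])
  obtain T \<V> where TV: "y \<in> T" "openin (top_of_set Q) T" "\<Union>\<V> = {x \<in> points M. f x \<in> T}"
    "\<And>U. U \<in> \<V> \<Longrightarrow> \<exists>c. sheet U c" "\<And>U. U \<in> \<V> \<Longrightarrow> f ` U = T" "pairwise disjnt \<V>"
    "finite \<V>" "card \<V> = deg" by (rule evenly_covered[OF y]) blast
  have "homeomorphic_map (subtopology (mtop M) U) (subtopology (top_of_set Q) T) f" if U: "U \<in> \<V>" for U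
  proof -
    obtain c where c: "sheet U c" using TV(4)[OF U] by blast
    have "subtopology (top_of_set Q) T = top_of_set T"
      using openin_subset[OF TV(2)] by (simp add: subtopology_subtopology Int_absorb1)
    then show ?thesis using sheet_homeomorphic[OF c] TV(5)[OF U] by simp
  qed
  moreover have "openin (mtop M) U" if "U \<in> \<V>" for U using TV(4)[OF that] sheetD(2) by blast
  ultimately show "\<exists>T. y \<in> T \<and> openin (top_of_set Q) T \<and>
      (\<exists>\<V>. \<Union>\<V> = {x \<in> points M. f x \<in> T} \<and> (\<forall>U\<in>\<V>. openin (mtop M) U) \<and> pairwise disjnt \<V> \<and>
        (\<forall>U\<in>\<V>. homeomorphic_map (subtopology (mtop M) U) (subtopology (top_of_set Q) T) f))"
    using TV(1,2,3,6) by blast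
qed

lemma f_cinv_charts: "c \<in> atlas M \<Longrightarrow> x \<in> fst c \<Longrightarrow> f (cinv c (snd c x)) = f x"
  by (simp add: cinv_chart[OF M])

text \<open>The coordinate changes of the image and all chart representations of \<open>f\<close> and of its local
  inverses have this form.\<close>
lemma sheet_transition_smooth:
  assumes c: "c \<in> atlas M" and U: "sheet U c'"
  shows "open (snd c ` {p \<in> fst c. f p \<in> f ` U})"
    and "smooth_on (snd c ` {p \<in> fst c. f p \<in> f ` U}) (snd c' \<circ> inv_into U f \<circ> f \<circ> cinv c)"
proof -
  let ?X = "snd c ` {p \<in> fst c. f p \<in> f ` U}" and ?\<phi> = "snd c' \<circ> inv_into U f \<circ> f \<circ> cinv c"
  note U' = sheetD[OF U]
  show X: "open ?X"
    by (rule open_chart_preimage[OF M c f_continuous sheet_image_open[OF U]])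
  have Xsub: "?X \<subseteq> snd c ` fst c" by blast
  note Y = open_chart_range[OF M U'(1)]
  have mem: "cinv c y \<in> fst c \<and> f (cinv c y) \<in> f ` U" if "y \<in> ?X" for y
    using that cinv_chart[OF M c] by auto
  show "smooth_on ?X ?\<phi>"
  \<comment> \<open>\<open>?\<phi>\<close> lifts the chart representation of \<open>f\<close> in
    \<open>c\<close> through the immersion that represents \<open>f\<close> in \<open>c'\<close>;
    only its continuity has to be checked by hand.\<close>
  proof (rule smooth_on_lift_immersion[OF X Y])
    show "smooth_on ?X (f \<circ> cinv c)" by (rule smooth_on_subset[OF f_chart_smooth[OF c] Xsub])
    show "smooth_on (snd c' ` fst c') (f \<circ> cinv c')" by (rule f_chart_smooth[OF U'(1)])
    show "inj (frechet_derivative (f \<circ> cinv c') (at y))" if "y \<in> snd c' ` fst c'" for y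
      by (rule f_immersion[OF U'(1) that])
    show "?\<phi> ` ?X \<subseteq> snd c' ` fst c'"
    proof (rule image_subsetI)
      fix x assume "x \<in> ?X"
      then obtain p where p: "p \<in> fst c" "f p \<in> f ` U" "x = snd c p" by blast
      then have "inv_into U f (f p) \<in> fst c'" using inv_into_into[of "f p" f U] U'(3) by blast
      then show "?\<phi> x \<in> snd c' ` fst c'" using cinv_chart[OF M c p(1)] p(3) by simp
    qed
    show "(f \<circ> cinv c') (?\<phi> x) = (f \<circ> cinv c) x" if "x \<in> ?X" for x
    proof -
      have m: "f (cinv c x) \<in> f ` U" using mem[OF that] by blast
      have "inv_into U f (f (cinv c x)) \<in> fst c'" using inv_into_into[OF m] U'(3) by blast
      then show ?thesis using cinv_chart[OF M U'(1)] f_inv_into_f[OF m] by simp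
    qed
    have "continuous_map (top_of_set ?X) (subtopology (mtop M) {p \<in> fst c. f p \<in> f ` U}) (cinv c)"
      using continuous_map_from_subtopology_mono[OF continuous_map_cinv[OF M c] Xsub] mem
      by (auto simp: continuous_map_in_subtopology)
    moreover have "continuous_map (subtopology (mtop M) {p \<in> fst c. f p \<in> f ` U}) (top_of_set (f ` U)) f"
    proof -
      have "continuous_map (subtopology (mtop M) {p \<in> fst c. f p \<in> f ` U}) euclidean f"
        using smooth_fun_continuous_map[OF M f_smooth] by (rule continuous_map_from_subtopology)
      then show ?thesis by (auto simp: continuous_map_in_subtopology)
    qed
    moreover have "continuous_map (subtopology (mtop M) U) euclidean (snd c')"
      by (rule continuous_map_from_subtopology_mono[OF continuous_map_chart[OF M U'(1)] U'(3)])
    ultimately have "continuous_map (top_of_set ?X) euclidean (snd c' \<circ> (inv_into U f \<circ> (f \<circ> cinv c)))"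
      by (intro continuous_map_compose[OF continuous_map_compose[OF continuous_map_compose[OF _ _]
              sheet_inverse_continuous[OF U]]])
    then show "continuous_on ?X ?\<phi>" by (simp add: o_assoc)
  qed
qed

section \<open>The smooth structure of the image\<close>

definition image_chart :: "'k set set \<Rightarrow> ('k set, real^'n) chart \<Rightarrow> (real^'N, real^'n) chart" where
  "image_chart U c = (f ` U, snd c \<circ> inv_into U f)"

text \<open>All sheets are used, so no preimage of a point is singled out; charts coming from
  different sheets over the same point are compatible by
  \<open>sheet_transition_smooth\<close>.\<close>

definition S :: "(real^'N, real^'n) mfd" where
  "S = \<lparr>mtop = top_of_set Q, atlas = {image_chart U c | U c. sheet U c}\<rparr>"

lemma mtop_S [simp]: "mtop S = top_of_set Q"
  by (simp add: S_def)

lemma atlas_S: "d \<in> atlas S \<longleftrightarrow> (\<exists>U c. sheet U c \<and> d = image_chart U c)"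
  by (auto simp: S_def)

lemma atlas_SE:
  assumes "d \<in> atlas S"
  obtains U c where "sheet U c" "d = image_chart U c"
  using assms atlas_S by blast

lemma image_chart_in_atlas: "sheet U c \<Longrightarrow> image_chart U c \<in> atlas S"
  using atlas_S by blast

lemma image_chart_f: "sheet U c \<Longrightarrow> x \<in> U \<Longrightarrow> snd (image_chart U c) (f x) = snd c x"
  by (simp add: image_chart_def sheetD(4))

lemma fst_image_chart [simp]: "fst (image_chart U c) = f ` U"
  by (simp add: image_chart_def)

lemma image_chart_charts_at: "sheet U c \<Longrightarrow> x \<in> U \<Longrightarrow> image_chart U c \<in> charts_at S (f x)"
  by (simp add: charts_at_def image_chart_in_atlas)

lemma image_chart_range:
  assumes U: "sheet U c" and A: "A \<subseteq> f ` U"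
  shows "snd (image_chart U c) ` A = snd c ` {x \<in> U. f x \<in> A}"
proof (intro equalityI subsetI)
  fix y assume "y \<in> snd (image_chart U c) ` A"
  then obtain x where "x \<in> U" "f x \<in> A" "y = snd (image_chart U c) (f x)" using A by blast
  then show "y \<in> snd c ` {x \<in> U. f x \<in> A}" using image_chart_f[OF U] by auto
next
  fix y assume "y \<in> snd c ` {x \<in> U. f x \<in> A}"
  then obtain x where "x \<in> U" "f x \<in> A" "y = snd c x" by blast
  then show "y \<in> snd (image_chart U c) ` A" using image_chart_f[OF U] by (metis imageI)
qed

lemma image_chart_full_range: "sheet U c \<Longrightarrow> snd (image_chart U c) ` f ` U = snd c ` U"
  by (subst image_chart_range) auto

lemma image_chart_inj: "sheet U c \<Longrightarrow> inj_on (snd (image_chart U c)) (f ` U)"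
proof (rule inj_onI)
  assume U: "sheet U c"
  fix y z assume "y \<in> f ` U" "z \<in> f ` U" and eq: "snd (image_chart U c) y = snd (image_chart U c) z"
  then obtain a b where ab: "a \<in> U" "y = f a" "b \<in> U" "z = f b" by blast
  then have "snd c a = snd c b" using eq image_chart_f[OF U] by simp
  then have "a = b" using inj_onD[OF chart_inj[OF M sheetD(1)[OF U]]] sheetD(3)[OF U] ab by blast
  then show "y = z" using ab by simp
qed

text \<open>In these coordinates the inclusion of the image into the Euclidean space is the chart
  representation of \<open>f\<close>, so its smoothness and derivative are those of
  \<open>f\<close>.\<close>

lemma cinv_image_chart:
  assumes U: "sheet U c" and y: "y \<in> snd c ` U"
  shows "cinv (image_chart U c) y = f (cinv c y)"
proof -
  obtain x where x: "x \<in> U" "y = snd c x" using y by blast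
  have "cinv c y = x" using x cinv_chart[OF M sheetD(1)[OF U]] sheetD(3)[OF U] by blast
  moreover have "y = snd (image_chart U c) (f x)" using image_chart_f[OF U x(1)] x(2) by simp
  ultimately show ?thesis
    using inv_into_f_f[OF image_chart_inj[OF U], of "f x"] x(1) by (simp add: cinv_def)
qed

lemma image_chart_homeomorphic:
  assumes U: "sheet U c"
  shows "homeomorphic_map (top_of_set (f ` U)) (top_of_set (snd c ` U)) (snd (image_chart U c))"
proof -
  note U' = sheetD[OF U]
  have cU: "continuous_map (subtopology (mtop M) U) (top_of_set (snd c ` U)) (snd c)"
    using continuous_map_from_subtopology_mono[OF continuous_map_chart[OF M U'(1)] U'(3)] U'(5)
    by (auto simp: continuous_map_in_subtopology)
  have cV: "continuous_map (top_of_set (snd c ` U)) (mtop M) (cinv c)"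
    by (rule continuous_map_from_subtopology_mono[OF continuous_map_cinv[OF M U'(1)] image_mono[OF U'(3)]])
  have "continuous_map (top_of_set (snd c ` U)) euclidean (f \<circ> cinv c)"
    by (rule continuous_map_compose[OF cV smooth_fun_continuous_map[OF M f_smooth]])
  moreover have "(f \<circ> cinv c) ` (snd c ` U) \<subseteq> f ` U"
    using U'(3) cinv_chart[OF M U'(1)] by auto
  ultimately have 2: "continuous_map (top_of_set (snd c ` U)) (top_of_set (f ` U)) (f \<circ> cinv c)"
    by (auto simp: continuous_map_in_subtopology)
  have 1: "continuous_map (top_of_set (f ` U)) (top_of_set (snd c ` U)) (snd (image_chart U c))"
    using continuous_map_compose[OF sheet_inverse_continuous[OF U] cU] by (simp add: image_chart_def)
  have "homeomorphic_maps (top_of_set (f ` U)) (top_of_set (snd c ` U)) (snd (image_chart U c)) (f \<circ> cinv c)"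
    unfolding homeomorphic_maps_def
  proof (intro conjI ballI 1 2)
    fix y assume "y \<in> topspace (top_of_set (f ` U))"
    then obtain x where "x \<in> U" "y = f x" by auto
    then show "(f \<circ> cinv c) (snd (image_chart U c) y) = y"
      using image_chart_f[OF U] cinv_chart[OF M U'(1)] U'(3) by (simp add: subset_iff)
  next
    fix y assume "y \<in> topspace (top_of_set (snd c ` U))"
    then obtain x where "x \<in> U" "y = snd c x" by auto
    then show "snd (image_chart U c) ((f \<circ> cinv c) y) = y"
      using image_chart_f[OF U] cinv_chart[OF M U'(1)] U'(3) by (simp add: subset_iff)
  qed
  then show ?thesis using homeomorphic_map_maps by blast
qed

lemma S_manifold: "smooth_manifold S"
  unfolding smooth_manifold_def
proof (intro conjI ballI)
  show "Hausdorff_space (mtop S)" by (simp add: Hausdorff_space_subtopology)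
  show "second_countable_top (mtop S)" by (simp add: second_countable_top_of_set)
  show "(\<Union>d\<in>atlas S. fst d) = points S"
  proof (intro equalityI subsetI)
    fix y assume "y \<in> (\<Union>d\<in>atlas S. fst d)"
    then obtain d where d: "d \<in> atlas S" "y \<in> fst d" by blast
    obtain U c where U: "sheet U c" "d = image_chart U c" by (rule atlas_SE[OF d(1)])
    then show "y \<in> points S" using sheetD(5)[OF U(1)] d(2) by auto
  next
    fix y assume "y \<in> points S"
    then obtain p where p: "p \<in> points M" "y = f p" by auto
    obtain U c where "sheet U c" "p \<in> U" by (rule sheet_exists[OF p(1)])
    then show "y \<in> (\<Union>d\<in>atlas S. fst d)"
      using p(2) by (intro UN_I[of "image_chart U c"]) (simp_all add: image_chart_in_atlas)
  qed
  fix d assume "d \<in> atlas S"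
  then obtain U c where U: "sheet U c" and d: "d = image_chart U c" by (rule atlas_SE)
  note U' = sheetD[OF U]
  show "openin (mtop S) (fst d)" using sheet_image_open[OF U] by (simp add: d)
  have "fst c \<inter> U = U" using U'(3) by blast
  then show "open (snd d ` fst d)"
    using open_chart_image[OF M U'(1,2)] by (simp add: d image_chart_full_range[OF U])
  have "subtopology (mtop S) (fst d) = top_of_set (f ` U)"
    using U'(5) by (simp add: d subtopology_subtopology Int_absorb1 image_mono)
  then show "homeomorphic_map (subtopology (mtop S) (fst d)) (top_of_set (snd d ` fst d)) (snd d)"
    using image_chart_homeomorphic[OF U] by (simp add: d image_chart_full_range[OF U])
  fix d' assume "d' \<in> atlas S"
  then obtain U1 c1 where U1: "sheet U1 c1" and d': "d' = image_chart U1 c1" by (rule atlas_SE)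
  \<comment> \<open>The overlap of the two image charts, seen in the chart \<open>c\<close> of
    \<open>M\<close>; the second sheet enters only through its image under \<open>f\<close>.\<close>
  have range: "snd d ` (fst d \<inter> fst d') = snd c ` {x \<in> U. f x \<in> f ` U1}"
    unfolding d d' fst_image_chart by (subst image_chart_range[OF U]) auto
  have eq: "{x \<in> U. f x \<in> f ` U1} = fst c \<inter> (U \<inter> {x \<in> points M. f x \<in> f ` U1})"
    using U'(3,5) by blast
  have "open (snd c ` {x \<in> U. f x \<in> f ` U1})"
    unfolding eq
    by (rule open_chart_image[OF M U'(1)])
      (rule openin_Int[OF U'(2) openin_continuous_map_preimage[OF f_continuous sheet_image_open[OF U1]]])
  then show "smooth_on (snd d ` (fst d \<inter> fst d')) (snd d' \<circ> cinv d)"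
    unfolding range
  proof (rule smooth_on_cong)
    show "smooth_on (snd c ` {x \<in> U. f x \<in> f ` U1}) (snd c1 \<circ> inv_into U1 f \<circ> f \<circ> cinv c)"
      by (rule smooth_on_subset[OF sheet_transition_smooth(2)[OF U'(1) U1]]) (use U'(3) in auto)
    fix y assume "y \<in> snd c ` {x \<in> U. f x \<in> f ` U1}"
    then have "y \<in> snd c ` U" by blast
    then show "(snd c1 \<circ> inv_into U1 f \<circ> f \<circ> cinv c) y = (snd d' \<circ> cinv d) y"
      by (simp add: d d' cinv_image_chart[OF U]) (simp add: image_chart_def)
  qed
qed

lemma S_chart_smooth:
  assumes U: "sheet U c"
  shows "smooth_on (snd c ` U) (f \<circ> cinv c)" "open (snd c ` U)"
proof -
  note U' = sheetD[OF U]
  have "fst c \<inter> U = U" using U'(3) by blast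
  then show "open (snd c ` U)" using open_chart_image[OF M U'(1,2)] by simp
  show "smooth_on (snd c ` U) (f \<circ> cinv c)"
    by (rule smooth_on_subset[OF f_chart_smooth[OF U'(1)] image_mono[OF U'(3)]])
qed

lemma S_inclusion_smooth: "smooth_fun S (\<lambda>x. x)"
  unfolding smooth_fun_def
proof
  fix d assume "d \<in> atlas S"
  then obtain U c where U: "sheet U c" and d: "d = image_chart U c" by (rule atlas_SE)
  show "smooth_on (snd d ` fst d) ((\<lambda>x. x) \<circ> cinv d)"
    unfolding d fst_image_chart image_chart_full_range[OF U]
    by (rule smooth_on_cong[OF S_chart_smooth(2)[OF U] _ S_chart_smooth(1)[OF U]])
      (simp add: cinv_image_chart[OF U])
qed

lemma S_inclusion_derivative:
  assumes U: "sheet U c" and y: "y \<in> snd c ` U"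
  shows "((\<lambda>x. x) \<circ> cinv (image_chart U c) has_derivative frechet_derivative (f \<circ> cinv c) (at y)) (at y)"
proof (rule has_derivative_transform_within_open[OF smooth_on_has_derivative[OF S_chart_smooth(1)[OF U] y]
      S_chart_smooth(2)[OF U] y])
  show "(f \<circ> cinv c) z = ((\<lambda>x. x) \<circ> cinv (image_chart U c)) z" if "z \<in> snd c ` U" for z
    using cinv_image_chart[OF U that] by simp
qed

lemma S_chart_at_point:
  assumes "d \<in> charts_at S q"
  obtains U c x where "sheet U c" "d = image_chart U c" "x \<in> U" "q = f x" "snd d q = snd c x"
proof -
  have d: "d \<in> atlas S" "q \<in> fst d" using assms by (auto simp: charts_at_def)
  obtain U c where U: "sheet U c" "d = image_chart U c" by (rule atlas_SE[OF d(1)])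
  then obtain x where "x \<in> U" "q = f x" using d(2) by auto
  then show thesis using that[OF U] image_chart_f[OF U(1)] U(2) by simp
qed

lemma S_inclusion_dfun:
  assumes U: "sheet U c" and x: "x \<in> U" and v: "v \<in> tangent_space S (f x)"
  shows "dfun S (\<lambda>x. x) (f x) v = frechet_derivative (f \<circ> cinv c) (at (snd c x)) (v (image_chart U c))"
proof (rule dfun_chart[OF S_manifold _ v])
  show "image_chart U c \<in> charts_at S (f x)" by (rule image_chart_charts_at[OF U x])
  show "((\<lambda>x. x) \<circ> cinv (image_chart U c) has_derivative frechet_derivative (f \<circ> cinv c) (at (snd c x)))
      (at (snd (image_chart U c) (f x)))"
    using S_inclusion_derivative[OF U, of "snd c x"] x by (simp add: image_chart_f[OF U x])
qed

lemma S_inclusion_immersion: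
  assumes q: "q \<in> Q"
  shows "inj_on (dfun S (\<lambda>x. x) q) (tangent_space S q)"
proof (rule inj_onI)
  fix v w assume v: "v \<in> tangent_space S q" and w: "w \<in> tangent_space S q"
    and eq: "dfun S (\<lambda>x. x) q v = dfun S (\<lambda>x. x) q w"
  have qS: "q \<in> points S" using q by simp
  note d = chart_at_in[OF S_manifold qS]
  obtain U c x where U: "sheet U c" "chart_at S q = image_chart U c" and x: "x \<in> U" "q = f x"
    by (rule S_chart_at_point[OF d])
  have "inj (frechet_derivative (f \<circ> cinv c) (at (snd c x)))"
    using f_immersion[OF sheetD(1)[OF U(1)]] x(1) sheetD(3)[OF U(1)] by blast
  then have "v (image_chart U c) = w (image_chart U c)"
    using eq v w S_inclusion_dfun[OF U(1) x(1)] x(2) by (simp add: inj_eq)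
  then show "v = w" using tangent_eqI[OF S_manifold d v w] U(2) by simp
qed

lemma S_embedded: "embedded_submanifold S Q"
  unfolding embedded_submanifold_def
  using S_manifold S_inclusion_smooth S_inclusion_immersion by simp

lemma S_inclusion_differentiable: "q \<in> points S \<Longrightarrow> mdifferentiable S (\<lambda>x. x) q"
  by (rule smooth_fun_mdifferentiable[OF S_manifold S_inclusion_smooth])

section \<open>The induced metric and the local isometry property\<close>

lemma induced_metric_riemannian: "riemannian_metric S (induced_metric S)"
  unfolding riemannian_metric_def
proof (intro conjI ballI allI impI)
  fix q assume q: "q \<in> points S"
  show "induced_metric S q v w = induced_metric S q w v" for v w
    by (simp add: induced_metric_def pullback_euclidean_def inner_commute)
  show "induced_metric S q (\<lambda>c. a *\<^sub>R v c + b *\<^sub>R w c) z = a * induced_metric S q v z + b * induced_metric S q w z"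
    if "v \<in> tangent_space S q" "w \<in> tangent_space S q" for a b v w z
    using dfun_linear[OF S_manifold S_inclusion_differentiable[OF q] that]
    by (simp add: induced_metric_def pullback_euclidean_def inner_add_left)
  fix v assume v: "v \<in> tangent_space S q" "v \<noteq> (\<lambda>_. 0)"
  note z = zero_in_tangent[OF S_manifold chart_at_in[OF S_manifold q]]
  have "dfun S (\<lambda>x. x) q (\<lambda>_. 0) = 0"
    using dfun_linear[OF S_manifold S_inclusion_differentiable[OF q] z z, of 0 0] by simp
  then have "dfun S (\<lambda>x. x) q v \<noteq> 0"
    using inj_onD[OF S_inclusion_immersion _ v(1) z] q v(2) by fastforce
  then show "0 < induced_metric S q v v" by (simp add: induced_metric_def pullback_euclidean_def)
next
  fix d e e' assume "d \<in> atlas S"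
  then obtain U c where U: "sheet U c" and d: "d = image_chart U c" by (rule atlas_SE)
  let ?D = "\<lambda>y. frechet_derivative (f \<circ> cinv c) (at y)"
  have "smooth_on (snd c ` U) (\<lambda>y. ?D y e \<bullet> ?D y e')"
    using smooth_on_frechet_derivative[OF S_chart_smooth(1)[OF U]] S_chart_smooth(2)[OF U]
    unfolding smooth_on_def by (intro allI Ck_on_inner) auto
  then show "smooth_on (snd d ` fst d)
      (\<lambda>y. induced_metric S (cinv d y) (coord_vec S d (cinv d y) e) (coord_vec S d (cinv d y) e'))"
    unfolding d fst_image_chart image_chart_full_range[OF U]
  proof (rule smooth_on_cong[OF S_chart_smooth(2)[OF U], rotated])
    fix y assume "y \<in> snd c ` U"
    then obtain x where x: "x \<in> U" "y = snd c x" by blast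
    have cd: "cinv (image_chart U c) y = f x"
      using cinv_image_chart[OF U] x f_cinv_charts[OF sheetD(1)[OF U]] sheetD(3)[OF U] by auto
    have at: "image_chart U c \<in> charts_at S (f x)" by (rule image_chart_charts_at[OF U x(1)])
    show "?D y e \<bullet> ?D y e' = induced_metric S (cinv (image_chart U c) y)
        (coord_vec S (image_chart U c) (cinv (image_chart U c) y) e)
        (coord_vec S (image_chart U c) (cinv (image_chart U c) y) e')"
      by (simp add: cd[unfolded x(2)] induced_metric_def pullback_euclidean_def x(2)
          S_inclusion_dfun[OF U x(1) coord_vec_in_tangent_space[OF S_manifold at]] coord_vec_apply[OF S_manifold at])
  qed
qed

lemma f_smooth_map: "smooth_map M S f"
  unfolding smooth_map_def
proof (intro conjI ballI)
  show "continuous_map (mtop M) (mtop S) f" using f_continuous by simp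
  fix c d assume c: "c \<in> atlas M" and "d \<in> atlas S"
  from \<open>d \<in> atlas S\<close> obtain U c' where U: "sheet U c'" and d: "d = image_chart U c'" by (rule atlas_SE)
  show "smooth_on (snd c ` {p \<in> fst c. f p \<in> fst d}) (snd d \<circ> f \<circ> cinv c)"
    using sheet_transition_smooth(2)[OF c U] by (simp add: d image_chart_def o_assoc)
qed

lemma f_differentiable_map: "p \<in> points M \<Longrightarrow> mdifferentiable_map M S f p"
  by (rule smooth_map_mdifferentiable_map[OF M S_manifold f_smooth_map])

text \<open>The inclusion of the image composed with \<open>f\<close> is \<open>f\<close> again, so
  by the chain rule the induced metric pulls back to the form already known to be proportional to
  \<open>g\<close>.\<close>

lemma f_dilation:
  assumes p: "p \<in> points M" and v: "v \<in> tangent_space M p" and w: "w \<in> tangent_space M p"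
  shows "induced_metric S (f p) (differential M S f p v) (differential M S f p w) = scale * g p v w"
proof -
  have fp: "f p \<in> points S" using p by simp
  have "dfun S (\<lambda>x. x) (f p) (differential M S f p v) = dfun M f p v" if "v \<in> tangent_space M p" for v
    using mdifferentiable_compose(3)[OF M S_manifold _ f_differentiable_map[OF p] S_inclusion_differentiable[OF fp] p that]
      f_continuous by (simp add: o_def)
  then show ?thesis
    using pullback_scale[OF p v w] v w by (simp add: induced_metric_def pullback_euclidean_def)
qed

text \<open>\<open>cinv\<close> depends on the domain of the chart through \<open>inv_into\<close>,
  and the charts of \<open>open_submfd\<close> have smaller domains.\<close>

lemma cinv_restrict:
  assumes "c \<in> atlas M" "A \<subseteq> fst c" "y \<in> snd c ` A"
  shows "cinv (A, snd c) y = cinv c y"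
proof -
  obtain x where x: "x \<in> A" "y = snd c x" using assms(3) by blast
  have "inj_on (snd c) A" using chart_inj[OF M assms(1)] assms(2) by (rule inj_on_subset)
  then show ?thesis using x assms(2) cinv_chart[OF M assms(1)] by (auto simp: cinv_def)
qed

lemma cinv_restrict_S:
  assumes U: "sheet U c" and "A \<subseteq> f ` U" "y \<in> snd (image_chart U c) ` A"
  shows "cinv (A, snd (image_chart U c)) y = f (cinv c y)"
proof -
  obtain q where q: "q \<in> A" "y = snd (image_chart U c) q" using assms(3) by blast
  then obtain x where x: "x \<in> U" "q = f x" using assms(2) by blast
  have "inj_on (snd (image_chart U c)) A" using image_chart_inj[OF U] assms(2) by (rule inj_on_subset)
  then have "cinv (A, snd (image_chart U c)) y = f x" using q x by (simp add: cinv_def)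
  moreover have "cinv c y = x"
    using q(2) x image_chart_f[OF U x(1)] cinv_chart[OF M sheetD(1)[OF U]] sheetD(3)[OF U] by auto
  ultimately show ?thesis by simp
qed

lemma f_local_diffeomorphism: "local_diffeomorphism M S f"
  unfolding local_diffeomorphism_def
proof
  fix p assume p: "p \<in> points M"
  obtain U c where U: "sheet U c" "p \<in> U" by (rule sheet_exists[OF p])
  note U' = sheetD[OF U(1)]
  have top: "points (open_submfd M U) = U" "points (open_submfd S (f ` U)) = f ` U"
    using U'(5) by (auto simp: open_submfd_def)
  have topS: "mtop (open_submfd S (f ` U)) = top_of_set (f ` U)"
    using U'(5) by (simp add: open_submfd_def subtopology_subtopology Int_absorb1 image_mono)
  have topM: "mtop (open_submfd M U) = subtopology (mtop M) U" by (simp add: open_submfd_def)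
  have "diffeomorphism (open_submfd M U) (open_submfd S (f ` U)) f"
    unfolding diffeomorphism_def top
  proof (intro conjI)
    show "bij_betw f U (f ` U)" using U'(4) by (simp add: bij_betw_def)
    show "smooth_map (open_submfd M U) (open_submfd S (f ` U)) f"
      unfolding smooth_map_def topM topS
    proof (intro conjI ballI)
      show "continuous_map (subtopology (mtop M) U) (top_of_set (f ` U)) f"
        by (rule homeomorphic_imp_continuous_map[OF sheet_homeomorphic[OF U(1)]])
      fix a b assume "a \<in> atlas (open_submfd M U)" "b \<in> atlas (open_submfd S (f ` U))"
      note ab = this
      obtain c1 where c1: "c1 \<in> atlas M" "a = (U \<inter> fst c1, snd c1)" by (rule atlas_open_submfdE[OF ab(1)])
      obtain b1 where b1: "b1 \<in> atlas S" "b = (f ` U \<inter> fst b1, snd b1)" by (rule atlas_open_submfdE[OF ab(2)])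
      obtain U2 c2 where U2: "sheet U2 c2" "b1 = image_chart U2 c2" by (rule atlas_SE[OF b1(1)])
      then have "b = (f ` U \<inter> f ` U2, snd (image_chart U2 c2))" using b1(2) by simp
      note U2 = U2(1) this
      let ?X = "snd c1 ` {q \<in> U \<inter> fst c1. f q \<in> f ` U2}"
      have X: "snd a ` {q \<in> fst a. f q \<in> fst b} = ?X" by (auto simp: c1(2) U2(2))
      have "{q \<in> U \<inter> fst c1. f q \<in> f ` U2} = fst c1 \<inter> (U \<inter> {q \<in> points M. f q \<in> f ` U2})"
        using U'(5) by blast
      then have o: "open ?X"
        using open_chart_image[OF M c1(1) openin_Int[OF U'(2) openin_continuous_map_preimage[OF f_continuous sheet_image_open[OF U2(1)]]]]
        by simp
      show "smooth_on (snd a ` {q \<in> fst a. f q \<in> fst b}) (snd b \<circ> f \<circ> cinv a)"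
        unfolding X
      proof (rule smooth_on_cong[OF o])
        show "smooth_on ?X (snd c2 \<circ> inv_into U2 f \<circ> f \<circ> cinv c1)"
          by (rule smooth_on_subset[OF sheet_transition_smooth(2)[OF c1(1) U2(1)]]) auto
        fix y assume "y \<in> ?X"
        then have "cinv a y = cinv c1 y"
          unfolding c1(2) by (intro cinv_restrict[OF c1(1)]) auto
        then show "(snd c2 \<circ> inv_into U2 f \<circ> f \<circ> cinv c1) y = (snd b \<circ> f \<circ> cinv a) y"
          by (simp add: U2(2) image_chart_def)
      qed
    qed
    show "smooth_map (open_submfd S (f ` U)) (open_submfd M U) (inv_into U f)"
      unfolding smooth_map_def topM topS
    proof (intro conjI ballI)
      show "continuous_map (top_of_set (f ` U)) (subtopology (mtop M) U) (inv_into U f)"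
        by (rule sheet_inverse_continuous[OF U(1)])
      fix b a assume "a \<in> atlas (open_submfd M U)" "b \<in> atlas (open_submfd S (f ` U))"
      note ab = this
      obtain c1 where c1: "c1 \<in> atlas M" "a = (U \<inter> fst c1, snd c1)" by (rule atlas_open_submfdE[OF ab(1)])
      obtain b1 where b1: "b1 \<in> atlas S" "b = (f ` U \<inter> fst b1, snd b1)" by (rule atlas_open_submfdE[OF ab(2)])
      obtain U2 c2 where U2: "sheet U2 c2" "b1 = image_chart U2 c2" by (rule atlas_SE[OF b1(1)])
      then have "b = (f ` U \<inter> f ` U2, snd (image_chart U2 c2))" using b1(2) by simp
      note U2 = U2(1) this
      \<comment> \<open>On the smaller sheet \<open>?U1\<close>, which lies in the domain of
        \<open>c1\<close>, the inverse of \<open>f\<close> agrees with the one on \<open>U\<close>.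
        So the local inverse is again represented by a map of the form treated in
        \<open>sheet_transition_smooth\<close>.\<close>
      let ?U1 = "U \<inter> fst c1"
      have U1: "sheet ?U1 c1"
        using c1(1) U'(4) openin_Int[OF U'(2) chart_openin[OF M c1(1)]] by (auto simp: sheet_def intro: inj_on_subset)
      note U2' = sheetD[OF U2(1)]
      let ?X = "snd c2 ` {q \<in> U2. f q \<in> f ` ?U1}"
      have inv: "inv_into U f (f x) = x" if "x \<in> U" for x using U'(4) that by simp
      have sets: "{q \<in> fst b. inv_into U f q \<in> fst a} = f ` U2 \<inter> f ` ?U1"
      proof (intro equalityI subsetI)
        fix q assume "q \<in> {q \<in> fst b. inv_into U f q \<in> fst a}"
        then have q: "q \<in> f ` U2" "q \<in> f ` U" "inv_into U f q \<in> ?U1" by (auto simp: U2(2) c1(2))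
        then show "q \<in> f ` U2 \<inter> f ` ?U1" using f_inv_into_f[OF q(2)] by (metis IntI imageI)
      next
        fix q assume "q \<in> f ` U2 \<inter> f ` ?U1"
        then show "q \<in> {q \<in> fst b. inv_into U f q \<in> fst a}" using inv by (auto simp: U2(2) c1(2))
      qed
      have X: "snd b ` {q \<in> fst b. inv_into U f q \<in> fst a} = ?X"
        unfolding sets by (simp add: U2(2) image_chart_range[OF U2(1)]) (rule arg_cong[where f = "image (snd c2)"], auto)
      have "{q \<in> U2. f q \<in> f ` ?U1} = fst c2 \<inter> (U2 \<inter> {q \<in> points M. f q \<in> f ` ?U1})"
        using U2'(3,5) by blast
      then have o: "open ?X"
        using open_chart_image[OF M U2'(1) openin_Int[OF U2'(2) openin_continuous_map_preimage[OF f_continuous sheet_image_open[OF U1]]]]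
        by simp
      show "smooth_on (snd b ` {q \<in> fst b. inv_into U f q \<in> fst a}) (snd a \<circ> inv_into U f \<circ> cinv b)"
        unfolding X
      proof (rule smooth_on_cong[OF o])
        show "smooth_on ?X (snd c1 \<circ> inv_into ?U1 f \<circ> f \<circ> cinv c2)"
          by (rule smooth_on_subset[OF sheet_transition_smooth(2)[OF U2'(1) U1]]) (use U2'(3) in auto)
        fix y assume "y \<in> ?X"
        then obtain q where q: "q \<in> U2" "y = snd c2 q" "f q \<in> f ` ?U1" by blast
        then obtain z where z: "z \<in> ?U1" "f q = f z" by blast
        have cq: "cinv c2 y = q" using q U2'(3) cinv_chart[OF M U2'(1)] by auto
        have "y \<in> snd (image_chart U2 c2) ` (f ` U \<inter> f ` U2)"
          using image_chart_f[OF U2(1) q(1)] q z by (metis Int_iff imageI)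
        then have "cinv b y = f q"
          unfolding U2(2) by (subst cinv_restrict_S[OF U2(1)]) (auto simp: cq)
        moreover have "inv_into ?U1 f (f z) = z" using sheetD(4)[OF U1] z(1) by simp
        ultimately show "(snd c1 \<circ> inv_into ?U1 f \<circ> f \<circ> cinv c2) y = (snd a \<circ> inv_into U f \<circ> cinv b) y"
          using z inv[of z] by (simp add: c1(2) cq)
      qed
    qed
  qed
  then show "\<exists>U. p \<in> U \<and> openin (mtop M) U \<and> openin (mtop S) (f ` U) \<and>
      diffeomorphism (open_submfd M U) (open_submfd S (f ` U)) f"
    using U(2) U'(2) sheet_image_open[OF U(1)] by auto
qed

section \<open>The volume of the image\<close>

abbreviation "\<nu> \<equiv> riemannian_measure S (induced_metric S)"

lemma nu: "volume_measure S (induced_metric S) \<nu>"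
  by (rule riemannian_measure_volume_measure[OF S_manifold induced_metric_riemannian]) (use points_ne in auto)

text \<open>A continuous image of a Borel set need not be Borel; on a sheet it is a preimage under
  the continuous inverse of \<open>f\<close>.\<close>

lemma sheet_image_borel:
  assumes U: "sheet U c" and A: "A \<in> sets (borel_space M)" "A \<subseteq> U"
  shows "f ` A \<in> sets (borel_space S)"
proof (cases "A = {}")
  case False
  then obtain p0 where p0: "p0 \<in> A" by blast
  note U' = sheetD[OF U]
  have fU: "f ` U \<in> sets (borel_space S)"
    using sheet_image_open[OF U] by (intro openin_borel_space) simp
  let ?k = "\<lambda>y. if y \<in> f ` U then inv_into U f y else p0"
  have inv: "inv_into U f (f x) = x" if "x \<in> U" for x using U'(4) that by simp
  have "?k \<in> measurable (borel_space S) (borel_space M)"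
  proof (rule measurable_to_borel_space)
    show "?k y \<in> points M" for y using inv p0 A(2) U'(5) by auto
    fix W assume W: "openin (mtop M) W"
    have "f ` (U \<inter> W) \<in> sets (borel_space S)"
      using f_open openin_Int[OF U'(2) W] unfolding open_map_def by (intro openin_borel_space) simp
    moreover have "?k -` W \<inter> space (borel_space S) = f ` (U \<inter> W) \<union> (if p0 \<in> W then space (borel_space S) - f ` U else {})"
    proof (rule Set.set_eqI)
      fix y
      show "y \<in> ?k -` W \<inter> space (borel_space S) \<longleftrightarrow> y \<in> f ` (U \<inter> W) \<union> (if p0 \<in> W then space (borel_space S) - f ` U else {})"
      proof (cases "y \<in> f ` U")
        case True
        then obtain x where x: "x \<in> U" "y = f x" by blast
        then have "f x \<in> f ` (U \<inter> W) \<longleftrightarrow> x \<in> W" using inj_onD[OF U'(4)] by blast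
        then show ?thesis using x U'(5) True inv[OF x(1)] by auto
      qed auto
    qed
    moreover have "space (borel_space S) - f ` U \<in> sets (borel_space S)"
      using fU by (rule sets.compl_sets)
    ultimately show "?k -` W \<inter> space (borel_space S) \<in> sets (borel_space S)"
      by (cases "p0 \<in> W") (simp_all only: if_True if_False sets.Un sets.empty_sets)
  qed
  from measurable_sets[OF this A(1)] fU
  have "(?k -` A \<inter> space (borel_space S)) \<inter> f ` U \<in> sets (borel_space S)" by blast
  moreover have "(?k -` A \<inter> space (borel_space S)) \<inter> f ` U = f ` A"
  proof (rule Set.set_eqI)
    fix y
    show "y \<in> (?k -` A \<inter> space (borel_space S)) \<inter> f ` U \<longleftrightarrow> y \<in> f ` A"
    proof (cases "y \<in> f ` U")
      case True
      then obtain x where x: "x \<in> U" "y = f x" by blast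
      then have "f x \<in> f ` A \<longleftrightarrow> x \<in> A" using inj_onD[OF U'(4)] A(2) by blast
      then show ?thesis using x U'(5) True inv[OF x(1)] by auto
    next
      case False
      then show ?thesis using A(2) by blast
    qed
  qed
  ultimately show ?thesis by simp
qed simp

lemma emeasure_sheet:
  assumes U: "sheet U c" and B: "B \<in> sets (borel_space M)" "B \<subseteq> U"
  shows "emeasure \<nu> (f ` B) = ennreal (scale powr (real CARD('n) / 2)) * emeasure \<mu> B"
proof (rule volume_measure_dilation[OF M S_manifold metric induced_metric_riemannian mu nu _
      f_differentiable_map f_dilation scale_pos B(1)])
  show "continuous_map (mtop M) (mtop S) f" using f_continuous by simp
  show "f ` A \<in> sets (borel_space S)" if "A \<in> sets (borel_space M)" "A \<subseteq> B" for A
    using sheet_image_borel[OF U that(1)] that(2) B(2) by blast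
  show "inj_on f B" using sheetD(4)[OF U] B(2) by (rule inj_on_subset)
qed

text \<open>Each of the \<open>deg\<close> sheets over \<open>T\<close> contains exactly one copy of
  \<open>P\<close>, and \<open>f\<close> scales its measure by the same factor.\<close>

lemma emeasure_evenly_covered:
  assumes \<V>: "\<Union>\<V> = {x \<in> points M. f x \<in> T}" "\<And>U. U \<in> \<V> \<Longrightarrow> \<exists>c. sheet U c" "\<And>U. U \<in> \<V> \<Longrightarrow> f ` U = T"
    "pairwise disjnt \<V>" "finite \<V>" "card \<V> = deg"
    and P: "P \<in> sets (borel_space S)" "P \<subseteq> T"
  shows "ennreal (scale powr (real CARD('n) / 2)) * emeasure \<mu> {x \<in> points M. f x \<in> P} = of_nat deg * emeasure \<nu> P"
proof -
  let ?k = "ennreal (scale powr (real CARD('n) / 2))"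
  let ?B = "{x \<in> points M. f x \<in> P}"
  have B: "?B \<in> sets (borel_space M)"
    by (rule continuous_map_preimage_sets[OF _ P(1)]) (use f_continuous in simp)
  have sheets: "U \<inter> ?B \<in> sets (borel_space M)" if U: "U \<in> \<V>" for U
  proof -
    obtain c where "sheet U c" using \<V>(2)[OF U] by blast
    then show ?thesis using openin_borel_space[OF sheetD(2)] B by blast
  qed
  have "?B = (\<Union>U\<in>\<V>. U \<inter> ?B)" using \<V>(1) P(2) by blast
  then have "emeasure \<mu> ?B = emeasure \<mu> (\<Union>U\<in>\<V>. U \<inter> ?B)" by simp
  also have "\<dots> = (\<Sum>U\<in>\<V>. emeasure \<mu> (U \<inter> ?B))"
  proof (rule sum_emeasure[symmetric])
    show "(\<lambda>U. U \<inter> ?B) ` \<V> \<subseteq> sets \<mu>" using sheets by (auto simp: sets_mu)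
    show "disjoint_family_on (\<lambda>U. U \<inter> ?B) \<V>"
      using \<V>(4) unfolding disjoint_family_on_def pairwise_def disjnt_def by blast
  qed (rule \<V>(5))
  finally have "?k * emeasure \<mu> ?B = (\<Sum>U\<in>\<V>. ?k * emeasure \<mu> (U \<inter> ?B))" by (simp only: sum_distrib_left)
  also have "\<dots> = (\<Sum>U\<in>\<V>. emeasure \<nu> P)"
  proof (rule sum.cong[OF refl])
    fix U assume U: "U \<in> \<V>"
    then obtain c where c: "sheet U c" using \<V>(2) by blast
    have "f ` (U \<inter> ?B) = P" using \<V>(3)[OF U] P(2) sheetD(5)[OF c] by blast
    then show "?k * emeasure \<mu> (U \<inter> ?B) = emeasure \<nu> P"
      using emeasure_sheet[OF c sheets[OF U]] by simp
  qed
  finally show ?thesis using \<V>(6) by simp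
qed

lemma emeasure_image: "ennreal (scale powr (real CARD('n) / 2)) * emeasure \<mu> (points M) = of_nat deg * emeasure \<nu> Q"
proof -
  \<comment> \<open>The formula is required for all Borel subsets of \<open>T\<close>, not just for
    \<open>T\<close>: this is what survives when a countable cover by such sets is made disjoint,
    whose pieces are no longer open.\<close>
  define \<T> where "\<T> = {T. openin (top_of_set Q) T \<and> (\<forall>P\<in>sets (borel_space S). P \<subseteq> T \<longrightarrow>
    ennreal (scale powr (real CARD('n) / 2)) * emeasure \<mu> {x \<in> points M. f x \<in> P} = of_nat deg * emeasure \<nu> P)}"
  have cover: "\<Union>\<T> = topspace (top_of_set Q)"
  proof (intro equalityI subsetI)
    show "y \<in> topspace (top_of_set Q)" if "y \<in> \<Union>\<T>" for y
      using that openin_subset by (fastforce simp: \<T>_def)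
    fix y assume "y \<in> topspace (top_of_set Q)"
    then have y: "y \<in> Q" by simp
    obtain T \<V> where TV: "y \<in> T" "openin (top_of_set Q) T" "\<Union>\<V> = {x \<in> points M. f x \<in> T}"
      "\<And>U. U \<in> \<V> \<Longrightarrow> \<exists>c. sheet U c" "\<And>U. U \<in> \<V> \<Longrightarrow> f ` U = T" "pairwise disjnt \<V>"
      "finite \<V>" "card \<V> = deg" by (rule evenly_covered[OF y]) blast
    have "T \<in> \<T>"
      unfolding \<T>_def using TV(2) emeasure_evenly_covered[OF TV(3-8)] by simp
    then show "y \<in> \<Union>\<T>" using TV(1) by blast
  qed
  have "\<And>T. T \<in> \<T> \<Longrightarrow> openin (top_of_set Q) T" by (simp add: \<T>_def)
  from countable_subcover[OF second_countable_top_of_set this cover]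
  obtain \<C> where C: "countable \<C>" "\<C> \<subseteq> \<T>" "\<Union>\<C> = topspace (top_of_set Q)" by blast
  have Cne: "\<C> \<noteq> {}" using C(3) points_ne by auto
  let ?T = "from_nat_into \<C>"
  have T: "?T i \<in> \<T>" for i using from_nat_into[OF Cne] C(2) by blast
  have UT: "(\<Union>i. ?T i) = Q" using range_from_nat_into[OF Cne C(1)] C(3) by simp
  define P where "P = disjointed ?T"
  have "?T i \<in> sets (borel_space S)" for i
    using T[of i] by (intro openin_borel_space) (simp add: \<T>_def)
  then have P: "P i \<in> sets (borel_space S)" for i
    unfolding P_def using sets.range_disjointed_sets[of ?T] by blast
  have PT: "P i \<subseteq> ?T i" for i unfolding P_def by (rule disjointed_subset)
  have Pdis: "disjoint_family P" unfolding P_def by (rule disjoint_family_disjointed)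
  have PU: "(\<Union>i. P i) = Q" unfolding P_def by (simp add: UN_disjointed_eq UT)
  have eq: "ennreal (scale powr (real CARD('n) / 2)) * emeasure \<mu> {x \<in> points M. f x \<in> P i} = of_nat deg * emeasure \<nu> (P i)" for i
    using T[of i] P[of i] PT[of i] by (simp add: \<T>_def)
  have "emeasure \<mu> (points M) = (\<Sum>i. emeasure \<mu> (points M \<inter> {x \<in> points M. f x \<in> P i}))"
  proof (rule emeasure_partition)
    show "{x \<in> points M. f x \<in> P i} \<in> sets \<mu>" for i
      using continuous_map_preimage_sets[of M S f, OF _ P] f_continuous by (simp add: sets_mu)
    show "disjoint_family (\<lambda>i. {x \<in> points M. f x \<in> P i})"
      using Pdis unfolding disjoint_family_on_def by blast
    show "points M \<subseteq> (\<Union>i. {x \<in> points M. f x \<in> P i})" using PU by blast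
    show "points M \<in> sets \<mu>" using sets.top[of \<mu>] by (simp add: space_mu)
  qed
  also have "\<dots> = (\<Sum>i. emeasure \<mu> {x \<in> points M. f x \<in> P i})"
    by (rule suminf_cong, rule arg_cong[where f = "emeasure \<mu>"]) blast
  finally have "ennreal (scale powr (real CARD('n) / 2)) * emeasure \<mu> (points M) = (\<Sum>i. of_nat deg * emeasure \<nu> (P i))"
    by (simp only: eq[symmetric] ennreal_suminf_cmult)
  also have "\<dots> = of_nat deg * (\<Sum>i. emeasure \<nu> (P i))" by (rule ennreal_suminf_cmult)
  also have "(\<Sum>i. emeasure \<nu> (P i)) = emeasure \<nu> Q"
    using suminf_emeasure[of P \<nu>] P Pdis volume_measureD(2)[OF nu] by (simp add: PU image_subset_iff)
  finally show ?thesis .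
qed

lemma volume_image: "riemannian_volume S (induced_metric S) = 1 / real deg * scale powr (real CARD('n) / 2) * V"
proof -
  have "scale powr (real CARD('n) / 2) * measure \<mu> (points M) = real deg * measure \<nu> Q"
    using arg_cong[OF emeasure_image, of enn2real]
    by (simp add: enn2real_mult measure_def ennreal_of_nat_eq_real_of_nat)
  then show ?thesis
    using deg_pos by (simp add: riemannian_volume_def field_simps)
qed

lemma f_sphere: "Q \<subseteq> sphere 0 (sqrt (real CARD('N) / V))"
  using inner_f by (auto simp: norm_eq_sqrt_inner)

lemma f_local_isometry: "local_isometry_up_to_dilation M g S (induced_metric S) f"
  unfolding local_isometry_up_to_dilation_def
  using f_local_diffeomorphism f_dilation scale_pos by blast

end

theorem theorem2p4:
  fixes K :: "('k, 'b) monoid_scheme"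
    and KM :: "('k, 'd::euclidean_space) mfd"
    and L :: "'k set"
    and M :: "('k set, real^'n) mfd"
    and g :: "('k set, real^'n) metric"
    and lam :: real
    and H :: "('k set \<Rightarrow> real) set"
    and f :: "'k set \<Rightarrow> real^'N"
  assumes "lie_group K KM" and "connected_space (mtop KM)" and "compact_space (mtop KM)"
    and "subgroup L K" and "closedin (mtop KM) L"
    and "homogeneous_space K KM L M"
    and "riemannian_metric M g" and "invariant_metric K M g"
    and "lam > 0" and "eigenspace M g lam \<noteq> {\<lambda>_. 0}"
    and "H \<subseteq> eigenspace M g lam" and "function_subspace H" and "H \<noteq> {\<lambda>_. 0}"
    and "invariant_functions K M H"
    and "orthonormal_basis M g H f"
    and "isotropy_irreducible K L M"
  defines "N \<equiv> real CARD('N)" and "n \<equiv> real CARD('n)" and "V \<equiv> riemannian_volume M g"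
  shows "\<exists>(S :: (real^'N, real^'n) mfd) d.
           embedded_submanifold S (f ` points M) \<and>
           covering_of_degree (mtop M) (mtop S) f d \<and>
           local_isometry_up_to_dilation M g S (induced_metric S) f \<and>
           (\<forall>p\<in>points M. \<forall>v\<in>tangent_space M p. \<forall>w\<in>tangent_space M p.
              pullback_euclidean M f p v w = lam * N / (n * V) * g p v w) \<and>
           f ` points M \<subseteq> sphere 0 (sqrt (N / V)) \<and>
           riemannian_volume S (induced_metric S) = 1 / real d * (lam * N / (n * V)) powr (n / 2) * V"
proof -
  interpret eigenmap K KM L M g lam H f
    by (intro eigenmap.intro homogeneous_manifold.intro eigenmap_axioms.intro assms)
  show ?thesis
    unfolding N_def n_def V_def
  proof (intro exI[of _ S] exI[of _ deg] conjI ballI)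
    show "covering_of_degree (mtop M) (mtop S) f deg" using f_covering by simp
  qed (fact S_embedded f_local_isometry f_sphere volume_image[unfolded scale_def] | rule pullback_eq; assumption)+
qed

end
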